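(* Let $M$ be an $F$-structure manifold of degree $K$. The following conditions are equivalent, where each of the identities (iii), (iv) is required for all vector fields $X,Y$ on $M$: (i) the operators $l$ and $m$ are integrable; (ii) the distributions $D_l$ and $D_m$ are integrable; (iii) $N_l(X,Y)=0$; (iv) $N_F(X,Y)=l\,N_F(lX,lY)+N_F(lX,mY)+N_F(mX,lY)$.
   Context: An $F$-structure manifold of degree $K$ is a smooth $n$-dimensional manifold $M$ with a nonzero smooth $(1,1)$-tensor field $F$ of constant rank $r$ satisfying $\alpha F^{K+1}+\beta F^{K}+F=0$, where $K\ge 3$ is an integer and $\alpha,\beta$ are real or complex numbers (polynomials in $F$ with complex coefficients are regarded as endomorphisms of the complexified tangent bundle). Put $l=-(\alpha F^{K}+\beta F^{K-1})$ and $m=I+\alpha F^{K}+\beta F^{K-1}$; $D_l=\mathrm{Im}\,l$ and $D_m=\mathrm{Im}\,m$ are complementary distributions of dimensions $r$ and $n-r$. For a $(1,1)$-tensor field $T$, the Nijenhuis tensor is $N_T(X,Y)=[TX,TY]-T[TX,Y]-T[X,TY]+T^2[X,Y]$; the operator $T$ is called integrable when $N_T=0$. A distribution $D$ is integrable if through each point of $M$ there is an integral manifold of $D$ (equivalently, by Frobenius, $D$ is involutive). *)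

theory Defs
  imports "HOL-Analysis.Analysis"
begin

section \<open>Smooth maps between normed spaces\<close>

primrec Ck_on :: "nat \<Rightarrow> 'a::real_normed_vector set \<Rightarrow> ('a \<Rightarrow> 'b::real_normed_vector) \<Rightarrow> bool" where
  "Ck_on 0 S f \<longleftrightarrow> continuous_on S f"
| "Ck_on (Suc k) S f \<longleftrightarrow>
     (\<forall>x\<in>S. f differentiable (at x)) \<and>
     (\<forall>v. Ck_on k S (\<lambda>x. frechet_derivative f (at x) v))"

text \<open>Only used for open \<open>S\<close>.\<close>

definition smooth_on :: "'a::real_normed_vector set \<Rightarrow> ('a \<Rightarrow> 'b::real_normed_vector) \<Rightarrow> bool" where
  "smooth_on S f \<longleftrightarrow> (\<forall>k. Ck_on k S f)"


section \<open>Smooth manifolds\<close>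

text \<open>The points of the manifold are all elements of a Hausdorff, second countable type \<open>'a\<close>;
  its dimension is \<open>CARD('n)\<close>. The values of \<open>coord c\<close> outside \<open>cdom c\<close> are irrelevant.\<close>

datatype ('a, 'n) chart = Chart (cdom: "'a set") (coord: "'a \<Rightarrow> real^'n")

definition chart_inv :: "('a, 'n::finite) chart \<Rightarrow> real^'n \<Rightarrow> 'a" where
  "chart_inv c = inv_into (cdom c) (coord c)"

definition is_chart :: "('a::topological_space, 'n::finite) chart \<Rightarrow> bool" where
  "is_chart c \<longleftrightarrow> open (cdom c) \<and> open (coord c ` cdom c) \<and>
     homeomorphism (cdom c) (coord c ` cdom c) (coord c) (chart_inv c)"

definition compatible :: "('a, 'n::finite) chart \<Rightarrow> ('a, 'n) chart \<Rightarrow> bool" where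
  "compatible c d \<longleftrightarrow>
     smooth_on (coord c ` (cdom c \<inter> cdom d)) (coord d \<circ> chart_inv c) \<and>
     smooth_on (coord d ` (cdom c \<inter> cdom d)) (coord c \<circ> chart_inv d)"

text \<open>A smooth structure is a maximal smooth atlas.\<close>

definition smooth_manifold ::
  "('a::{t2_space, second_countable_topology}, 'n::finite) chart set \<Rightarrow> bool" where
  "smooth_manifold A \<longleftrightarrow>
     (\<forall>c\<in>A. is_chart c) \<and>
     (\<Union>c\<in>A. cdom c) = UNIV \<and>
     (\<forall>c\<in>A. \<forall>d\<in>A. compatible c d) \<and>
     (\<forall>c. is_chart c \<and> (\<forall>d\<in>A. compatible c d) \<longrightarrow> c \<in> A)"


section \<open>Vector fields and tensor fields of type (1,1)\<close>

text \<open>Tangent vectors, vector fields and endomorphism fields are families of coordinate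
  representatives, one for each chart of the maximal atlas, related by the usual transformation
  laws. Hence \<open>X c p\<close> is the column of components at \<open>p\<close> of \<open>X\<close> in the chart \<open>c\<close>; it is
  meaningful only for \<open>p \<in> cdom c\<close>.\<close>

definition chart_jac :: "('a, 'n::finite) chart \<Rightarrow> ('a, 'n) chart \<Rightarrow> 'a \<Rightarrow> real^'n^'n" where
  "chart_jac c d p = jacobian (coord d \<circ> chart_inv c) (at (coord c p))"

type_synonym ('a, 'n, 'k) vfield = "('a, 'n) chart \<Rightarrow> 'a \<Rightarrow> 'k^'n"
type_synonym ('a, 'n, 'k) endo_field = "('a, 'n) chart \<Rightarrow> 'a \<Rightarrow> 'k^'n^'n"

definition vector_field ::
  "('a, 'n::finite) chart set \<Rightarrow> ('a, 'n, real) vfield \<Rightarrow> bool" where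
  "vector_field A X \<longleftrightarrow>
     (\<forall>c\<in>A. \<forall>d\<in>A. \<forall>p\<in>cdom c \<inter> cdom d. X d p = chart_jac c d p *v X c p) \<and>
     (\<forall>c\<in>A. smooth_on (coord c ` cdom c) (\<lambda>x. X c (chart_inv c x)))"

definition tensor_field_1_1 ::
  "('a, 'n::finite) chart set \<Rightarrow> ('a, 'n, real) endo_field \<Rightarrow> bool" where
  "tensor_field_1_1 A T \<longleftrightarrow>
     (\<forall>c\<in>A. \<forall>d\<in>A. \<forall>p\<in>cdom c \<inter> cdom d.
        T d p = chart_jac c d p ** T c p ** chart_jac d c p) \<and>
     (\<forall>c\<in>A. smooth_on (coord c ` cdom c) (\<lambda>x. T c (chart_inv c x)))"


section \<open>The complexified tangent bundle\<close>

definition cvec :: "real^'n \<Rightarrow> complex^'n" where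
  "cvec v = (\<chi> i. complex_of_real (v $ i))"

definition complexify :: "(real^'n) set \<Rightarrow> (complex^'n) set" where
  "complexify V = {cvec u + \<i> *s cvec v | u v. u \<in> V \<and> v \<in> V}"

definition cfield :: "('a, 'n::finite, real) vfield \<Rightarrow> ('a, 'n, complex) vfield" where
  "cfield X c p = cvec (X c p)"

definition cendo :: "('a, 'n::finite, real) endo_field \<Rightarrow> ('a, 'n, complex) endo_field" where
  "cendo T c p = map_matrix complex_of_real (T c p)"

definition app :: "('a, 'n::finite, complex) endo_field \<Rightarrow> ('a, 'n, complex) vfield
    \<Rightarrow> ('a, 'n, complex) vfield" where
  "app T X c p = T c p *v X c p"

definition partial_deriv :: "('a, 'n::finite) chart \<Rightarrow> 'n \<Rightarrow> ('a \<Rightarrow> complex) \<Rightarrow> 'a \<Rightarrow> complex" where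
  "partial_deriv c j f p =
     frechet_derivative (f \<circ> chart_inv c) (at (coord c p)) (axis j 1)"

text \<open>The complex bilinear extension of the Lie bracket of vector fields, in coordinates.\<close>

definition lie_bracket :: "('a, 'n::finite, complex) vfield \<Rightarrow> ('a, 'n, complex) vfield
    \<Rightarrow> ('a, 'n, complex) vfield" where
  "lie_bracket X Y c p =
     (\<chi> i. \<Sum>j\<in>UNIV. X c p $ j * partial_deriv c j (\<lambda>q. Y c q $ i) p
                     - Y c p $ j * partial_deriv c j (\<lambda>q. X c q $ i) p)"

definition nijenhuis :: "('a, 'n::finite, complex) endo_field \<Rightarrow> ('a, 'n, complex) vfield
    \<Rightarrow> ('a, 'n, complex) vfield \<Rightarrow> ('a, 'n, complex) vfield" where
  "nijenhuis T X Y c p =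
     lie_bracket (app T X) (app T Y) c p
     - app T (lie_bracket (app T X) Y) c p
     - app T (lie_bracket X (app T Y)) c p
     + app T (app T (lie_bracket X Y)) c p"

definition nijenhuis_vanishes ::
  "('a, 'n::finite) chart set \<Rightarrow> ('a, 'n, complex) endo_field \<Rightarrow> bool" where
  "nijenhuis_vanishes A T \<longleftrightarrow>
     (\<forall>X Y. vector_field A X \<longrightarrow> vector_field A Y \<longrightarrow>
        (\<forall>c\<in>A. \<forall>p\<in>cdom c. nijenhuis T (cfield X) (cfield Y) c p = 0))"

definition integrable_operator ::
  "('a, 'n::finite) chart set \<Rightarrow> ('a, 'n, complex) endo_field \<Rightarrow> bool" where
  "integrable_operator A T \<longleftrightarrow> nijenhuis_vanishes A T"


section \<open>Distributions and integral manifolds\<close>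

text \<open>Embedded submanifolds of dimension \<open>k\<close>, described by slice charts. Integral manifolds
  through a point may be taken embedded, since an immersed submanifold is locally embedded.\<close>

definition embedded_submanifold ::
  "('a, 'n::finite) chart set \<Rightarrow> nat \<Rightarrow> 'a set \<Rightarrow> bool" where
  "embedded_submanifold A k N \<longleftrightarrow>
     (\<forall>q\<in>N. \<exists>c\<in>A. \<exists>V. q \<in> cdom c \<and> subspace V \<and> dim V = k \<and>
        coord c ` (cdom c \<inter> N) = coord c ` cdom c \<inter> V)"

text \<open>Velocities at \<open>q\<close>, in the chart \<open>c\<close>, of smooth curves lying in \<open>N\<close>.\<close>

definition tangent_space :: "'a set \<Rightarrow> ('a, 'n::finite) chart \<Rightarrow> 'a \<Rightarrow> (real^'n) set" where
  "tangent_space N c q =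
     {v. \<exists>\<gamma>::real \<Rightarrow> 'a. \<exists>\<epsilon>>0. \<gamma> 0 = q \<and> \<gamma> ` {-\<epsilon><..<\<epsilon>} \<subseteq> N \<inter> cdom c \<and>
        smooth_on {-\<epsilon><..<\<epsilon>} (coord c \<circ> \<gamma>) \<and>
        ((coord c \<circ> \<gamma>) has_vector_derivative v) (at 0)}"

text \<open>Distributions are subbundles of the complexified tangent bundle; \<open>N\<close> is an integral manifold
  of such a \<open>D\<close> if the complexification of its tangent space is \<open>D\<close> at each of its points. For the
  complexification of a real distribution this is the usual notion.\<close>

definition integral_manifold :: "('a, 'n::finite) chart set
    \<Rightarrow> (('a, 'n) chart \<Rightarrow> 'a \<Rightarrow> (complex^'n) set) \<Rightarrow> 'a set \<Rightarrow> bool" where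
  "integral_manifold A D N \<longleftrightarrow>
     (\<exists>k. embedded_submanifold A k N) \<and>
     (\<forall>c\<in>A. \<forall>q\<in>N \<inter> cdom c. D c q = complexify (tangent_space N c q))"

definition integrable_distribution :: "('a, 'n::finite) chart set
    \<Rightarrow> (('a, 'n) chart \<Rightarrow> 'a \<Rightarrow> (complex^'n) set) \<Rightarrow> bool" where
  "integrable_distribution A D \<longleftrightarrow> (\<forall>p. \<exists>N. p \<in> N \<and> integral_manifold A D N)"

definition image_distribution :: "('a, 'n::finite, complex) endo_field
    \<Rightarrow> ('a, 'n) chart \<Rightarrow> 'a \<Rightarrow> (complex^'n) set" where
  "image_distribution T c p = range (\<lambda>v. T c p *v v)"


section \<open>\<open>F\<close>-structures of degree \<open>K\<close>\<close>

text \<open>The operation \<open>^\<close> on \<open>complex^'n^'n\<close> is componentwise, hence a separate matrix power.\<close>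

primrec matrix_power :: "'k::comm_semiring_1^'n^'n \<Rightarrow> nat \<Rightarrow> 'k^'n^'n" where
  "matrix_power B 0 = mat 1"
| "matrix_power B (Suc k) = B ** matrix_power B k"

definition l_op :: "complex \<Rightarrow> complex \<Rightarrow> nat \<Rightarrow> ('a, 'n::finite, real) endo_field
    \<Rightarrow> ('a, 'n, complex) endo_field" where
  "l_op \<alpha> \<beta> K F c p =
     - (mat \<alpha> ** matrix_power (cendo F c p) K + mat \<beta> ** matrix_power (cendo F c p) (K - 1))"

definition m_op :: "complex \<Rightarrow> complex \<Rightarrow> nat \<Rightarrow> ('a, 'n::finite, real) endo_field
    \<Rightarrow> ('a, 'n, complex) endo_field" where
  "m_op \<alpha> \<beta> K F c p =
     mat 1 + mat \<alpha> ** matrix_power (cendo F c p) K + mat \<beta> ** matrix_power (cendo F c p) (K - 1)"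

definition F_structure_manifold ::
  "('a::{t2_space, second_countable_topology}, 'n::finite) chart set \<Rightarrow> nat \<Rightarrow>
    complex \<Rightarrow> complex \<Rightarrow> nat \<Rightarrow> ('a, 'n, real) endo_field \<Rightarrow> bool" where
  "F_structure_manifold A K \<alpha> \<beta> r F \<longleftrightarrow>
     smooth_manifold A \<and> K \<ge> 3 \<and> tensor_field_1_1 A F \<and>
     (\<exists>c\<in>A. \<exists>p\<in>cdom c. F c p \<noteq> 0) \<and>
     (\<forall>c\<in>A. \<forall>p\<in>cdom c. rank (F c p) = r) \<and>
     (\<forall>c\<in>A. \<forall>p\<in>cdom c.
        mat \<alpha> ** matrix_power (cendo F c p) (K + 1) + mat \<beta> ** matrix_power (cendo F c p) K
        + cendo F c p = 0)"

end

theory Submission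
  imports Defs
begin

text \<open>Taking real parts in \<open>\<alpha>F\<^sup>K\<^sup>+\<^sup>1 + \<beta>F\<^sup>K + F = 0\<close> shows that \<open>l\<close> is the complexification of a real
  projection \<open>L\<close> with \<open>LF = FL = F\<close>, \<open>L = FG = GF\<close>. In a chart, with \<open>D\<close> the derivative of the matrix
  field \<open>T\<close>, \<open>N\<^sub>T(a,b) = D(Ta)b - D(Tb)a - T(D(a)b) + T(D(b)a)\<close>. For the projections \<open>L\<close> and \<open>1 - L\<close>
  this combines the obstructions to involutivity of the two images, which lie in complementary
  subspaces, and (iv) differs from \<open>N\<^sub>L = 0\<close> by the invertible action of \<open>F\<close> on the image of \<open>L\<close>.
  An integral manifold, parametrised by a slice chart, gives involutivity by the symmetry of second
  derivatives. Conversely, writing the involutive distribution near \<open>x\<^sub>0\<close> as a graph over its value at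
  \<open>x\<^sub>0\<close>, with slopes \<open>B\<close>, turns the search for a leaf into the total differential equation
  \<open>f'(u) = B(f(u))\<close>, whose compatibility condition is involutivity; it is solved by the
  contraction principle along the rays \<open>t \<mapsto> f(tu)\<close>.\<close>

section \<open>Calculus of smooth maps\<close>

text \<open>Three obstacles shape the proof. The identities are stated for global real vector
  fields, while the argument is algebra at a point; to pass from fields to vectors, every tangent
  vector must be the value of a global field, which is what the bump functions are for. Since
  \<alpha> and \<beta> are complex, the distributions live in the complexified bundle, and integral
  manifolds are possible only for complexifications of real subspaces; hence the reality of
  \<open>l\<close> has to be settled before any geometry. Condition (i) then collapses to (iii),
  because a Nijenhuis tensor is quadratic in its operator and blind to added constant multiples of
  the identity, so that \<open>m\<close> and \<open>l\<close> have the same one. In the converse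
  direction the fixed point satisfies the differential equation along rays only. Its full
  differentiability comes from comparing neighbouring rays, and this is where compatibility enters.
  Finally, integral manifolds are given by slice charts, so a parametrised leaf is not enough: a
  shear straightens it, and the maximality of the atlas makes the straightened coordinates an
  admissible chart.\<close>

lemma Ck_on_cong:
  assumes "open S" "\<And>x. x \<in> S \<Longrightarrow> f x = g x" "Ck_on k S f"
  shows "Ck_on k S g"
  using assms(2,3)
proof (induction k arbitrary: f g)
  case 0
  then show ?case by (metis Ck_on.simps(1) continuous_on_cong)
next
  case (Suc k)
  have D: "(g has_derivative frechet_derivative f (at x)) (at x)" if "x \<in> S" for x
    using Suc.prems that assms(1) frechet_derivative_works has_derivative_transform_within_open
    by (metis Ck_on.simps(2))
  have E: "frechet_derivative f (at x) = frechet_derivative g (at x)" if "x \<in> S" for x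
    using D[OF that] by (rule frechet_derivative_at)
  have "Ck_on k S (\<lambda>x. frechet_derivative g (at x) v)" for v
    by (rule Suc.IH[of "\<lambda>x. frechet_derivative f (at x) v"]) (use E Suc.prems in auto)
  then show ?case using D by (auto simp: differentiable_def)
qed

lemma Ck_on_subset: "Ck_on k S f \<Longrightarrow> T \<subseteq> S \<Longrightarrow> Ck_on k T f"
  by (induction k arbitrary: f) (auto intro: continuous_on_subset)

text \<open>Any explicit formula \<open>f'\<close> may serve as the derivative in place of
  \<open>frechet_derivative\<close>. The closure properties below recurse on the order through this
  rule.\<close>

lemma Ck_on_SucI:
  assumes "open S" and "\<And>x. x \<in> S \<Longrightarrow> (f has_derivative f' x) (at x)"
    and "\<And>v. Ck_on k S (\<lambda>x. f' x v)"
  shows "Ck_on (Suc k) S f"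
proof -
  have E: "f' x = frechet_derivative f (at x)" if "x \<in> S" for x
    using assms(2)[OF that] by (rule frechet_derivative_at)
  have "Ck_on k S (\<lambda>x. frechet_derivative f (at x) v)" for v
    by (rule Ck_on_cong[OF assms(1) _ assms(3)[of v]]) (simp add: E)
  then show ?thesis using assms(2) by (auto simp: differentiable_def)
qed

lemma Ck_on_SucD: "Ck_on (Suc k) S f \<Longrightarrow> Ck_on k S f"
proof (induction k arbitrary: f)
  case 0
  then have "isCont f x" if "x \<in> S" for x
    using that by (simp add: differentiable_imp_continuous_within)
  then show ?case by (simp add: continuous_at_imp_continuous_on)
next
  case (Suc k)
  then have "\<forall>v. Ck_on (Suc k) S (\<lambda>x. frechet_derivative f (at x) v)" by simp
  then have "Ck_on k S (\<lambda>x. frechet_derivative f (at x) v)" for v using Suc.IH by blast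
  then show ?case using Suc.prems by simp
qed

lemma Ck_on_local:
  assumes "\<And>x. x \<in> S \<Longrightarrow> \<exists>T. open T \<and> x \<in> T \<and> Ck_on k T f"
  shows "Ck_on k S f"
  using assms
proof (induction k arbitrary: f)
  case 0
  have "isCont f x" if "x \<in> S" for x
    using 0[OF that] continuous_on_eq_continuous_at by auto
  then show ?case by (simp add: continuous_at_imp_continuous_on)
next
  case (Suc k)
  have "f differentiable at x" if "x \<in> S" for x
    using Suc.prems[OF that] by auto
  moreover have "Ck_on k S (\<lambda>x. frechet_derivative f (at x) v)" for v
  proof (rule Suc.IH)
    fix x assume "x \<in> S"
    from Suc.prems[OF this] show "\<exists>T. open T \<and> x \<in> T \<and> Ck_on k T (\<lambda>x. frechet_derivative f (at x) v)"
      by auto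
  qed
  ultimately show ?case by simp
qed

lemma has_derivative_frechet_Ck:
  "Ck_on (Suc k) S f \<Longrightarrow> x \<in> S \<Longrightarrow> (f has_derivative frechet_derivative f (at x)) (at x)"
  by (simp add: frechet_derivative_works)

lemma Ck_on_const: "Ck_on k S (\<lambda>x. c)"
  by (induction k arbitrary: c) auto

lemma Ck_on_bounded_linear:
  assumes h: "bounded_linear h" and f: "Ck_on k S f" and S: "open S"
  shows "Ck_on k S (\<lambda>x. h (f x))"
  using f
proof (induction k arbitrary: f)
  case 0
  then show ?case using h by (auto intro: bounded_linear.continuous_on)
next
  case (Suc k)
  show ?case
    by (rule Ck_on_SucI[OF S, where f' = "\<lambda>x v. h (frechet_derivative f (at x) v)"])
      (use Suc in \<open>auto intro!: bounded_linear.has_derivative[OF h] simp: frechet_derivative_works\<close>)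
qed

lemma Ck_on_id: "open S \<Longrightarrow> Ck_on k S (\<lambda>x. x)"
  by (cases k) (auto simp: Ck_on_const)

lemma Ck_on_add:
  assumes "Ck_on k S f" "Ck_on k S g" "open S"
  shows "Ck_on k S (\<lambda>x. f x + g x)"
  using assms(1,2)
proof (induction k arbitrary: f g)
  case 0
  then show ?case by (auto intro: continuous_on_add)
next
  case (Suc k)
  show ?case
    by (rule Ck_on_SucI[OF assms(3), where f' = "\<lambda>x v. frechet_derivative f (at x) v + frechet_derivative g (at x) v"])
      (use Suc in \<open>auto intro!: has_derivative_add simp: frechet_derivative_works\<close>)
qed

lemma Ck_on_bilinear:
  assumes h: "bounded_bilinear h" and S: "open S"
    and "Ck_on k S f" "Ck_on k S g"
  shows "Ck_on k S (\<lambda>x. h (f x) (g x))"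
  using assms(3,4)
proof (induction k arbitrary: f g)
  case 0
  then show ?case using h by (auto intro: bounded_bilinear.continuous_on)
next
  case (Suc k)
  have 1: "Ck_on k S (\<lambda>x. h (f x) (frechet_derivative g (at x) v))"
    and 2: "Ck_on k S (\<lambda>x. h (frechet_derivative f (at x) v) (g x))" for v
    using Suc.IH[of f "\<lambda>x. frechet_derivative g (at x) v"] Suc.IH[of "\<lambda>x. frechet_derivative f (at x) v" g]
      Suc.prems Ck_on_SucD[OF Suc.prems(1)] Ck_on_SucD[OF Suc.prems(2)] by simp_all
  show ?case
    by (rule Ck_on_SucI[OF S, where f' = "\<lambda>x v. h (f x) (frechet_derivative g (at x) v) + h (frechet_derivative f (at x) v) (g x)"])
      (use Suc 1 2 in \<open>auto intro!: Ck_on_add[OF _ _ S] bounded_bilinear.FDERIV[OF h] simp: frechet_derivative_works\<close>)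
qed

lemma Ck_on_sum:
  assumes "\<And>i. i \<in> I \<Longrightarrow> Ck_on k S (f i)" "open S"
  shows "Ck_on k S (\<lambda>x. \<Sum>i\<in>I. f i x)"
  using assms by (induction I rule: infinite_finite_induct) (auto intro: Ck_on_const Ck_on_add)

lemma Ck_on_compose:
  fixes f :: "'a::real_normed_vector \<Rightarrow> 'b::euclidean_space"
  assumes S: "open S" and T: "f ` S \<subseteq> T" and "Ck_on k S f" "Ck_on k T g"
  shows "Ck_on k S (\<lambda>x. g (f x))"
  using assms(3,4)
proof (induction k arbitrary: g)
  case 0
  then show ?case using T by (auto intro: continuous_on_compose2)
next
  case (Suc k)
  \<comment> \<open>\<open>Ck_on\<close> differentiates in fixed directions, but in the chain rule
    the direction \<open>frechet_derivative f (at x) v\<close> moves with \<open>x\<close>.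
    Expanding it in the basis leaves fixed directions with varying coefficients, to which the
    induction hypothesis applies.\<close>
  let ?D = "\<lambda>x v. \<Sum>b\<in>Basis. (frechet_derivative f (at x) v \<bullet> b) *\<^sub>R frechet_derivative g (at (f x)) b"
  have der: "((\<lambda>x. g (f x)) has_derivative ?D x) (at x)" if x: "x \<in> S" for x
  proof -
    have f: "(f has_derivative frechet_derivative f (at x)) (at x)"
      using has_derivative_frechet_Ck Suc.prems(1) x by blast
    have g: "(g has_derivative frechet_derivative g (at (f x))) (at (f x))"
      using has_derivative_frechet_Ck Suc.prems(2) x T by blast
    interpret g: bounded_linear "frechet_derivative g (at (f x))"
      using g by (rule has_derivative_bounded_linear)
    have "frechet_derivative g (at (f x)) (frechet_derivative f (at x) v) = ?D x v" for v
      by (subst euclidean_representation[symmetric, of "frechet_derivative f (at x) v"])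
        (simp only: g.sum g.scaleR)
    then show ?thesis using diff_chain_at[OF f g] by (simp add: o_def)
  qed
  have "Ck_on k S (\<lambda>x. frechet_derivative g (at (f x)) b)" for b
    using Suc.IH[of "\<lambda>y. frechet_derivative g (at y) b"] Ck_on_SucD[OF Suc.prems(1)] Suc.prems(2) by simp
  then have "Ck_on k S (\<lambda>x. ?D x v)" for v
    using Suc.prems(1)
    by (intro Ck_on_sum S Ck_on_bilinear[OF bounded_bilinear_scaleR S]
        Ck_on_bounded_linear[OF bounded_linear_inner_left _ S]) auto
  then show ?case using der by (intro Ck_on_SucI[OF S]) auto
qed

lemma smooth_onD: "smooth_on S f \<Longrightarrow> Ck_on k S f"
  by (simp add: smooth_on_def)

lemma smooth_on_cong:
  "smooth_on S f \<Longrightarrow> open S \<Longrightarrow> (\<And>x. x \<in> S \<Longrightarrow> f x = g x) \<Longrightarrow> smooth_on S g"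
  unfolding smooth_on_def using Ck_on_cong by blast

lemma smooth_on_subset: "smooth_on S f \<Longrightarrow> T \<subseteq> S \<Longrightarrow> smooth_on T f"
  unfolding smooth_on_def using Ck_on_subset by blast

lemma smooth_on_local:
  "(\<And>x. x \<in> S \<Longrightarrow> \<exists>T. open T \<and> x \<in> T \<and> smooth_on T f) \<Longrightarrow> smooth_on S f"
  unfolding smooth_on_def using Ck_on_local by meson

lemma smooth_on_imp_continuous_on: "smooth_on S f \<Longrightarrow> continuous_on S f"
  by (metis Ck_on.simps(1) smooth_onD)

lemma smooth_on_has_derivative:
  "smooth_on S f \<Longrightarrow> x \<in> S \<Longrightarrow> (f has_derivative frechet_derivative f (at x)) (at x)"
  by (rule has_derivative_frechet_Ck[OF smooth_onD])

lemma smooth_on_frechet_derivative: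
  "smooth_on S f \<Longrightarrow> smooth_on S (\<lambda>x. frechet_derivative f (at x) v)"
  unfolding smooth_on_def by (metis Ck_on.simps(2))

lemma smooth_on_const: "smooth_on S (\<lambda>x. c)"
  by (simp add: smooth_on_def Ck_on_const)

lemma smooth_on_id: "open S \<Longrightarrow> smooth_on S (\<lambda>x. x)"
  by (simp add: smooth_on_def Ck_on_id)

lemma smooth_on_bounded_linear:
  "bounded_linear h \<Longrightarrow> smooth_on S f \<Longrightarrow> open S \<Longrightarrow> smooth_on S (\<lambda>x. h (f x))"
  by (simp add: smooth_on_def Ck_on_bounded_linear)

lemma smooth_on_add:
  "smooth_on S f \<Longrightarrow> smooth_on S g \<Longrightarrow> open S \<Longrightarrow> smooth_on S (\<lambda>x. f x + g x)"
  by (simp add: smooth_on_def Ck_on_add)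

lemma smooth_on_minus: "smooth_on S f \<Longrightarrow> open S \<Longrightarrow> smooth_on S (\<lambda>x. - f x)"
  by (rule smooth_on_bounded_linear[OF bounded_linear_minus[OF bounded_linear_ident]])

lemma smooth_on_diff:
  "smooth_on S f \<Longrightarrow> smooth_on S g \<Longrightarrow> open S \<Longrightarrow> smooth_on S (\<lambda>x. f x - g x)"
  using smooth_on_add[of S f "\<lambda>x. - g x"] by (simp add: smooth_on_minus)

lemma smooth_on_bilinear:
  "bounded_bilinear h \<Longrightarrow> open S \<Longrightarrow> smooth_on S f \<Longrightarrow> smooth_on S g \<Longrightarrow> smooth_on S (\<lambda>x. h (f x) (g x))"
  by (simp add: smooth_on_def Ck_on_bilinear)

lemmas smooth_on_mult = smooth_on_bilinear[OF bounded_bilinear_mult]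
lemmas smooth_on_scaleR = smooth_on_bilinear[OF bounded_bilinear_scaleR]

lemma smooth_on_sum:
  "(\<And>i. i \<in> I \<Longrightarrow> smooth_on S (f i)) \<Longrightarrow> open S \<Longrightarrow> smooth_on S (\<lambda>x. \<Sum>i\<in>I. f i x)"
  by (simp add: smooth_on_def Ck_on_sum)

lemma smooth_on_prod:
  fixes f :: "'i \<Rightarrow> 'a::real_normed_vector \<Rightarrow> real"
  assumes "\<And>i. i \<in> I \<Longrightarrow> smooth_on S (f i)" "open S"
  shows "smooth_on S (\<lambda>x. \<Prod>i\<in>I. f i x)"
  using assms
  by (induction I rule: infinite_finite_induct) (auto intro: smooth_on_const smooth_on_mult)

lemma smooth_on_compose:
  fixes f :: "'a::real_normed_vector \<Rightarrow> 'b::euclidean_space"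
  shows "smooth_on T g \<Longrightarrow> smooth_on S f \<Longrightarrow> open S \<Longrightarrow> f ` S \<subseteq> T \<Longrightarrow> smooth_on S (\<lambda>x. g (f x))"
  by (simp add: smooth_on_def Ck_on_compose)

lemma smooth_on_euclideanI:
  fixes f :: "'a::real_normed_vector \<Rightarrow> 'b::euclidean_space"
  assumes "\<And>b. b \<in> Basis \<Longrightarrow> smooth_on S (\<lambda>x. f x \<bullet> b)" "open S"
  shows "smooth_on S f"
proof -
  have "smooth_on S (\<lambda>x. \<Sum>b\<in>Basis. (f x \<bullet> b) *\<^sub>R b)"
    by (intro smooth_on_sum smooth_on_scaleR assms smooth_on_const)
  then show ?thesis by (simp add: euclidean_representation)
qed

lemma smooth_on_vecI:
  fixes f :: "'a::real_normed_vector \<Rightarrow> ('b::euclidean_space)^'n"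
  assumes "\<And>i. smooth_on S (\<lambda>x. f x $ i)" "open S"
  shows "smooth_on S f"
proof (rule smooth_on_euclideanI[OF _ assms(2)])
  fix b :: "'b^'n" assume "b \<in> Basis"
  then obtain i u where "b = axis i u" by (auto simp: Basis_vec_def)
  then show "smooth_on S (\<lambda>x. f x \<bullet> b)"
    by (simp add: inner_axis)
      (rule smooth_on_bounded_linear[OF bounded_linear_inner_left assms])
qed

lemma smooth_on_vec_nth:
  "smooth_on S f \<Longrightarrow> open S \<Longrightarrow> smooth_on S (\<lambda>x. f x $ i)"
  by (rule smooth_on_bounded_linear[OF bounded_linear_vec_nth])

lemma bounded_bilinear_matrix_vector_mult:
  "bounded_bilinear (\<lambda>(A::real^'n^'m) v. A *v v)"
  unfolding bilinear_conv_bounded_bilinear[symmetric] bilinear_def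
  by (auto intro!: linearI simp: algebra_simps matrix_vector_mult_scaleR scaleR_matrix_vector_assoc)

lemma bounded_bilinear_matrix_mult:
  "bounded_bilinear (\<lambda>(A::real^'n^'m) (B::real^'k^'n). A ** B)"
  unfolding bilinear_conv_bounded_bilinear[symmetric] bilinear_def
  by (auto intro!: linearI simp: matrix_add_ldistrib matrix_matrix_mult_def vec_eq_iff sum.distrib algebra_simps sum_distrib_left)

lemmas smooth_on_matrix_vector_mult = smooth_on_bilinear[OF bounded_bilinear_matrix_vector_mult]
lemmas smooth_on_matrix_mult = smooth_on_bilinear[OF bounded_bilinear_matrix_mult]

text \<open>The derivative is a product of copies of \<open>inverse\<close> itself, so each order of
  smoothness yields the next.\<close>

lemma smooth_on_inverse: "smooth_on (- {0}) (inverse :: real \<Rightarrow> real)"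
proof -
  have "Ck_on k (- {0}) (inverse :: real \<Rightarrow> real)" for k
  proof (induction k)
    case 0
    show ?case unfolding Ck_on.simps by (rule continuous_on_inverse) auto
  next
    case (Suc k)
    have op: "open (- {0::real})" by (rule open_Compl) simp
    show ?case
      by (rule Ck_on_SucI[OF op, where f' = "\<lambda>x v. - (inverse x * v * inverse x)"])
        (use Suc in \<open>auto intro!: has_derivative_inverse' 
            Ck_on_bounded_linear[OF bounded_linear_minus[OF bounded_linear_ident] _ op]
            Ck_on_bilinear[OF bounded_bilinear_mult op] Ck_on_const\<close>)
  qed
  then show ?thesis by (simp add: smooth_on_def)
qed

lemma smooth_on_divide:
  fixes f g :: "'a::real_normed_vector \<Rightarrow> real"
  assumes "smooth_on S f" "smooth_on S g" "open S" "\<And>x. x \<in> S \<Longrightarrow> g x \<noteq> 0"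
  shows "smooth_on S (\<lambda>x. f x / g x)"
  unfolding divide_inverse
  by (intro smooth_on_mult assms smooth_on_compose[OF smooth_on_inverse]) (use assms in auto)

lemma smooth_on_det:
  assumes "smooth_on S J" "open S"
  shows "smooth_on S (\<lambda>x. det (J x :: real^'n^'n))"
  unfolding det_def
  by (intro smooth_on_sum smooth_on_mult smooth_on_const smooth_on_prod smooth_on_vec_nth assms)

lemma matrix_inv_works:
  assumes "invertible (A :: 'k::semiring_1^'n^'m)"
  shows "A ** matrix_inv A = mat 1" "matrix_inv A ** A = mat 1"
  using someI_ex[OF assms[unfolded invertible_def]] unfolding matrix_inv_def by auto

text \<open>By Cramer's rule the entries of the inverse are quotients of determinants with
  nonvanishing denominator.\<close>

lemma smooth_on_matrix_inv:
  fixes J :: "'a::real_normed_vector \<Rightarrow> real^'n^'n"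
  assumes J: "smooth_on S J" "open S" and inv: "\<And>x. x \<in> S \<Longrightarrow> invertible (J x)"
  shows "smooth_on S (\<lambda>x. matrix_inv (J x))"
proof -
  let ?C = "\<lambda>x k l. det (\<chi> i j. if j = k then axis l 1 $ i else J x $ i $ j) / det (J x)"
  have eq: "matrix_inv (J x) $ k $ l = ?C x k l" if x: "x \<in> S" for x k l
  proof -
    have d: "det (J x) \<noteq> 0" using inv[OF x] by (simp add: invertible_det_nz)
    have "J x ** matrix_inv (J x) = mat 1"
      using inv[OF x] by (rule matrix_inv_works)
    then have "J x *v (matrix_inv (J x) *v axis l 1) = axis l 1"
      by (simp add: matrix_vector_mul_assoc)
    then have "(matrix_inv (J x) *v axis l 1) $ k = ?C x k l"
      unfolding cramer[OF d] by (metis (no_types, lifting) vec_lambda_beta)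
    then show ?thesis by (simp add: matrix_vector_mult_basis column_def)
  qed
  have "smooth_on S (\<lambda>x. ?C x k l)" for k l
  proof (intro smooth_on_divide smooth_on_det J smooth_on_vecI)
    show "det (J x) \<noteq> 0" if "x \<in> S" for x using inv[OF that] by (simp add: invertible_det_nz)
    show "smooth_on S (\<lambda>x. (\<chi> i j. if j = k then axis l 1 $ i else J x $ i $ j) $ i $ j)" for i j
      by (cases "j = k") (auto intro!: smooth_on_const smooth_on_vec_nth J)
  qed
  then have "smooth_on S (\<lambda>x. matrix_inv (J x) $ k $ l)" for k l
    by (rule smooth_on_cong) (use J eq in auto)
  then show ?thesis by (intro smooth_on_vecI J)
qed


section \<open>Bump functions\<close>

text \<open>The classical flat function is the case \<open>k = 0\<close>. The factor
  \<open>inverse t ^ k\<close> closes the family under differentiation up to linear combinations, so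
  smoothness is one induction for all \<open>k\<close> at once.\<close>

definition bump_aux :: "nat \<Rightarrow> real \<Rightarrow> real" where
  "bump_aux k t = (if t > 0 then exp (- inverse t) * inverse t ^ k else 0)"

lemma tendsto_bump_aux: "(bump_aux k \<longlongrightarrow> 0) (at 0)"
proof -
  have "((\<lambda>t. inverse t ^ k / exp (inverse t)) \<longlongrightarrow> 0) (at_right (0::real))"
    by (rule filterlim_compose[OF tendsto_power_div_exp_0 filterlim_inverse_at_top_right])
  moreover have "\<forall>\<^sub>F t in at_right 0. inverse t ^ k / exp (inverse t) = bump_aux k t"
    by (auto simp: eventually_at_filter bump_aux_def exp_minus field_simps)
  ultimately have "(bump_aux k \<longlongrightarrow> 0) (at_right 0)"
    by (rule Lim_transform_eventually)
  moreover have "(bump_aux k \<longlongrightarrow> 0) (at_left 0)"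
    by (rule Lim_transform_eventually[OF tendsto_const]) (auto simp: eventually_at_filter bump_aux_def)
  ultimately show ?thesis by (simp add: filterlim_split_at)
qed

lemma bump_aux_has_derivative:
  "(bump_aux k has_real_derivative (bump_aux (k + 2) t - real k * bump_aux (k + 1) t)) (at t)"
proof (cases t "0::real" rule: linorder_cases)
  case less
  have "(bump_aux k has_real_derivative 0) (at t)"
    by (rule has_field_derivative_transform_within_open[OF DERIV_const, of "{..<0}"])
      (use less in \<open>auto simp: bump_aux_def\<close>)
  then show ?thesis using less by (simp add: bump_aux_def)
next
  case equal
  \<comment> \<open>Since the function vanishes at 0, its difference quotient there is again a
    member of the family, and the limit already found is the derivative.\<close>
  have "bump_aux (k + 1) = (\<lambda>h. (bump_aux k (0 + h) - bump_aux k 0) / h)"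
    by (simp add: bump_aux_def divide_inverse fun_eq_iff)
  then have "(bump_aux k has_real_derivative 0) (at 0)"
    using tendsto_bump_aux[of "k + 1"] by (simp only: DERIV_def)
  then show ?thesis using equal by (simp add: bump_aux_def)
next
  case greater
  let ?f = "\<lambda>t. exp (- inverse t) * inverse t ^ k"
  have 1: "((\<lambda>t. exp (- inverse t)) has_real_derivative exp (- inverse t) * inverse t ^ 2) (at t)"
    using greater by (auto intro!: derivative_eq_intros simp: power2_eq_square)
  have 2: "((\<lambda>t. inverse t ^ k) has_real_derivative - (real k * inverse t ^ (k + 1))) (at t)"
  proof (cases "k = 0")
    case False
    then have pw: "inverse t * inverse t ^ (k - Suc 0) = inverse t ^ k" by (cases k) auto
    have "((\<lambda>t. inverse t ^ k) has_real_derivative real k * (- (inverse t * inverse t) * inverse t ^ (k - Suc 0))) (at t)"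
      using greater by (auto intro!: derivative_eq_intros)
    moreover have "real k * (- (inverse t * inverse t) * inverse t ^ (k - Suc 0)) = - (real k * inverse t ^ (k + 1))"
      using pw by (simp add: mult.assoc)
    ultimately show ?thesis by (simp only:)
  qed simp
  have "(?f has_real_derivative (bump_aux (k + 2) t - real k * bump_aux (k + 1) t)) (at t)"
    using DERIV_mult[OF 1 2] greater by (simp add: bump_aux_def power2_eq_square algebra_simps)
  then show ?thesis
    by (rule has_field_derivative_transform_within_open[of _ _ _ "{0<..}"])
      (use greater in \<open>auto simp: bump_aux_def\<close>)
qed

lemma smooth_on_bump_aux: "smooth_on UNIV (bump_aux k)"
proof -
  have "Ck_on n UNIV (bump_aux k)" for n
  proof (induction n arbitrary: k)
    case 0
    have "isCont (bump_aux k) t" for t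
      using bump_aux_has_derivative by (rule DERIV_isCont)
    then show ?case by (simp add: continuous_at_imp_continuous_on)
  next
    case (Suc n)
    have 1: "Ck_on n UNIV (\<lambda>t. v * bump_aux (k + 2) t + (- (real k * v)) * bump_aux (k + 1) t)" for v
      by (intro Ck_on_add Ck_on_bilinear[OF bounded_bilinear_mult] Ck_on_const Suc open_UNIV)
    show ?case
    proof (rule Ck_on_SucI[OF open_UNIV])
      fix t show "(bump_aux k has_derivative
          (\<lambda>v. v * bump_aux (k + 2) t + (- (real k * v)) * bump_aux (k + 1) t)) (at t)"
        using bump_aux_has_derivative[of k t] unfolding has_field_derivative_def
        by (rule has_derivative_eq_rhs) (simp add: algebra_simps fun_eq_iff)
    qed (rule 1)
  qed
  then show ?thesis by (simp add: smooth_on_def)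
qed

text \<open>The flat function is composed with a polynomial in the squared distance, because the
  norm itself is not smooth at \<open>a\<close>; division by \<open>g (e\<^sup>2)\<close> normalises
  the value at the centre.\<close>

lemma smooth_bump_exists:
  fixes a :: "'a::euclidean_space"
  assumes "e > 0"
  obtains \<phi> :: "'a \<Rightarrow> real" where "smooth_on UNIV \<phi>" "\<phi> a = 1" "\<And>x. x \<notin> cball a e \<Longrightarrow> \<phi> x = 0"
proof -
  define g where "g = bump_aux 0"
  define \<phi> where "\<phi> x = g (e\<^sup>2 - (x - a) \<bullet> (x - a)) / g (e\<^sup>2)" for x
  have g: "g (e\<^sup>2) \<noteq> 0" using assms by (simp add: g_def bump_aux_def)
  have "\<phi> a = 1" using g by (simp add: \<phi>_def)
  moreover have "\<phi> x = 0" if "x \<notin> cball a e" for x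
  proof -
    have "e\<^sup>2 < (norm (x - a))\<^sup>2"
      using that assms by (intro power_strict_mono) (auto simp: dist_norm norm_minus_commute)
    then show ?thesis by (simp add: \<phi>_def g_def bump_aux_def power2_norm_eq_inner)
  qed
  moreover have 1: "smooth_on UNIV (\<lambda>x. e\<^sup>2 - (x - a) \<bullet> (x - a))"
    by (intro smooth_on_const open_UNIV smooth_on_diff smooth_on_bilinear[OF bounded_bilinear_inner] smooth_on_id)
  moreover have "smooth_on UNIV \<phi>"
    unfolding \<phi>_def
    by (intro smooth_on_divide smooth_on_const open_UNIV g
        smooth_on_compose[OF smooth_on_bump_aux[of 0, folded g_def] 1] subset_UNIV)
  ultimately show ?thesis by (intro that)
qed

section \<open>Total differential equations\<close>

text \<open>A Gronwall estimate on the unit interval. At a point where \<open>norm (d t)\<close> is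
  maximal, the mean value inequality bounds the maximum by \<open>A\<close> plus half of
  itself.\<close>

lemma norm_le_of_derivative_bound:
  fixes d :: "real \<Rightarrow> 'a::real_normed_vector"
  assumes d: "\<And>t. t \<in> {0..1} \<Longrightarrow> (d has_vector_derivative d' t) (at t within {0..1})"
    and d0: "d 0 = 0"
    and bd: "\<And>t. t \<in> {0..1} \<Longrightarrow> norm (d' t) \<le> A + norm (d t) / 2"
    and t: "t \<in> {0..1}"
  shows "norm (d t) \<le> 2 * A"
proof -
  have "continuous_on {0..1} d"
    by (rule continuous_on_vector_derivative[OF d])
  then have "\<exists>s\<in>{0..1}. \<forall>t\<in>{0..1}. norm (d t) \<le> norm (d s)"
    by (intro continuous_attains_sup continuous_on_norm) auto
  then obtain s where s: "s \<in> {0..1}" "\<And>t. t \<in> {0..1} \<Longrightarrow> norm (d t) \<le> norm (d s)"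
    by blast
  have K: "norm (d' t) \<le> A + norm (d s) / 2" if "t \<in> {0..1}" for t
    using bd[OF that] s(2)[OF that] by linarith
  have "norm (d s - d 0) \<le> (A + norm (d s) / 2) * norm (s - 0)"
  proof (rule differentiable_bound[OF convex_real_interval(5)])
    show "(d has_derivative (\<lambda>x. x *\<^sub>R d' t)) (at t within {0..1})" if "t \<in> {0..1}" for t
      using d[OF that] by (simp add: has_vector_derivative_def)
    show "onorm (\<lambda>x. x *\<^sub>R d' t) \<le> A + norm (d s) / 2" if "t \<in> {0..1}" for t
      using K[OF that] by (simp add: onorm_scaleR_left[OF bounded_linear_ident] onorm_id)
  qed (use s in auto)
  also have "\<dots> \<le> (A + norm (d s) / 2) * 1"
    using s(1) K[of 0] norm_ge_zero[of "d' 0"] by (intro mult_left_mono) (simp_all del: norm_ge_zero)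
  finally show ?thesis using s(2)[OF t] d0 by simp
qed

text \<open>The equation is f'(u) = b(f(u)). In \<open>db x w v\<close> the direction of
  differentiation is \<open>w\<close>, and \<open>v\<close> is the argument of \<open>b\<close>. A
  solution would have the second derivative \<open>db (f u) (b (f u) w) v\<close> in the directions
  \<open>v\<close> and \<open>w\<close>; \<open>sym\<close> is its symmetry. A single constant
  \<open>C\<close> serves for all estimates.\<close>

locale total_differential_equation =
  fixes b :: "'a::euclidean_space \<Rightarrow> 'a \<Rightarrow> 'a" and db :: "'a \<Rightarrow> 'a \<Rightarrow> 'a \<Rightarrow> 'a"
    and x0 :: 'a and R C :: real
  assumes R: "R > 0" and C: "C > 0"
    and lin: "x \<in> cball x0 R \<Longrightarrow> linear (b x)"
    and bound: "x \<in> cball x0 R \<Longrightarrow> norm (b x v) \<le> C * norm v"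
    and lip: "x \<in> cball x0 R \<Longrightarrow> y \<in> cball x0 R \<Longrightarrow> norm (b x v - b y v) \<le> C * norm (x - y) * norm v"
    and db_lin: "x \<in> cball x0 R \<Longrightarrow> linear (\<lambda>w. db x w v)"
    and db_bound: "x \<in> cball x0 R \<Longrightarrow> norm (db x w v) \<le> C * norm w * norm v"
    and taylor: "x \<in> cball x0 R \<Longrightarrow> y \<in> cball x0 R \<Longrightarrow>
      norm (b y v - b x v - db x (y - x) v) \<le> C * (norm (y - x))\<^sup>2 * norm v"
    and deriv: "x \<in> cball x0 R \<Longrightarrow> ((\<lambda>x. b x v) has_derivative (\<lambda>w. db x w v)) (at x)"
    and sym: "x \<in> cball x0 R \<Longrightarrow> db x (b x u) v = db x (b x v) u"
begin

text \<open>The first bound makes the integral operator a contraction with factor 1/2; the second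
  keeps its values within distance \<open>R\<close> of \<open>x0\<close>.\<close>

definition \<rho> :: real where "\<rho> = min (1 / (2 * C)) (R / C)"

lemma \<rho>: "\<rho> > 0" "C * \<rho> \<le> 1 / 2" "C * \<rho> \<le> R"
proof -
  show "\<rho> > 0" using R C by (simp add: \<rho>_def)
  have "C * \<rho> \<le> C * (1 / (2 * C))" "C * \<rho> \<le> C * (R / C)"
    unfolding \<rho>_def using C by (intro mult_left_mono; simp)+
  then show "C * \<rho> \<le> 1 / 2" "C * \<rho> \<le> R" using C by auto
qed

lemma b_continuous: "continuous_on (cball x0 R) (\<lambda>x. b x v)"
  by (rule continuous_at_imp_continuous_on) (auto intro: has_derivative_continuous[OF deriv])

text \<open>Nearest point projections are inserted before \<open>b\<close>, onto
  \<open>cball x0 R\<close> for the state and onto \<open>cball 0 \<rho>\<close> for the argument.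
  The integral operator then acts on all bounded continuous functions on the whole space, a complete
  space. At the fixed point the first projection does nothing, and on \<open>cball 0 \<rho>\<close>
  neither does the second.\<close>

lemma fixed_point:
  obtains f where "continuous_on UNIV f" "\<And>u. f u \<in> cball x0 R"
    "\<And>u. u \<in> cball 0 \<rho> \<Longrightarrow> f u = x0 + integral {0..1} (\<lambda>t. b (f (t *\<^sub>R u)) u)"
proof -
  define cp where "cp = closest_point (cball x0 R)"
  define k where "k = closest_point (cball (0::'a) \<rho>)"
  have cp: "cp x \<in> cball x0 R" for x
    unfolding cp_def using R by (intro closest_point_in_set) auto
  have k: "norm (k x) \<le> \<rho>" for x
    using closest_point_in_set[of "cball (0::'a) \<rho>" x] \<rho> by (simp add: k_def)
  have cp_lip: "norm (cp x - cp y) \<le> norm (x - y)" for x y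
    using closest_point_lipschitz[of "cball x0 R" x y] R by (simp add: cp_def dist_norm)
  have cp_cont: "continuous_on UNIV cp" and k_cont: "continuous_on UNIV k"
    using R \<rho> by (auto simp: cp_def k_def intro!: continuous_on_closest_point)
  \<comment> \<open>Continuity of \<open>b\<close> in the point is known for each fixed vector only.
    The basis expansion gives joint continuity in point and vector, as required of a parametric
    integral.\<close>
  have expand: "b (cp x) v = (\<Sum>i\<in>Basis. (v \<bullet> i) *\<^sub>R b (cp x) i)" for x v
  proof -
    have "b (cp x) (\<Sum>i\<in>Basis. (v \<bullet> i) *\<^sub>R i) = (\<Sum>i\<in>Basis. (v \<bullet> i) *\<^sub>R b (cp x) i)"
      by (simp only: linear_sum[OF lin[OF cp]] linear_scale[OF lin[OF cp]])
    then show ?thesis by (simp only: euclidean_representation)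
  qed
  have b_cp: "continuous_on UNIV (\<lambda>x. b (cp x) i)" for i
    by (rule continuous_on_compose2[OF b_continuous cp_cont]) (use cp in auto)
  have int_cont: "continuous_on (UNIV \<times> cbox 0 1) (\<lambda>(u, t). b (cp (f (t *\<^sub>R u))) (k u))"
    if "continuous_on UNIV f" for f :: "'a \<Rightarrow> 'a"
  proof -
    have "(\<lambda>(u, t). b (cp (f (t *\<^sub>R u))) (k u)) =
        (\<lambda>p. \<Sum>i\<in>Basis. (k (fst p) \<bullet> i) *\<^sub>R b (cp (f (snd p *\<^sub>R fst p))) i)"
      by (rule ext) (simp only: split_beta, rule expand)
    moreover have "continuous_on (UNIV \<times> cbox 0 1) \<dots>"
      by (intro continuous_intros continuous_on_compose2[OF b_cp] continuous_on_compose2[OF that]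
        continuous_on_compose2[OF k_cont]) auto
    ultimately show ?thesis by (simp only:)
  qed
  have int_cont1: "continuous_on {0..1} (\<lambda>t. b (cp (f (t *\<^sub>R u))) (k u))"
    if "continuous_on UNIV f" for f :: "'a \<Rightarrow> 'a" and u
    by (intro continuous_on_compose2[OF b_cp] continuous_on_compose2[OF that] continuous_intros) auto
  have int_bd: "norm (integral {0..1} (\<lambda>t. b (cp (f (t *\<^sub>R u))) (k u))) \<le> C * \<rho>"
    if "continuous_on UNIV f" for f :: "'a \<Rightarrow> 'a" and u
  proof -
    have "norm (b (cp x) (k u)) \<le> C * \<rho>" for x
      by (rule order_trans[OF bound[OF cp] mult_left_mono[OF k]]) (use C in simp)
    then show ?thesis using integral_bound[OF _ int_cont1[OF that], of u "C * \<rho>"] by simp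
  qed
  define T where "T f u = x0 + integral {0..1} (\<lambda>t. b (cp (f (t *\<^sub>R u))) (k u))" for f u
  have T_bcont: "T f \<in> bcontfun" if "continuous_on UNIV f" for f
  proof (rule bcontfun_normI)
    show "continuous_on UNIV (T f)"
      unfolding T_def using integral_continuous_on_param[OF int_cont[OF that]]
      by (intro continuous_intros) simp
    show "norm (T f u) \<le> norm x0 + C * \<rho>" for u
      unfolding T_def by (rule order_trans[OF norm_triangle_ineq add_left_mono[OF int_bd[OF that]]])
  qed
  define TT where "TT f = Bcontfun (T (apply_bcontfun f))" for f :: "'a \<Rightarrow>\<^sub>C 'a"
  have TT: "apply_bcontfun (TT f) u = T (apply_bcontfun f) u" for f u
    unfolding TT_def by (subst Bcontfun_inverse) (auto intro: T_bcont)
  have contr: "dist (TT f) (TT g) \<le> (1 / 2) * dist f g" for f g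
  proof (rule dist_bound)
    fix u
    let ?I = "\<lambda>f t. b (cp (apply_bcontfun f (t *\<^sub>R u))) (k u)"
    have c: "continuous_on {0..1} (?I f)" for f by (intro int_cont1) simp
    have bd: "norm (?I f t - ?I g t) \<le> (1 / 2) * dist f g" for t
    proof -
      have "norm (?I f t - ?I g t) \<le> C * norm (cp (apply_bcontfun f (t *\<^sub>R u)) - cp (apply_bcontfun g (t *\<^sub>R u))) * norm (k u)"
        by (intro lip cp)
      also have "\<dots> \<le> C * dist f g * \<rho>"
      proof (intro mult_mono k)
        show "norm (cp (apply_bcontfun f (t *\<^sub>R u)) - cp (apply_bcontfun g (t *\<^sub>R u))) \<le> dist f g"
          by (rule order_trans[OF cp_lip]) (use dist_bounded[of f _ g] in \<open>simp add: dist_norm\<close>)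
      qed (use C in auto)
      also have "\<dots> = (C * \<rho>) * dist f g" by simp
      also have "\<dots> \<le> (1 / 2) * dist f g" using \<rho> by (intro mult_right_mono) auto
      finally show ?thesis .
    qed
    have "dist (apply_bcontfun (TT f) u) (apply_bcontfun (TT g) u) = norm (integral {0..1} (\<lambda>t. ?I f t - ?I g t))"
      using integral_diff[OF integrable_continuous_real[OF c[of f]] integrable_continuous_real[OF c[of g]]]
      by (simp add: TT T_def dist_norm)
    also have "\<dots> \<le> (1 / 2) * dist f g * (1 - 0)"
      by (rule integral_bound) (use bd c in \<open>auto intro!: continuous_on_diff\<close>)
    finally show "dist (apply_bcontfun (TT f) u) (apply_bcontfun (TT g) u) \<le> (1 / 2) * dist f g" by simp
  qed
  obtain F where F: "TT F = F"
    using banach_fix_type[of "1/2" TT] contr by auto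
  define f where "f = apply_bcontfun F"
  have f_cont: "continuous_on UNIV f" by (simp add: f_def)
  have fT: "f u = T f u" for u using TT[of F u] by (simp add: f_def F)
  \<comment> \<open>The integral has norm at most \<open>C * \<rho>\<close>, which is at most
    \<open>R\<close>, so the values stay where the projection \<open>cp\<close> is the
    identity.\<close>
  have f_in: "f u \<in> cball x0 R" for u
    using int_bd[OF f_cont, of u] \<rho>(3) fT[of u] by (simp add: T_def dist_norm)
  show ?thesis
  proof
    show "f u = x0 + integral {0..1} (\<lambda>t. b (f (t *\<^sub>R u)) u)" if "u \<in> cball 0 \<rho>" for u
      using fT[of u] that f_in unfolding T_def cp_def k_def by (simp add: closest_point_self)
  qed (use f_cont f_in in auto)
qed

theorem solution_exists:
  obtains f where "f 0 = x0" "\<And>u. u \<in> ball 0 \<rho> \<Longrightarrow> f u \<in> cball x0 R"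
    "\<And>u. u \<in> ball 0 \<rho> \<Longrightarrow> (f has_derivative b (f u)) (at u)"
proof -
  obtain f where f_cont: "continuous_on UNIV f" and f_in: "\<And>u. f u \<in> cball x0 R"
    and f_eq: "\<And>u. u \<in> cball 0 \<rho> \<Longrightarrow> f u = x0 + integral {0..1} (\<lambda>t. b (f (t *\<^sub>R u)) u)"
    using fixed_point by blast
  have b0: "b x 0 = 0" if "x \<in> cball x0 R" for x using lin[OF that] by (rule linear_0)
  have f0: "f 0 = x0" using f_eq[of 0] \<rho> by (simp add: b0[OF f_in])
  \<comment> \<open>Substituting \<open>t * r\<close> for the variable turns the equation at
    \<open>t *\<^sub>R u\<close> into an integral over \<open>{0..t}\<close> of one fixed function.
    So \<open>f\<close> restricted to a ray solves an ordinary differential equation.\<close>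
  have ray: "((\<lambda>s. f (s *\<^sub>R u)) has_vector_derivative b (f (s *\<^sub>R u)) u) (at s within {0..1})"
    if u: "u \<in> cball 0 \<rho>" and s: "s \<in> {0..1}" for u s
  proof -
    define g where "g t = b (f (t *\<^sub>R u)) u" for t
    have g: "continuous_on {0..1} g"
      unfolding g_def
      by (intro continuous_on_compose2[OF b_continuous] continuous_on_compose2[OF f_cont] continuous_intros)
        (use f_in in auto)
    have eq: "x0 + integral {0..t} g = f (t *\<^sub>R u)" if t: "t \<in> {0..1}" for t
    proof -
      have "t * norm u \<le> 1 * \<rho>" using t u by (intro mult_mono) auto
      then have "f (t *\<^sub>R u) = x0 + integral {0..1} (\<lambda>r. b (f (r *\<^sub>R t *\<^sub>R u)) (t *\<^sub>R u))"
        using t by (intro f_eq) auto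
      moreover have *: "((\<lambda>r. t *\<^sub>R g (t * r)) has_integral integral {t * 0..t * 1} g) {0..1}"
        using t by (intro has_integral_substitution[where c = 0 and d = 1] g)
          (auto intro!: derivative_eq_intros simp: mult_le_one)
      moreover have "(\<lambda>r. b (f (r *\<^sub>R t *\<^sub>R u)) (t *\<^sub>R u)) = (\<lambda>r. t *\<^sub>R g (t * r))"
        using lin[OF f_in] by (simp add: g_def linear_scale mult.commute)
      ultimately show ?thesis using integral_unique[OF *] by (simp del: integral_scaleR_right integral_cmul)
    qed
    have "((\<lambda>t. x0 + integral {0..t} g) has_vector_derivative 0 + g s) (at s within {0..1})"
      by (intro has_vector_derivative_add has_vector_derivative_const integral_has_vector_derivative g s)
    then have "((\<lambda>t. x0 + integral {0..t} g) has_vector_derivative b (f (s *\<^sub>R u)) u) (at s within {0..1})"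
      by (simp add: g_def)
    then show ?thesis
      by (rule has_vector_derivative_transform[rotated 2]) (use s eq in auto)
  qed
  \<comment> \<open>The derivative across rays: the solutions along the rays towards
    \<open>u\<close> and \<open>u + v\<close> are compared, and \<open>f\<close> turns out to be
    affine up to a quadratic error with constant independent of \<open>u\<close>.\<close>
  have est: "norm (f (u + v) - f u - b (f u) v) \<le> 8 * C\<^sup>2 * (norm v)\<^sup>2"
    if u: "u \<in> cball 0 \<rho>" and uv: "u + v \<in> cball 0 \<rho>" for u v
  proof -
    let ?y0 = "\<lambda>t. f (t *\<^sub>R u)" and ?y1 = "\<lambda>t. f (t *\<^sub>R (u + v))"
    \<comment> \<open>\<open>d\<close> is the gap between the two rays and \<open>e\<close> what is
      left of it after its expected linear part. First \<open>d\<close> is shown to be of first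
      order in \<open>v\<close>, then \<open>e\<close> of second order.\<close>
    define d where "d t = ?y1 t - ?y0 t" for t
    define e where "e t = d t - t *\<^sub>R b (?y0 t) v" for t
    have Cu: "C * norm u \<le> 1 / 2"
      using u \<rho>(2) C by (meson mem_cball_0 mult_left_mono less_imp_le order_trans)
    have b_add: "b (?y1 t) (u + v) = b (?y1 t) u + b (?y1 t) v" for t
      using lin[OF f_in] by (rule linear_add)
    have d_le: "norm (d t) \<le> 2 * (C * norm v)" if t: "t \<in> {0..1}" for t
    proof (rule norm_le_of_derivative_bound[OF _ _ _ t])
      fix t :: real assume t: "t \<in> {0..1}"
      show "(d has_vector_derivative b (?y1 t) (u + v) - b (?y0 t) u) (at t within {0..1})"
        unfolding d_def by (intro has_vector_derivative_diff ray u uv t)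
      have "norm (b (?y1 t) (u + v) - b (?y0 t) u) \<le> norm (b (?y1 t) v) + norm (b (?y1 t) u - b (?y0 t) u)"
        unfolding b_add by (metis add.commute add_diff_eq norm_triangle_ineq)
      also have "\<dots> \<le> C * norm v + C * norm (d t) * norm u"
        unfolding d_def by (intro add_mono bound lip f_in)
      also have "\<dots> = C * norm v + (C * norm u) * norm (d t)" by simp
      also have "\<dots> \<le> C * norm v + (1 / 2) * norm (d t)"
        by (intro add_left_mono mult_right_mono Cu) auto
      finally show "norm (b (?y1 t) (u + v) - b (?y0 t) u) \<le> C * norm v + norm (d t) / 2" by simp
    qed (simp add: d_def)
    let ?e' = "\<lambda>t. b (?y1 t) (u + v) - b (?y0 t) u - (b (?y0 t) v + t *\<^sub>R db (?y0 t) (b (?y0 t) u) v)"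
    have "norm (e 1) \<le> 2 * (4 * C\<^sup>2 * (norm v)\<^sup>2)"
    proof (rule norm_le_of_derivative_bound)
      fix t :: real assume t: "t \<in> {0..1}"
      have bd: "((\<lambda>t. b (?y0 t) v) has_vector_derivative db (?y0 t) (b (?y0 t) u) v) (at t within {0..1})"
        using vector_derivative_diff_chain_within[OF ray[OF u t] has_derivative_at_withinI[OF deriv[OF f_in]]]
        by (simp add: o_def)
      show "(e has_vector_derivative ?e' t) (at t within {0..1})"
        unfolding e_def d_def
        using has_vector_derivative_scaleR[OF DERIV_ident bd]
        by (intro has_vector_derivative_diff ray u uv t) (simp add: add.commute)
      \<comment> \<open>Compatibility moves \<open>v\<close> into the direction slot, where
        \<open>t *\<^sub>R b (?y0 t) v\<close> is \<open>d t - e t\<close>. The part with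
        \<open>d t\<close> is the linear Taylor term of \<open>b\<close> between the rays, and the
        part with \<open>e t\<close> is absorbed by the Gronwall estimate.\<close>
      have "t *\<^sub>R db (?y0 t) (b (?y0 t) u) v = t *\<^sub>R db (?y0 t) (b (?y0 t) v) u"
        using sym[OF f_in] by simp
      also have "\<dots> = db (?y0 t) (d t) u - db (?y0 t) (e t) u"
        unfolding e_def by (simp add: linear_diff[OF db_lin[OF f_in]] linear_scale[OF db_lin[OF f_in]])
      finally have "?e' t = (b (?y1 t) v - b (?y0 t) v)
          + (b (?y1 t) u - b (?y0 t) u - db (?y0 t) (?y1 t - ?y0 t) u) + db (?y0 t) (e t) u"
        unfolding b_add d_def by simp
      also have "norm \<dots> \<le> C * norm (d t) * norm v + C * (norm (d t))\<^sup>2 * norm u + C * norm (e t) * norm u"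
        unfolding d_def by (intro norm_triangle_le add_mono lip taylor db_bound f_in)
      also have "\<dots> \<le> C * (2 * (C * norm v)) * norm v + (1 / 2) * (2 * (C * norm v))\<^sup>2 + (1 / 2) * norm (e t)"
      proof (intro add_mono)
        show "C * norm (d t) * norm v \<le> C * (2 * (C * norm v)) * norm v"
          using C by (intro mult_mono d_le t) auto
        have "(C * norm u) * (norm (d t))\<^sup>2 \<le> (1 / 2) * (2 * (C * norm v))\<^sup>2"
          using C by (intro mult_mono power_mono d_le t Cu) auto
        then show "C * (norm (d t))\<^sup>2 * norm u \<le> (1 / 2) * (2 * (C * norm v))\<^sup>2" by (simp add: mult_ac)
        have "(C * norm u) * norm (e t) \<le> (1 / 2) * norm (e t)" by (intro mult_right_mono Cu) auto
        then show "C * norm (e t) * norm u \<le> (1 / 2) * norm (e t)" by (simp add: mult_ac)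
      qed
      \<comment> \<open>The Lipschitz and the Taylor term contribute
        \<open>2 * C\<^sup>2 * (norm v)\<^sup>2\<close> each; the Gronwall estimate doubles their
        sum, whence the 8 in \<open>est\<close>.\<close>
      also have "\<dots> = 4 * C\<^sup>2 * (norm v)\<^sup>2 + norm (e t) / 2"
        by (simp add: power2_eq_square)
      finally show "norm (?e' t) \<le> 4 * C\<^sup>2 * (norm v)\<^sup>2 + norm (e t) / 2" .
    qed (auto simp: e_def d_def)
    then show ?thesis by (simp add: e_def d_def)
  qed
  have "(f has_derivative b (f u)) (at u)" if u: "u \<in> ball 0 \<rho>" for u
  proof (rule has_derivativeI_sandwich)
    show "0 < \<rho> - norm u" using u by simp
    show "bounded_linear (b (f u))" using lin[OF f_in] by (simp add: linear_conv_bounded_linear)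
    fix y assume y: "y \<noteq> u" "dist y u < \<rho> - norm u"
    have "norm y \<le> norm u + norm (y - u)" by norm
    then have "norm (f (u + (y - u)) - f u - b (f u) (y - u)) \<le> 8 * C\<^sup>2 * (norm (y - u))\<^sup>2"
      using u y by (intro est) (auto simp: dist_norm)
    then show "norm (f y - f u - b (f u) (y - u)) / norm (y - u) \<le> 8 * C\<^sup>2 * norm (y - u)"
      using y by (simp add: power2_eq_square field_simps)
  next
    have "((\<lambda>y. 8 * C\<^sup>2 * norm (y - u)) \<longlongrightarrow> 8 * C\<^sup>2 * norm (u - u)) (at u)"
      by (intro tendsto_intros)
    then show "((\<lambda>y. 8 * C\<^sup>2 * norm (y - u)) \<longlongrightarrow> 0) (at u)" by simp
  qed
  then show ?thesis using that f0 f_in by blast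
qed

end

section \<open>Uniform bounds on compact sets\<close>

text \<open>Smoothness controls a derivative one direction at a time. Bounds on the finitely many
  basis vectors combine into a bound uniform in the direction.\<close>

lemma linear_basis_bound:
  fixes h :: "'a::euclidean_space \<Rightarrow> 'b::real_normed_vector"
  assumes "linear h" "\<And>b. b \<in> Basis \<Longrightarrow> norm (h b) \<le> c b"
  shows "norm (h v) \<le> (\<Sum>b\<in>Basis. c b) * norm v"
proof -
  have "h v = h (\<Sum>b\<in>Basis. (v \<bullet> b) *\<^sub>R b)" by (simp only: euclidean_representation)
  also have "\<dots> = (\<Sum>b\<in>Basis. (v \<bullet> b) *\<^sub>R h b)"
    by (simp only: linear_sum[OF assms(1)] linear_scale[OF assms(1)])
  also have "norm \<dots> \<le> (\<Sum>b\<in>Basis. c b * norm v)"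
  proof (rule order_trans[OF norm_sum sum_mono])
    fix b :: 'a assume b: "b \<in> Basis"
    have "norm (v \<bullet> b) * norm (h b) \<le> norm v * c b"
      using b Basis_le_norm[OF b, of v] assms(2)[OF b] by (intro mult_mono) auto
    then show "norm ((v \<bullet> b) *\<^sub>R h b) \<le> c b * norm v" by (simp add: mult.commute)
  qed
  finally show ?thesis by (simp add: sum_distrib_right)
qed

lemma lipschitz_of_frechet_derivative_bound:
  assumes g: "\<And>x. x \<in> K \<Longrightarrow> (g has_derivative g' x) (at x)" and K: "convex K" and C: "0 \<le> C"
    and bd: "\<And>x v. x \<in> K \<Longrightarrow> norm (g' x v) \<le> C * norm v"
    and xy: "x \<in> K" "y \<in> K"
  shows "norm (g x - g y) \<le> C * norm (x - y)"
proof (rule differentiable_bound[OF K _ _ xy])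
  show "(g has_derivative g' x) (at x within K)" if "x \<in> K" for x
    using g[OF that] by (rule has_derivative_at_withinI)
  show "onorm (g' x) \<le> C" if "x \<in> K" for x
    by (rule onorm_bound[OF C]) (rule bd[OF that])
qed

lemma smooth_on_compact_derivative_bound:
  fixes g :: "'a::euclidean_space \<Rightarrow> 'b::real_normed_vector"
  assumes g: "smooth_on S g" and K: "compact K" "K \<subseteq> S"
  obtains C where "C > 0" "\<And>x v. x \<in> K \<Longrightarrow> norm (frechet_derivative g (at x) v) \<le> C * norm v"
proof -
  have "\<exists>c. \<forall>x\<in>K. norm (frechet_derivative g (at x) b) \<le> c" for b
  proof -
    have "continuous_on K (\<lambda>x. frechet_derivative g (at x) b)"
      by (rule continuous_on_subset[OF smooth_on_imp_continuous_on[OF smooth_on_frechet_derivative[OF g]] K(2)])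
    then have "bounded ((\<lambda>x. frechet_derivative g (at x) b) ` K)"
      by (intro compact_imp_bounded compact_continuous_image K(1))
    then show ?thesis by (auto simp: bounded_iff)
  qed
  then obtain c where c: "\<And>b x. x \<in> K \<Longrightarrow> norm (frechet_derivative g (at x) b) \<le> c b"
    by metis
  let ?C = "(\<Sum>b\<in>Basis. c b)"
  \<comment> \<open>The absolute value and the added 1 make the constant strictly positive, even for
    vanishing derivatives.\<close>
  have bd: "norm (frechet_derivative g (at x) v) \<le> (\<bar>?C\<bar> + 1) * norm v" if x: "x \<in> K" for x v
  proof -
    have "(g has_derivative frechet_derivative g (at x)) (at x)"
      using smooth_on_has_derivative[OF g] x K by blast
    then have "norm (frechet_derivative g (at x) v) \<le> ?C * norm v"
      by (intro linear_basis_bound c x has_derivative_linear)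
    also have "\<dots> \<le> (\<bar>?C\<bar> + 1) * norm v" by (intro mult_right_mono) auto
    finally show ?thesis .
  qed
  show ?thesis by (rule that[of "\<bar>?C\<bar> + 1"]) (use bd in auto)
qed

text \<open>These are the estimates demanded by \<open>total_differential_equation\<close>, with one
  common constant. The last comes from a Lipschitz bound on the derivative, that is, from the second
  derivatives.\<close>

lemma smooth_on_compact_bounds:
  fixes g :: "'a::euclidean_space \<Rightarrow> 'b::real_normed_vector"
  assumes g: "smooth_on S g" and K: "compact K" "convex K" "K \<subseteq> S"
  obtains C where "C > 0"
    "\<And>x. x \<in> K \<Longrightarrow> norm (g x) \<le> C"
    "\<And>x y. x \<in> K \<Longrightarrow> y \<in> K \<Longrightarrow> norm (g x - g y) \<le> C * norm (x - y)"
    "\<And>x v. x \<in> K \<Longrightarrow> norm (frechet_derivative g (at x) v) \<le> C * norm v"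
    "\<And>x y. x \<in> K \<Longrightarrow> y \<in> K \<Longrightarrow>
       norm (g y - g x - frechet_derivative g (at x) (y - x)) \<le> C * (norm (y - x))\<^sup>2"
proof -
  let ?D = "\<lambda>x. frechet_derivative g (at x)"
  have der: "(g has_derivative ?D x) (at x)" if "x \<in> K" for x
    using smooth_on_has_derivative[OF g] that K by blast
  have "bounded (g ` K)"
    by (intro compact_imp_bounded compact_continuous_image K(1)
        continuous_on_subset[OF smooth_on_imp_continuous_on[OF g] K(3)])
  then obtain C0 where C0: "\<And>x. x \<in> K \<Longrightarrow> norm (g x) \<le> C0"
    by (auto simp: bounded_iff)
  obtain C1 where C1: "C1 > 0" "\<And>x v. x \<in> K \<Longrightarrow> norm (?D x v) \<le> C1 * norm v"
    using smooth_on_compact_derivative_bound[OF g K(1,3)] by blast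
  have "\<exists>c. \<forall>x\<in>K. \<forall>y\<in>K. norm (?D x b - ?D y b) \<le> c * norm (x - y)" for b
  proof -
    have s: "smooth_on S (\<lambda>x. ?D x b)" by (rule smooth_on_frechet_derivative[OF g])
    obtain c where cpos: "c > 0" and c: "\<And>x v. x \<in> K \<Longrightarrow> norm (frechet_derivative (\<lambda>x. ?D x b) (at x) v) \<le> c * norm v"
      using smooth_on_compact_derivative_bound[OF s K(1,3)] by blast
    show ?thesis
    proof (intro exI ballI)
      fix x y assume "x \<in> K" "y \<in> K"
      then show "norm (?D x b - ?D y b) \<le> c * norm (x - y)"
        by (intro lipschitz_of_frechet_derivative_bound[where g = "\<lambda>x. ?D x b" and K = K
              and g' = "\<lambda>x. frechet_derivative (\<lambda>x. ?D x b) (at x)"]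
            smooth_on_has_derivative[OF s] K(2) c less_imp_le[OF cpos] subsetD[OF K(3)])
    qed
  qed
  then obtain c where c: "\<And>b x y. x \<in> K \<Longrightarrow> y \<in> K \<Longrightarrow> norm (?D x b - ?D y b) \<le> c b * norm (x - y)"
    by metis
  define C2 where "C2 = \<bar>\<Sum>b\<in>Basis. c b\<bar>"
  have C2: "norm (?D x v - ?D y v) \<le> C2 * norm (x - y) * norm v" if "x \<in> K" "y \<in> K" for x y v
  proof -
    have "linear (\<lambda>v. ?D x v - ?D y v)"
      using der that by (intro linear_compose_sub has_derivative_linear)
    then have "norm (?D x v - ?D y v) \<le> (\<Sum>b\<in>Basis. c b * norm (x - y)) * norm v"
      by (rule linear_basis_bound) (use c that in auto)
    also have "\<dots> = (\<Sum>b\<in>Basis. c b) * (norm (x - y) * norm v)" by (simp add: sum_distrib_right mult.assoc)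
    also have "\<dots> \<le> C2 * (norm (x - y) * norm v)"
      unfolding C2_def by (intro mult_right_mono) auto
    finally show ?thesis by simp
  qed
  have taylor: "norm (g y - g x - ?D x (y - x)) \<le> C2 * (norm (y - x))\<^sup>2" if xy: "x \<in> K" "y \<in> K" for x y
  proof -
    have seg: "closed_segment x y \<subseteq> K" using xy K by (simp add: closed_segment_subset)
    have lin: "linear (?D x)" using der xy by (intro has_derivative_linear)
    \<comment> \<open>Taylor estimate: the mean value inequality for \<open>g\<close> minus its
      linear part at \<open>x\<close>. On the segment the derivative of this difference is at most
      \<open>C2 * norm (y - x)\<close>.\<close>
    have "norm ((g y - ?D x y) - (g x - ?D x x)) \<le> (C2 * norm (y - x)) * norm (y - x)"
    proof (rule lipschitz_of_frechet_derivative_bound[where K = "closed_segment x y" and g' = "\<lambda>z v. ?D z v - ?D x v"])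
      fix z assume z: "z \<in> closed_segment x y"
      show "((\<lambda>z. g z - ?D x z) has_derivative (\<lambda>v. ?D z v - ?D x v)) (at z)"
        using z seg xy der by (intro has_derivative_diff bounded_linear_imp_has_derivative has_derivative_bounded_linear) auto
      show "norm (?D z v - ?D x v) \<le> C2 * norm (y - x) * norm v" for v
      proof -
        have "norm (?D z v - ?D x v) \<le> C2 * norm (z - x) * norm v"
          using z seg xy by (intro C2) auto
        also have "\<dots> \<le> C2 * norm (y - x) * norm v"
          using segment_bound1[OF z] by (intro mult_right_mono mult_left_mono) (auto simp: C2_def norm_minus_commute)
        finally show ?thesis .
      qed
    qed (auto simp: C2_def)
    then show ?thesis by (simp add: linear_diff[OF lin] algebra_simps power2_eq_square)
  qed
  define C where "C = max (max C0 C1) C2"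
  have C: "C0 \<le> C" "C1 \<le> C" "C2 \<le> C" by (auto simp: C_def)
  show ?thesis
  proof
    show "C > 0" using C1 C by linarith
    show "norm (g x) \<le> C" if "x \<in> K" for x using C0[OF that] C by linarith
    show "norm (?D x v) \<le> C * norm v" if "x \<in> K" for x v
      using C1(2)[OF that, of v] mult_right_mono[OF C(2), of "norm v"] by simp
    show "norm (g x - g y) \<le> C * norm (x - y)" if "x \<in> K" "y \<in> K" for x y
      using lipschitz_of_frechet_derivative_bound[OF der K(2) less_imp_le[OF C1(1)] C1(2) that]
        mult_right_mono[OF C(2), of "norm (x - y)"] by simp
    show "norm (g y - g x - ?D x (y - x)) \<le> C * (norm (y - x))\<^sup>2" if "x \<in> K" "y \<in> K" for x y
      using taylor[OF that] mult_right_mono[OF C(3), of "(norm (y - x))\<^sup>2"] by simp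
  qed
qed

section \<open>Smooth solutions of total differential equations\<close>

proposition total_differential_equation_smooth_solution:
  fixes B :: "real^'n \<Rightarrow> real^'n^'n"
  assumes S: "open S" "x0 \<in> S" and B: "smooth_on S B"
    and sym: "\<And>x u v. x \<in> S \<Longrightarrow>
      frechet_derivative B (at x) (B x *v u) *v v = frechet_derivative B (at x) (B x *v v) *v u"
  obtains r f where "r > 0" "f 0 = x0" "smooth_on (ball 0 r) f"
    "\<And>u. u \<in> ball 0 r \<Longrightarrow> f u \<in> S"
    "\<And>u. u \<in> ball 0 r \<Longrightarrow> (f has_derivative (*v) (B (f u))) (at u)"
proof -
  let ?D = "\<lambda>x. frechet_derivative B (at x)"
  obtain R where Rad: "R > 0" "cball x0 R \<subseteq> S" using S open_contains_cball by blast
  obtain C where C: "C > 0"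
    "\<And>x. x \<in> cball x0 R \<Longrightarrow> norm (B x) \<le> C"
    "\<And>x y. x \<in> cball x0 R \<Longrightarrow> y \<in> cball x0 R \<Longrightarrow> norm (B x - B y) \<le> C * norm (x - y)"
    "\<And>x v. x \<in> cball x0 R \<Longrightarrow> norm (?D x v) \<le> C * norm v"
    "\<And>x y. x \<in> cball x0 R \<Longrightarrow> y \<in> cball x0 R \<Longrightarrow> norm (B y - B x - ?D x (y - x)) \<le> C * (norm (y - x))\<^sup>2"
    using smooth_on_compact_bounds[OF B compact_cball convex_cball Rad(2)] by blast
  \<comment> \<open>\<open>k\<close> compares the norm of a matrix as an element of
    \<open>real^'n^'n\<close> with its action on vectors; this turns \<open>C\<close> into the
    constant \<open>C * k\<close> of the locale.\<close>
  obtain k where k: "k > 0" "\<And>(A::real^'n^'n) v. norm (A *v v) \<le> norm A * norm v * k"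
    using bounded_bilinear.pos_bounded[OF bounded_bilinear_matrix_vector_mult] by blast
  have kC: "norm (A *v v) \<le> (C * k) * c * norm v" if "norm A \<le> C * c" for A :: "real^'n^'n" and v c
  proof -
    have "norm A * norm v * k \<le> (C * c) * norm v * k"
      using that k by (intro mult_right_mono) auto
    then show ?thesis using k(2)[of A v] by (simp add: mult_ac)
  qed
  have der: "(B has_derivative ?D x) (at x)" if "x \<in> cball x0 R" for x
    using smooth_on_has_derivative[OF B] that Rad by blast
  interpret total_differential_equation "\<lambda>x v. B x *v v" "\<lambda>x w v. ?D x w *v v" x0 R "C * k"
  proof (rule total_differential_equation.intro)
    show "R > 0" "C * k > 0" using Rad C k by auto
  next
    fix x v assume x: "x \<in> cball x0 R"
    show "norm (B x *v v) \<le> C * k * norm v" using kC[of "B x" 1 v] C(2)[OF x] by simp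
    show "linear (\<lambda>w. ?D x w *v v)"
      using linear_compose[OF has_derivative_linear[OF der[OF x]]
          bounded_linear.linear[OF bounded_bilinear.bounded_linear_left[OF bounded_bilinear_matrix_vector_mult]]]
      by (simp add: o_def)
    show "((\<lambda>x. B x *v v) has_derivative (\<lambda>w. ?D x w *v v)) (at x)"
      using bounded_linear.has_derivative[OF bounded_bilinear.bounded_linear_left[OF bounded_bilinear_matrix_vector_mult] der[OF x]] .
    show "norm (?D x w *v v) \<le> C * k * norm w * norm v" for w by (rule kC[OF C(4)[OF x]])
    show "?D x (B x *v u) *v v = ?D x (B x *v v) *v u" for u using sym x Rad by blast
    fix y assume y: "y \<in> cball x0 R"
    show "norm (B x *v v - B y *v v) \<le> C * k * norm (x - y) * norm v"
      using kC[OF C(3)[OF x y], of v] by (simp add: matrix_vector_mult_diff_rdistrib)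
    show "norm (B y *v v - B x *v v - ?D x (y - x) *v v) \<le> C * k * (norm (y - x))\<^sup>2 * norm v"
      using kC[OF C(5)[OF x y], of v] by (simp add: matrix_vector_mult_diff_rdistrib)
  qed (simp add: matrix_vector_mul_linear)
  obtain f where f: "f 0 = x0" "\<And>u. u \<in> ball 0 \<rho> \<Longrightarrow> f u \<in> cball x0 R"
    "\<And>u. u \<in> ball 0 \<rho> \<Longrightarrow> (f has_derivative (*v) (B (f u))) (at u)"
    using solution_exists by blast
  have fS: "f u \<in> S" if "u \<in> ball 0 \<rho>" for u using f(2)[OF that] Rad(2) by blast
  \<comment> \<open>Bootstrapping: the derivative of \<open>f\<close> is \<open>B\<close> after
    \<open>f\<close>, so it is as smooth as \<open>f\<close>, and \<open>f\<close> gains one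
    order.\<close>
  have "Ck_on k (ball 0 \<rho>) f" for k
  proof (induction k)
    case 0
    show ?case using f(3) by (auto intro!: continuous_at_imp_continuous_on has_derivative_continuous)
  next
    case (Suc k)
    show ?case
    proof (rule Ck_on_SucI[OF open_ball f(3)])
      show "Ck_on k (ball 0 \<rho>) (\<lambda>u. B (f u) *v v)" for v
        by (intro Ck_on_bilinear[OF bounded_bilinear_matrix_vector_mult] open_ball Ck_on_const
            Ck_on_compose[OF open_ball _ Suc smooth_onD[OF B]]) (use fS in auto)
    qed
  qed
  then show ?thesis using f fS \<rho>(1) by (intro that[of \<rho> f]) (auto simp: smooth_on_def)
qed

section \<open>Charts, and real vectors inside complex ones\<close>

lemma chart_inv_coord:
  assumes "is_chart c" "p \<in> cdom c"
  shows "chart_inv c (coord c p) = p"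
  using assms unfolding is_chart_def homeomorphism_def by blast

lemma coord_chart_inv:
  assumes "is_chart c" "x \<in> coord c ` cdom c"
  shows "coord c (chart_inv c x) = x" "chart_inv c x \<in> cdom c"
  using assms chart_inv_coord[OF assms(1)] by auto

lemma open_coord_image:
  assumes "is_chart c" "open S"
  shows "open (coord c ` (cdom c \<inter> S))"
proof -
  have h: "homeomorphism (cdom c) (coord c ` cdom c) (coord c) (chart_inv c)"
    and o: "open (cdom c)" "open (coord c ` cdom c)"
    using assms by (auto simp: is_chart_def)
  have "openin (top_of_set (coord c ` cdom c)) (coord c ` (cdom c \<inter> S))"
    by (rule homeomorphism_imp_open_map[OF h openin_open_Int[OF assms(2)]])
  then show ?thesis by (rule openin_open_trans[OF _ o(2)])
qed

lemma continuous_on_coord: "is_chart c \<Longrightarrow> continuous_on (cdom c) (coord c)"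
  and continuous_on_chart_inv: "is_chart c \<Longrightarrow> continuous_on (coord c ` cdom c) (chart_inv c)"
  by (auto simp: is_chart_def homeomorphism_def)

lemma frechet_derivative_cong_open:
  assumes "open S" "x \<in> S" "\<And>y. y \<in> S \<Longrightarrow> f y = g y" "(g has_derivative g') (at x)"
  shows "frechet_derivative f (at x) = g'"
proof -
  have "(f has_derivative g') (at x)"
    using assms by (intro has_derivative_transform_within_open[OF assms(4,1,2)]) simp
  then show ?thesis by (rule frechet_derivative_at[symmetric])
qed

lemma matrix_eqI: "(\<And>v. (M::real^'n^'m) *v v = N *v v) \<Longrightarrow> M = N"
  by (simp add: matrix_eq)

lemma linear_cart_expand:
  fixes h :: "real^'n \<Rightarrow> 'b::real_vector"
  assumes "linear h"
  shows "h v = (\<Sum>j\<in>UNIV. v $ j *\<^sub>R h (axis j 1))"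
proof -
  have "h (\<Sum>j\<in>UNIV. v $ j *s axis j 1) = (\<Sum>j\<in>UNIV. v $ j *\<^sub>R h (axis j 1))"
    by (simp only: scalar_mult_eq_scaleR linear_sum[OF assms] linear_scale[OF assms])
  then show ?thesis by (simp only: basis_expansion)
qed

lemma cvec_simps:
  "cvec (x + y) = cvec x + cvec y" "cvec (x - y) = cvec x - cvec y" "cvec (- x) = - cvec x" "cvec 0 = 0"
  by (simp_all add: cvec_def vec_eq_iff)

lemma cvec_eq_iff [simp]: "cvec x = cvec y \<longleftrightarrow> x = y"
  by (simp add: cvec_def vec_eq_iff)

lemma cvec_eq_0_iff [simp]: "cvec x = 0 \<longleftrightarrow> x = 0"
  by (simp add: cvec_def vec_eq_iff)

lemma cvec_matrix_vector: "map_matrix complex_of_real M *v cvec v = cvec (M *v v)"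
  by (simp add: cvec_def vec_eq_iff matrix_vector_mult_def)

section \<open>Lie brackets and Nijenhuis tensors in a chart\<close>

lemma partial_deriv_cvec:
  fixes y :: "real^'n \<Rightarrow> real^'n" and Y :: "'a::topological_space \<Rightarrow> complex^'n"
  assumes c: "is_chart c" "p \<in> cdom c" and Y: "\<And>q. q \<in> cdom c \<Longrightarrow> Y q = cvec (y (coord c q))"
    and y: "(y has_derivative y') (at (coord c p))"
  shows "partial_deriv c j (\<lambda>q. Y q $ i) p = of_real (y' (axis j 1) $ i)"
proof -
  have "((\<lambda>x. complex_of_real (y x $ i)) has_derivative (\<lambda>v. of_real (y' v $ i))) (at (coord c p))"
    by (intro bounded_linear.has_derivative[OF bounded_linear_of_real]
        bounded_linear.has_derivative[OF bounded_linear_vec_nth] y)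
  then have "frechet_derivative ((\<lambda>q. Y q $ i) \<circ> chart_inv c) (at (coord c p)) = (\<lambda>v. of_real (y' v $ i))"
    by (intro frechet_derivative_cong_open[of "coord c ` cdom c"])
      (use c in \<open>auto simp: is_chart_def Y coord_chart_inv[OF c(1)] chart_inv_coord[OF c(1)] cvec_def\<close>)
  then show ?thesis by (simp add: partial_deriv_def)
qed

text \<open>The fields need only be real on the domain of this one chart and differentiable at this
  one point. Hence the lemma also covers products such as \<open>app T X\<close>, which are not
  given as a \<open>vector_field\<close>.\<close>

lemma lie_bracket_cvec:
  fixes x y :: "real^'n \<Rightarrow> real^'n" and X Y :: "('a::topological_space, 'n, complex) vfield"
  assumes c: "is_chart c" "p \<in> cdom c"
    and X: "\<And>q. q \<in> cdom c \<Longrightarrow> X c q = cvec (x (coord c q))"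
    and Y: "\<And>q. q \<in> cdom c \<Longrightarrow> Y c q = cvec (y (coord c q))"
    and x: "(x has_derivative x') (at (coord c p))" and y: "(y has_derivative y') (at (coord c p))"
  shows "lie_bracket X Y c p = cvec (y' (x (coord c p)) - x' (y (coord c p)))"
proof -
  have lin: "linear x'" "linear y'" using x y by (auto intro: has_derivative_linear)
  have pd: "partial_deriv c j (\<lambda>q. X c q $ i) p = of_real (x' (axis j 1) $ i)" for i j
    by (rule partial_deriv_cvec[OF c X x])
  have pd': "partial_deriv c j (\<lambda>q. Y c q $ i) p = of_real (y' (axis j 1) $ i)" for i j
    by (rule partial_deriv_cvec[OF c Y y])
  have "(\<Sum>j\<in>UNIV. X c p $ j * partial_deriv c j (\<lambda>q. Y c q $ i) p
           - Y c p $ j * partial_deriv c j (\<lambda>q. X c q $ i) p)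
      = of_real ((y' (x (coord c p)) - x' (y (coord c p))) $ i)" for i
    by (simp add: pd pd' X[OF c(2)] Y[OF c(2)] cvec_def sum_subtractf linear_cart_expand[OF lin(1), of "y (coord c p)"]
        linear_cart_expand[OF lin(2), of "x (coord c p)"])
  then show ?thesis by (simp add: lie_bracket_def cvec_def vec_eq_iff)
qed

text \<open>What is left of \<open>N\<^sub>T(X,Y)\<close> at a point where \<open>X = a\<close>, \<open>Y = b\<close> and \<open>T\<close> has derivative \<open>D\<close>, after
  the derivatives of \<open>X\<close> and \<open>Y\<close> have cancelled.\<close>

definition nijenhuis_at :: "real^'n^'n \<Rightarrow> (real^'n \<Rightarrow> real^'n^'n) \<Rightarrow> real^'n \<Rightarrow> real^'n \<Rightarrow> real^'n" where
  "nijenhuis_at T D a b = D (T *v a) *v b - D (T *v b) *v a - T *v (D a *v b) + T *v (D b *v a)"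

lemma nijenhuis_cvec:
  fixes x y :: "real^'n \<Rightarrow> real^'n" and t :: "real^'n \<Rightarrow> real^'n^'n"
    and X Y :: "('a::topological_space, 'n, complex) vfield"
  assumes c: "is_chart c" "p \<in> cdom c"
    and X: "\<And>q. q \<in> cdom c \<Longrightarrow> X c q = cvec (x (coord c q))"
    and Y: "\<And>q. q \<in> cdom c \<Longrightarrow> Y c q = cvec (y (coord c q))"
    and T: "\<And>q. q \<in> cdom c \<Longrightarrow> T c q = map_matrix complex_of_real (t (coord c q))"
    and x: "(x has_derivative x') (at (coord c p))" and y: "(y has_derivative y') (at (coord c p))"
    and t: "(t has_derivative t') (at (coord c p))"
  shows "nijenhuis T X Y c p
    = cvec (nijenhuis_at (t (coord c p)) t' (x (coord c p)) (y (coord c p)))"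
proof -
  let ?\<xi> = "coord c p"
  note mv = bounded_bilinear.FDERIV[OF bounded_bilinear_matrix_vector_mult]
  have TX: "app T X c q = cvec (t (coord c q) *v x (coord c q))"
    and TY: "app T Y c q = cvec (t (coord c q) *v y (coord c q))" if "q \<in> cdom c" for q
    using that by (simp_all add: app_def T X Y cvec_matrix_vector)
  have lin: "linear x'" "linear y'" using x y by (auto intro: has_derivative_linear)
  have b1: "lie_bracket (app T X) (app T Y) c p = cvec ((t ?\<xi> *v y' (t ?\<xi> *v x ?\<xi>) + t' (t ?\<xi> *v x ?\<xi>) *v y ?\<xi>)
      - (t ?\<xi> *v x' (t ?\<xi> *v y ?\<xi>) + t' (t ?\<xi> *v y ?\<xi>) *v x ?\<xi>))"
    by (rule lie_bracket_cvec[where x = "\<lambda>z. t z *v x z" and y = "\<lambda>z. t z *v y z" and X = "app T X" and Y = "app T Y", OF c TX TY mv[OF t x] mv[OF t y]])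
  have b2: "lie_bracket (app T X) Y c p = cvec (y' (t ?\<xi> *v x ?\<xi>) - (t ?\<xi> *v x' (y ?\<xi>) + t' (y ?\<xi>) *v x ?\<xi>))"
    by (rule lie_bracket_cvec[where x = "\<lambda>z. t z *v x z" and y = "y" and X = "app T X" and Y = "Y", OF c TX Y mv[OF t x] y])
  have b3: "lie_bracket X (app T Y) c p = cvec ((t ?\<xi> *v y' (x ?\<xi>) + t' (x ?\<xi>) *v y ?\<xi>) - x' (t ?\<xi> *v y ?\<xi>))"
    by (rule lie_bracket_cvec[where x = "x" and y = "\<lambda>z. t z *v y z" and X = "X" and Y = "app T Y", OF c X TY x mv[OF t y]])
  have b4: "lie_bracket X Y c p = cvec (y' (x ?\<xi>) - x' (y ?\<xi>))"
    by (rule lie_bracket_cvec[where x = "x" and y = "y" and X = "X" and Y = "Y", OF c X Y x y])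
  show ?thesis
    unfolding nijenhuis_def app_def[of T "lie_bracket _ _"] app_def[of T "app _ _"] b1 b2 b3 b4 T[OF c(2)]
      cvec_matrix_vector nijenhuis_at_def
    by (simp add: cvec_simps matrix_vector_right_distrib matrix_vector_mult_diff_distrib)
qed

section \<open>Transition maps and vector fields\<close>

locale manifold_atlas =
  fixes A :: "('a::{t2_space, second_countable_topology}, 'n::finite) chart set"
  assumes manifold: "smooth_manifold A"
begin

lemmas manifold_props = manifold[unfolded smooth_manifold_def]

lemma chart: "c \<in> A \<Longrightarrow> is_chart c"
  using manifold_props[THEN conjunct1] by blast

lemma compatible_charts: "c \<in> A \<Longrightarrow> d \<in> A \<Longrightarrow> compatible c d"
  using manifold_props[THEN conjunct2, THEN conjunct2, THEN conjunct1] by blast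

lemma maximal: "is_chart c \<Longrightarrow> (\<And>d. d \<in> A \<Longrightarrow> compatible c d) \<Longrightarrow> c \<in> A"
  using manifold_props[THEN conjunct2, THEN conjunct2, THEN conjunct2, rule_format, of c] by blast

lemma chart_at: obtains c where "c \<in> A" "p \<in> cdom c"
  using manifold_props[THEN conjunct2, THEN conjunct1] by blast

lemma open_cdom: "c \<in> A \<Longrightarrow> open (cdom c)"
  using chart by (simp add: is_chart_def)

lemma open_overlap: "c \<in> A \<Longrightarrow> d \<in> A \<Longrightarrow> open (coord c ` (cdom c \<inter> cdom d))"
  by (rule open_coord_image[OF chart open_cdom])

lemma smooth_transition:
  "c \<in> A \<Longrightarrow> d \<in> A \<Longrightarrow> smooth_on (coord c ` (cdom c \<inter> cdom d)) (coord d \<circ> chart_inv c)"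
  using compatible_charts[of c d] by (simp add: compatible_def)

lemma transition_has_derivative:
  assumes "c \<in> A" "d \<in> A" "p \<in> cdom c" "p \<in> cdom d"
  shows "(coord d \<circ> chart_inv c has_derivative (*v) (chart_jac c d p)) (at (coord c p))"
proof -
  have "(coord d \<circ> chart_inv c) differentiable at (coord c p)"
    using smooth_on_has_derivative[OF smooth_transition[OF assms(1,2)]] assms(3,4)
    unfolding differentiable_def by blast
  then show ?thesis unfolding chart_jac_def by (simp add: jacobian_works)
qed

lemma chart_jac_cocycle:
  assumes "c \<in> A" "d \<in> A" "e \<in> A" "p \<in> cdom c" "p \<in> cdom d" "p \<in> cdom e"
  shows "chart_jac d e p ** chart_jac c d p = chart_jac c e p"
proof -
  have p: "(coord d \<circ> chart_inv c) (coord c p) = coord d p"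
    using assms by (simp add: chart_inv_coord chart)
  have 1: "(coord d \<circ> chart_inv c has_derivative (*v) (chart_jac c d p)) (at (coord c p))"
    by (rule transition_has_derivative[OF assms(1,2,4,5)])
  have 2: "(coord e \<circ> chart_inv d has_derivative (*v) (chart_jac d e p)) (at ((coord d \<circ> chart_inv c) (coord c p)))"
    unfolding p by (rule transition_has_derivative[OF assms(2,3,5,6)])
  note diff_chain_at[OF 1 2]
  moreover have "((coord e \<circ> chart_inv d) \<circ> (coord d \<circ> chart_inv c) has_derivative
      (*v) (chart_jac c e p)) (at (coord c p))"
    by (rule has_derivative_transform_within_open[OF transition_has_derivative[OF assms(1,3,4,6)]
          open_overlap[OF assms(1,2)]])
      (use assms in \<open>auto simp: chart_inv_coord chart\<close>)
  ultimately have "(*v) (chart_jac d e p) \<circ> (*v) (chart_jac c d p) = (*v) (chart_jac c e p)"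
    by (rule has_derivative_unique)
  then have "chart_jac d e p *v (chart_jac c d p *v v) = chart_jac c e p *v v" for v
    by (simp add: fun_eq_iff)
  then show ?thesis by (intro matrix_eqI) (simp add: matrix_vector_mul_assoc)
qed

lemma chart_jac_self:
  assumes "c \<in> A" "p \<in> cdom c"
  shows "chart_jac c c p = mat 1"
proof -
  have "(coord c \<circ> chart_inv c has_derivative (\<lambda>v. v)) (at (coord c p))"
    by (rule has_derivative_transform_within_open[OF has_derivative_ident, of "coord c ` cdom c"])
      (use assms chart in \<open>auto simp: coord_chart_inv is_chart_def\<close>)
  then have "(*v) (chart_jac c c p) = (\<lambda>v. v)"
    using transition_has_derivative[OF assms(1,1,2,2)] has_derivative_unique by blast
  then show ?thesis by (intro matrix_eqI) simp
qed

lemma chart_jac_inverse: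
  assumes "c \<in> A" "d \<in> A" "p \<in> cdom c" "p \<in> cdom d"
  shows "chart_jac d c p ** chart_jac c d p = mat 1"
  using chart_jac_cocycle[of c d c p] chart_jac_self assms by simp

lemma smooth_chart_jac:
  assumes "c \<in> A" "d \<in> A"
  shows "smooth_on (coord c ` (cdom c \<inter> cdom d)) (\<lambda>x. chart_jac c d (chart_inv c x))"
proof -
  let ?S = "coord c ` (cdom c \<inter> cdom d)"
  have "smooth_on ?S (\<lambda>x. frechet_derivative (coord d \<circ> chart_inv c) (at x) (axis j 1) $ i)" for i j
    by (intro smooth_on_vec_nth smooth_on_frechet_derivative smooth_transition open_overlap assms)
  then have "smooth_on ?S (\<lambda>x. chart_jac c d (chart_inv c x) $ i $ j)" for i j
    by (rule smooth_on_cong)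
      (use assms in \<open>auto simp: open_overlap chart_jac_def jacobian_def matrix_def coord_chart_inv chart chart_inv_coord\<close>)
  then show ?thesis by (intro smooth_on_vecI open_overlap assms)
qed

text \<open>Identities required for all global vector fields become identities for all vectors at a
  point through this extension: the field constant in the chart \<open>c\<close>, cut off by a bump
  function and continued by zero.\<close>

lemma vector_field_through:
  assumes c: "c \<in> A" "p \<in> cdom c"
  obtains X where "vector_field A X" "X c p = a"
proof -
  have ch: "is_chart c" using chart c by blast
  obtain e where e: "e > 0" "cball (coord c p) e \<subseteq> coord c ` cdom c"
    using ch c by (metis image_eqI is_chart_def open_contains_cball)
  obtain \<phi> :: "real^'n \<Rightarrow> real" where \<phi>: "smooth_on UNIV \<phi>" "\<phi> (coord c p) = 1"
    "\<And>x. x \<notin> cball (coord c p) e \<Longrightarrow> \<phi> x = 0"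
    using smooth_bump_exists[OF e(1)] by blast
  define X where "X d q = (if q \<in> cdom c then \<phi> (coord c q) *\<^sub>R (chart_jac c d q *v a) else 0)"
    for d :: "('a, 'n) chart" and q
  define K where "K = chart_inv c ` cball (coord c p) e"
  \<comment> \<open>\<open>K\<close> contains the support. Being compact in a Hausdorff space, it is
    closed in the manifold and not only in \<open>cdom c\<close>; this makes the continuation by
    zero smooth at boundary points of \<open>cdom c\<close>.\<close>
  have "compact K"
    unfolding K_def by (intro compact_continuous_image continuous_on_subset[OF continuous_on_chart_inv[OF ch] e(2)] compact_cball)
  then have K: "closed K" by (rule compact_imp_closed)
  have Kc: "K \<subseteq> cdom c" unfolding K_def using e coord_chart_inv[OF ch] by blast
  have "vector_field A X"
    unfolding vector_field_def
  proof (intro conjI ballI)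
    fix d1 d2 q assume d: "d1 \<in> A" "d2 \<in> A" and q: "q \<in> cdom d1 \<inter> cdom d2"
    show "X d2 q = chart_jac d1 d2 q *v X d1 q"
      using q by (simp add: X_def matrix_vector_mult_scaleR matrix_vector_mul_assoc chart_jac_cocycle[OF c(1) d])
  next
    fix d assume d: "d \<in> A"
    have chd: "is_chart d" using chart d by blast
    show "smooth_on (coord d ` cdom d) (\<lambda>x. X d (chart_inv d x))"
    proof (rule smooth_on_local)
      fix x assume x: "x \<in> coord d ` cdom d"
      then obtain q where q: "q \<in> cdom d" "x = coord d q" by auto
      show "\<exists>T. open T \<and> x \<in> T \<and> smooth_on T (\<lambda>x. X d (chart_inv d x))"
      proof (cases "q \<in> cdom c")
        case True
        let ?T = "coord d ` (cdom d \<inter> cdom c)"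
        have T: "open ?T" by (rule open_overlap[OF d c(1)])
        have tr: "smooth_on ?T (coord c \<circ> chart_inv d)" by (rule smooth_transition[OF d c(1)])
        have im: "(coord c \<circ> chart_inv d) ` ?T \<subseteq> coord c ` (cdom c \<inter> cdom d)"
          by (auto simp: chart_inv_coord[OF chd])
        have "smooth_on ?T (\<lambda>x. \<phi> ((coord c \<circ> chart_inv d) x) *\<^sub>R
            (chart_jac c d (chart_inv c ((coord c \<circ> chart_inv d) x)) *v a))"
          by (intro smooth_on_scaleR smooth_on_matrix_vector_mult smooth_on_const T
              smooth_on_compose[OF \<phi>(1) tr T] smooth_on_compose[OF smooth_chart_jac[OF c(1) d] tr T im]) auto
        then have "smooth_on ?T (\<lambda>x. X d (chart_inv d x))"
          by (rule smooth_on_cong[OF _ T]) (auto simp: X_def chart_inv_coord[OF chd] chart_inv_coord[OF ch])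
        then show ?thesis using T True q by (intro exI[of _ ?T]) auto
      next
        case False
        let ?T = "coord d ` (cdom d \<inter> - K)"
        have T: "open ?T" using K by (intro open_coord_image[OF chd]) auto
        have "smooth_on ?T (\<lambda>x. X d (chart_inv d x))"
        proof (rule smooth_on_cong[OF smooth_on_const T])
          fix y assume "y \<in> ?T"
          then obtain q where q: "q \<in> cdom d" "q \<notin> K" "y = coord d q" by auto
          have "q \<in> K" if "q \<in> cdom c" "coord c q \<in> cball (coord c p) e"
            unfolding K_def using that chart_inv_coord[OF ch] by (metis image_eqI)
          then show "0 = X d (chart_inv d y)"
            using q \<phi>(3) by (auto simp: X_def chart_inv_coord[OF chd])
        qed
        then show ?thesis using T False Kc q by (intro exI[of _ ?T]) auto
      qed
    qed
  qed
  moreover have "X c p = a" using c \<phi> by (simp add: X_def chart_jac_self)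
  ultimately show ?thesis by (rule that)
qed

lemma vector_field_coord:
  assumes "vector_field A X" "c \<in> A" "p \<in> cdom c"
  obtains x x' where "(x has_derivative x') (at (coord c p))" "x (coord c p) = X c p"
    "\<And>q. q \<in> cdom c \<Longrightarrow> cfield X c q = cvec (x (coord c q))"
proof
  have "smooth_on (coord c ` cdom c) (\<lambda>x. X c (chart_inv c x))"
    using assms by (simp add: vector_field_def)
  then show "((\<lambda>x. X c (chart_inv c x)) has_derivative frechet_derivative (\<lambda>x. X c (chart_inv c x)) (at (coord c p))) (at (coord c p))"
    by (rule smooth_on_has_derivative) (use assms in auto)
qed (use assms in \<open>auto simp: cfield_def chart_inv_coord chart\<close>)

end

section \<open>The projection \<open>l\<close> is real\<close>

lemma map_matrix_of_real_mult:
  "map_matrix complex_of_real (M ** N) = map_matrix complex_of_real M ** map_matrix complex_of_real N"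
  by (simp add: vec_eq_iff matrix_matrix_mult_def)

lemma map_matrix_of_real_mat: "map_matrix complex_of_real (mat a) = mat (complex_of_real a)"
  by (simp add: vec_eq_iff mat_def)

lemma matrix_power_map_of_real:
  "matrix_power (map_matrix complex_of_real M) k = map_matrix complex_of_real (matrix_power M k)"
  by (induction k) (simp_all add: map_matrix_of_real_mult map_matrix_of_real_mat)

lemma mat_mult_nth: "(mat a ** M) $ i $ j = a * M $ i $ j" for M :: "'k::comm_semiring_1^'n^'m"
proof -
  have "(\<Sum>k\<in>UNIV. (if i = k then a else 0) * M $ k $ j) = (\<Sum>k\<in>UNIV. if i = k then a * M $ k $ j else 0)"
    by (rule sum.cong) auto
  then show ?thesis by (simp add: matrix_matrix_mult_def mat_def)
qed

lemma matrix_power_commute: "matrix_power M k ** M = M ** matrix_power M k"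
  by (induction k) (simp_all add: matrix_mul_assoc[symmetric])

lemma matrix_mult_scaleR:
  "(M::real^'n^'m) ** (a *\<^sub>R N) = a *\<^sub>R (M ** N)" "(a *\<^sub>R (M::real^'n^'m)) ** N = a *\<^sub>R (M ** N)"
  by (rule bounded_bilinear.scaleR_right[OF bounded_bilinear_matrix_mult]
      bounded_bilinear.scaleR_left[OF bounded_bilinear_matrix_mult])+

lemma matrix_mult_minus:
  "(M::real^'n^'m) ** (- N) = - (M ** N)" "(- (M::real^'n^'m)) ** N = - (M ** N)"
  by (rule bounded_bilinear.minus_right[OF bounded_bilinear_matrix_mult]
      bounded_bilinear.minus_left[OF bounded_bilinear_matrix_mult])+

definition real_l :: "complex \<Rightarrow> complex \<Rightarrow> nat \<Rightarrow> real^'n^'n \<Rightarrow> real^'n^'n" where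
  "real_l \<alpha> \<beta> K M = - (Re \<alpha> *\<^sub>R matrix_power M K + Re \<beta> *\<^sub>R matrix_power M (K - 1))"

text \<open>The real part of the structure equation is \<open>M ** L = M\<close>. Together with the
  factorisation of \<open>L\<close> through \<open>M\<close> on either side it gives that
  \<open>L\<close> is idempotent. The imaginary part gives that the imaginary part of the complex
  \<open>l\<close> vanishes.\<close>

lemma F_structure_matrix:
  fixes M :: "real^'n^'n"
  assumes K: "K \<ge> 3"
    and eq: "mat \<alpha> ** matrix_power (map_matrix complex_of_real M) (K + 1)
      + mat \<beta> ** matrix_power (map_matrix complex_of_real M) K + map_matrix complex_of_real M = 0"
  defines "L \<equiv> real_l \<alpha> \<beta> K M"
  shows "M ** L = M" "L ** M = M" "L ** L = L"
    "\<exists>G. M ** G = L \<and> G ** M = L"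
    "- (mat \<alpha> ** matrix_power (map_matrix complex_of_real M) K
      + mat \<beta> ** matrix_power (map_matrix complex_of_real M) (K - 1)) = map_matrix complex_of_real L"
proof -
  \<comment> \<open>With \<open>K = k + 2\<close> one factor \<open>M\<close> can be split off every
    power in \<open>L\<close>; the cofactor \<open>?G\<close> inverts \<open>M\<close> on the image
    of \<open>L\<close>.\<close>
  obtain k where k: "K = Suc (Suc k)" using K by (metis add_2_eq_Suc le_Suc_ex numeral_3_eq_3 Suc_eq_plus1 add_Suc)
  let ?P = "matrix_power M"
  let ?G = "- (Re \<alpha> *\<^sub>R ?P (Suc k) + Re \<beta> *\<^sub>R ?P k)"
  let ?H = "Im \<alpha> *\<^sub>R ?P (Suc k) + Im \<beta> *\<^sub>R ?P k"
  let ?Z = "Im \<alpha> *\<^sub>R ?P K + Im \<beta> *\<^sub>R ?P (K - 1)"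
  have ent: "\<alpha> * of_real (?P (K + 1) $ i $ j) + \<beta> * of_real (?P K $ i $ j) + of_real (M $ i $ j) = 0" for i j
    using arg_cong[OF eq, of "\<lambda>N. N $ i $ j"] by (simp add: matrix_power_map_of_real mat_mult_nth del: matrix_power.simps)
  have "Re \<alpha> * ?P (K + 1) $ i $ j + Re \<beta> * ?P K $ i $ j + M $ i $ j = 0" for i j
    using arg_cong[OF ent[of i j], of Re] by simp
  then have re: "Re \<alpha> *\<^sub>R ?P (K + 1) + Re \<beta> *\<^sub>R ?P K + M = 0"
    by (simp add: vec_eq_iff)
  have "Im \<alpha> * ?P (K + 1) $ i $ j + Im \<beta> * ?P K $ i $ j = 0" for i j
    using arg_cong[OF ent[of i j], of Im] by simp
  then have im: "Im \<alpha> *\<^sub>R ?P (K + 1) + Im \<beta> *\<^sub>R ?P K = 0"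
    by (simp add: vec_eq_iff)
  note ms = bounded_bilinear.diff_left[OF bounded_bilinear_matrix_mult]
    bounded_bilinear.diff_right[OF bounded_bilinear_matrix_mult] matrix_mult_scaleR matrix_mult_minus bounded_bilinear.add_left[OF bounded_bilinear_matrix_mult]
    bounded_bilinear.add_right[OF bounded_bilinear_matrix_mult] matrix_power_commute
    matrix_mul_assoc[symmetric]
  have "M ** L = - (Re \<alpha> *\<^sub>R ?P (K + 1) + Re \<beta> *\<^sub>R ?P K)"
    by (simp add: L_def real_l_def ms k)
  then show FL: "M ** L = M" using re by (metis add.commute add_eq_0_iff)
  have FG: "M ** ?G = L" and GF: "?G ** M = L"
    by (simp_all add: L_def real_l_def ms k)
  show LF: "L ** M = M" using FG GF FL by (metis matrix_mul_assoc)
  show "L ** L = L" using FG GF FL by (metis matrix_mul_assoc)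
  show "\<exists>G. M ** G = L \<and> G ** M = L" using FG GF by blast
  \<comment> \<open>As \<open>M\<close> may be singular, \<open>?Z ** M = 0\<close> does not suffice
    by itself. But \<open>?Z = ?H ** M\<close>, and \<open>M = M ** L = M ** M ** ?G\<close>; so
    \<open>?Z\<close> equals \<open>?Z ** M ** ?G\<close>.\<close>
  have ZM: "?Z ** M = 0" using im by (simp add: ms k)
  have "?Z = ?H ** M" by (simp add: ms k)
  also have "\<dots> = ?H ** (M ** L)" by (simp only: FL)
  also have "\<dots> = (?H ** M) ** (M ** ?G)" by (simp only: FG matrix_mul_assoc)
  also have "\<dots> = ((?H ** M) ** M) ** ?G" by (simp only: matrix_mul_assoc)
  also have "?H ** M = ?Z" by (simp add: ms k)
  finally have Z: "?Z = 0" unfolding ZM by (simp add: matrix_matrix_mult_def vec_eq_iff)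
  show "- (mat \<alpha> ** matrix_power (map_matrix complex_of_real M) K
      + mat \<beta> ** matrix_power (map_matrix complex_of_real M) (K - 1)) = map_matrix complex_of_real L"
  proof -
    have "Im \<alpha> * ?P K $ i $ j + Im \<beta> * ?P (K - 1) $ i $ j = 0" for i j
      using arg_cong[OF Z, of "\<lambda>N. N $ i $ j"] by simp
    then have "- (Im \<alpha> * ?P K $ i $ j) = Im \<beta> * ?P (K - Suc 0) $ i $ j" for i j
      by (metis One_nat_def add_eq_0_iff minus_minus)
    then show ?thesis
      by (simp add: vec_eq_iff matrix_power_map_of_real mat_mult_nth L_def real_l_def complex_eq_iff)
  qed
qed

section \<open>Algebra of the Nijenhuis tensors at a point\<close>

text \<open>Frobenius' condition for the image of a projection field \<open>T\<close> with
  derivative \<open>D\<close>: for constant \<open>a\<close>, \<open>b\<close> the bracket of the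
  fields \<open>T a\<close> and \<open>T b\<close> is
  \<open>D (T *v a) *v b - D (T *v b) *v a\<close>, and it has to be fixed by
  \<open>T\<close>.\<close>

definition involutive_at :: "real^'n^'n \<Rightarrow> (real^'n \<Rightarrow> real^'n^'n) \<Rightarrow> bool" where
  "involutive_at T D \<longleftrightarrow>
     (\<forall>a b. T *v (D (T *v a) *v b - D (T *v b) *v a) = D (T *v a) *v b - D (T *v b) *v a)"

lemmas mv_simps = matrix_vector_right_distrib matrix_vector_mult_diff_distrib
  matrix_vector_mult_add_rdistrib matrix_vector_mult_diff_rdistrib

lemma matrix_vector_minus:
  "(- (M::real^'n^'m)) *v x = - (M *v x)" "(M::real^'n^'m) *v (- x) = - (M *v x)"
  by (rule bounded_bilinear.minus_left[OF bounded_bilinear_matrix_vector_mult]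
      bounded_bilinear.minus_right[OF bounded_bilinear_matrix_vector_mult])+

text \<open>\<open>\<kappa>\<close> is the bracket of \<open>L a\<close> and \<open>L b\<close>, and
  \<open>- \<mu>\<close> that of the complementary parts. The Nijenhuis tensor equals
  \<open>(1 - L) \<kappa> - L \<mu>\<close>; its summands lie in the kernel and the image of
  \<open>L\<close>, so it vanishes only if both do.\<close>

lemma nijenhuis_at_projection:
  assumes L: "L ** L = L" and D: "linear D"
  shows "(\<forall>a b. nijenhuis_at L D a b = 0)
    \<longleftrightarrow> involutive_at L D \<and> involutive_at (mat 1 - L) (\<lambda>v. - D v)"
proof -
  define \<kappa> where "\<kappa> a b = D (L *v a) *v b - D (L *v b) *v a" for a b
  define \<mu> where "\<mu> a b = D (a - L *v a) *v b - D (b - L *v b) *v a" for a b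
  have LL: "L *v (L *v x) = L *v x" for x by (simp add: matrix_vector_mul_assoc L)
  have eq: "nijenhuis_at L D a b = (\<kappa> a b - L *v \<kappa> a b) - L *v \<mu> a b" for a b
    by (simp add: nijenhuis_at_def \<kappa>_def \<mu>_def linear_diff[OF D] mv_simps)
  have "nijenhuis_at L D a b = 0 \<longleftrightarrow> \<kappa> a b = L *v \<kappa> a b \<and> L *v \<mu> a b = 0" for a b
  proof
    assume 0: "nijenhuis_at L D a b = 0"
    then have "L *v ((\<kappa> a b - L *v \<kappa> a b) - L *v \<mu> a b) = 0" by (simp add: eq)
    then have "L *v \<mu> a b = 0" by (simp add: mv_simps LL)
    then show "\<kappa> a b = L *v \<kappa> a b \<and> L *v \<mu> a b = 0" using 0 by (simp add: eq)
  qed (simp add: eq)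
  moreover have "involutive_at L D \<longleftrightarrow> (\<forall>a b. \<kappa> a b = L *v \<kappa> a b)"
    by (auto simp: involutive_at_def \<kappa>_def)
  moreover have "involutive_at (mat 1 - L) (\<lambda>v. - D v) \<longleftrightarrow> (\<forall>a b. L *v \<mu> a b = 0)"
  proof -
    have "(mat 1 - L) *v (- D ((mat 1 - L) *v a) *v b - - D ((mat 1 - L) *v b) *v a)
        = - \<mu> a b + L *v \<mu> a b" for a b
      by (simp add: \<mu>_def mv_simps matrix_vector_minus)
    moreover have "- D ((mat 1 - L) *v a) *v b - - D ((mat 1 - L) *v b) *v a = - \<mu> a b" for a b
      by (simp add: \<mu>_def mv_simps matrix_vector_minus)
    ultimately show ?thesis unfolding involutive_at_def by simp
  qed
  ultimately show ?thesis by auto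
qed

lemma nijenhuis_at_complement:
  assumes "linear D"
  shows "nijenhuis_at (mat 1 - L) (\<lambda>v. - D v) a b = nijenhuis_at L D a b"
  by (simp add: nijenhuis_at_def linear_diff[OF assms] mv_simps matrix_vector_minus)

text \<open>Here \<open>M\<close> is the matrix of \<open>F\<close>, and \<open>d1\<close>,
  \<open>d2\<close>, \<open>d3\<close> are the derivatives of \<open>F = LF\<close>,
  \<open>F = FL\<close> and \<open>L = LL\<close>. Splitting both arguments by \<open>L\<close> and
  \<open>1 - L\<close> cancels the mixed blocks in the identity. What remains is a sum of a vector
  killed by \<open>L\<close> (see \<open>A\<close>) and one in the image of \<open>M\<close> (see
  \<open>B\<close>), so each of the two vanishes.\<close>

lemma nijenhuis_at_F_iff:
  fixes M L G :: "real^'n^'n"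
  assumes FL: "M ** L = M" and LF: "L ** M = M" and LL: "L ** L = L" and FG: "M ** G = L" and GF: "G ** M = L"
    and dM: "linear dM" and dL: "linear dL"
    and d1: "\<And>v. dM v = dL v ** M + L ** dM v"
    and d2: "\<And>v. dM v = dM v ** L + M ** dL v"
    and d3: "\<And>v. dL v = dL v ** L + L ** dL v"
  shows "(\<forall>a b. nijenhuis_at M dM a b = L *v nijenhuis_at M dM (L *v a) (L *v b)
      + nijenhuis_at M dM (L *v a) (b - L *v b) + nijenhuis_at M dM (a - L *v a) (L *v b))
    \<longleftrightarrow> (\<forall>a b. nijenhuis_at L dL a b = 0)" (is "?iv \<longleftrightarrow> _")
proof -
  define \<kappa> where "\<kappa> a b = dL (L *v a) *v b - dL (L *v b) *v a" for a b
  define \<mu> where "\<mu> a b = dL (a - L *v a) *v b - dL (b - L *v b) *v a" for a b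
  have v: "M *v (L *v x) = M *v x" "L *v (M *v x) = M *v x" "L *v (L *v x) = L *v x"
    "M *v (G *v x) = L *v x" "G *v (M *v x) = L *v x" for x
    by (simp_all add: matrix_vector_mul_assoc assms)
  \<comment> \<open>Outside the projections the derivative of \<open>M\<close> is expressible by
    that of \<open>L\<close>: this is how obstructions for \<open>F\<close> turn into obstructions
    for \<open>L\<close>.\<close>
  have e1: "dM v *v x - L *v (dM v *v x) = dL v *v (M *v x)" for v x
    unfolding diff_eq_eq by (subst d1) (simp add: mv_simps matrix_vector_mul_assoc add.commute)
  have e2: "dM v *v x - dM v *v (L *v x) = M *v (dL v *v x)" for v x
    unfolding diff_eq_eq by (subst d2) (simp add: mv_simps matrix_vector_mul_assoc add.commute)
  have e3: "dL v *v x - L *v (dL v *v x) = dL v *v (L *v x)" for v x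
    unfolding diff_eq_eq by (subst d3) (simp add: mv_simps matrix_vector_mul_assoc add.commute)
  have split: "nijenhuis_at M dM a b = nijenhuis_at M dM (L *v a) (L *v b)
      + nijenhuis_at M dM (L *v a) (b - L *v b) + nijenhuis_at M dM (a - L *v a) (L *v b)
      + nijenhuis_at M dM (a - L *v a) (b - L *v b)" for a b
    by (simp add: nijenhuis_at_def linear_diff[OF dM] linear_0[OF dM] mv_simps v)
  have A: "nijenhuis_at M dM (L *v a) (L *v b) - L *v nijenhuis_at M dM (L *v a) (L *v b)
      = \<kappa> (M *v a) (M *v b) - L *v \<kappa> (M *v a) (M *v b)" for a b
  proof -
    have "nijenhuis_at M dM (L *v a) (L *v b) - L *v nijenhuis_at M dM (L *v a) (L *v b)
      = (dM (M *v a) *v (L *v b) - L *v (dM (M *v a) *v (L *v b)))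
        - (dM (M *v b) *v (L *v a) - L *v (dM (M *v b) *v (L *v a)))"
      by (simp add: nijenhuis_at_def mv_simps v)
    also have "\<dots> = dL (M *v a) *v (M *v b) - dL (M *v b) *v (M *v a)" by (simp add: e1 v)
    also have "\<dots> = \<kappa> (M *v a) (M *v b) - L *v \<kappa> (M *v a) (M *v b)"
      using e3[of "M *v a" "M *v b"] e3[of "M *v b" "M *v a"]
      by (simp add: \<kappa>_def mv_simps v)
    finally show ?thesis .
  qed
  have B: "nijenhuis_at M dM (a - L *v a) (b - L *v b) = - (M *v (M *v \<mu> a b))" for a b
  proof -
    have dM0: "dM 0 = 0" by (rule linear_0[OF dM])
    have z: "M *v (a - L *v a) = 0" for a by (simp add: mv_simps v)
    have "nijenhuis_at M dM (a - L *v a) (b - L *v b)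
      = - (M *v (dM (a - L *v a) *v b - dM (a - L *v a) *v (L *v b)))
        + M *v (dM (b - L *v b) *v a - dM (b - L *v b) *v (L *v a))"
      by (simp only: nijenhuis_at_def z) (simp add: mv_simps dM0)
    also have "\<dots> = - (M *v (M *v \<mu> a b))" by (simp only: e2) (simp add: \<mu>_def mv_simps)
    finally show ?thesis .
  qed
  have eqv: "nijenhuis_at L dL a b = (\<kappa> a b - L *v \<kappa> a b) - L *v \<mu> a b" for a b
    by (simp add: nijenhuis_at_def \<kappa>_def \<mu>_def linear_diff[OF dL] mv_simps)
  have iii: "nijenhuis_at L dL a b = 0 \<longleftrightarrow> \<kappa> a b - L *v \<kappa> a b = 0 \<and> L *v \<mu> a b = 0" for a b
  proof
    assume 0: "nijenhuis_at L dL a b = 0"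
    then have "L *v ((\<kappa> a b - L *v \<kappa> a b) - L *v \<mu> a b) = 0" by (simp add: eqv)
    then have "L *v \<mu> a b = 0" by (simp add: mv_simps v)
    then show "\<kappa> a b - L *v \<kappa> a b = 0 \<and> L *v \<mu> a b = 0" using 0 by (simp add: eqv)
  qed (simp add: eqv)
  \<comment> \<open>\<open>M\<close> is invertible on the image of \<open>L\<close>, with inverse
    \<open>G\<close>, so applying it twice loses only the kernel of \<open>L\<close>.\<close>
  have L0: "M *v (M *v x) = 0 \<longleftrightarrow> L *v x = 0" for x
  proof
    assume "M *v (M *v x) = 0"
    then have "G *v (G *v (M *v (M *v x))) = 0" by simp
    then show "L *v x = 0" by (simp add: v)
  next
    assume "L *v x = 0"
    then have "M *v (M *v (L *v x)) = 0" by simp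
    then show "M *v (M *v x) = 0" by (simp add: v)
  qed
  have iv: "nijenhuis_at M dM a b = L *v nijenhuis_at M dM (L *v a) (L *v b)
      + nijenhuis_at M dM (L *v a) (b - L *v b) + nijenhuis_at M dM (a - L *v a) (L *v b)
    \<longleftrightarrow> \<kappa> (M *v a) (M *v b) - L *v \<kappa> (M *v a) (M *v b) = 0 \<and> L *v \<mu> a b = 0" (is "?l \<longleftrightarrow> ?r") for a b
  proof -
    let ?k = "\<kappa> (M *v a) (M *v b)"
    have "?l \<longleftrightarrow> (?k - L *v ?k) - M *v (M *v \<mu> a b) = 0"
      unfolding eq_iff_diff_eq_0[of "nijenhuis_at M dM a b"] A[symmetric] split[of a b] B
      by (simp add: algebra_simps)
    also have "\<dots> \<longleftrightarrow> ?k - L *v ?k = 0 \<and> M *v (M *v \<mu> a b) = 0"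
    proof
      assume 0: "(?k - L *v ?k) - M *v (M *v \<mu> a b) = 0"
      then have "L *v ((?k - L *v ?k) - M *v (M *v \<mu> a b)) = 0" by simp
      then have "M *v (M *v \<mu> a b) = 0" by (simp add: mv_simps v)
      then show "?k - L *v ?k = 0 \<and> M *v (M *v \<mu> a b) = 0" using 0 by simp
    qed simp
    finally show ?thesis by (simp add: L0)
  qed
  \<comment> \<open>By \<open>e3\<close>, \<open>\<kappa>\<close> modulo the image of
    \<open>L\<close> depends only on the components \<open>L a\<close> and \<open>L b\<close>, and
    these are \<open>M (G a)\<close> and \<open>M (G b)\<close>. So testing on the image of
    \<open>M\<close> tests everything.\<close>
  have kL: "\<kappa> a b - L *v \<kappa> a b = \<kappa> (M *v (G *v a)) (M *v (G *v b)) - L *v \<kappa> (M *v (G *v a)) (M *v (G *v b))" for a b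
    using e3[of "L *v a" b, symmetric] e3[of "L *v b" a, symmetric] e3[of "L *v a" "L *v b"] e3[of "L *v b" "L *v a"]
    by (simp add: \<kappa>_def mv_simps v algebra_simps)
  show ?thesis unfolding iii iv using kL by metis
qed

section \<open>Nijenhuis tensors of endomorphism fields\<close>

definition endo_deriv :: "('a, 'n::finite, real) endo_field \<Rightarrow> ('a, 'n) chart \<Rightarrow> 'a \<Rightarrow> real^'n \<Rightarrow> real^'n^'n" where
  "endo_deriv T c p = frechet_derivative (\<lambda>x. T c (chart_inv c x)) (at (coord c p))"

context manifold_atlas
begin

lemma tensor_field_transform:
  "tensor_field_1_1 A T \<Longrightarrow> c \<in> A \<Longrightarrow> d \<in> A \<Longrightarrow> p \<in> cdom c \<Longrightarrow> p \<in> cdom d \<Longrightarrow>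
    T d p = chart_jac c d p ** T c p ** chart_jac d c p"
  unfolding tensor_field_1_1_def by blast

lemma tensor_field_smooth:
  "tensor_field_1_1 A T \<Longrightarrow> c \<in> A \<Longrightarrow> smooth_on (coord c ` cdom c) (\<lambda>x. T c (chart_inv c x))"
  unfolding tensor_field_1_1_def by blast

lemma endo_has_derivative:
  assumes "tensor_field_1_1 A T" "c \<in> A" "p \<in> cdom c"
  shows "((\<lambda>x. T c (chart_inv c x)) has_derivative endo_deriv T c p) (at (coord c p))"
  unfolding endo_deriv_def
  by (rule smooth_on_has_derivative[of "coord c ` cdom c"])
    (use assms tensor_field_smooth in auto)

lemma linear_endo_deriv:
  "tensor_field_1_1 A T \<Longrightarrow> c \<in> A \<Longrightarrow> p \<in> cdom c \<Longrightarrow> linear (endo_deriv T c p)"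
  by (rule has_derivative_linear[OF endo_has_derivative])

lemma endo_deriv_mult:
  assumes T: "tensor_field_1_1 A T" and U: "tensor_field_1_1 A U" and V: "tensor_field_1_1 A V"
    and c: "c \<in> A" "p \<in> cdom c" and eq: "\<And>q. q \<in> cdom c \<Longrightarrow> V c q = T c q ** U c q"
  shows "endo_deriv V c p v = endo_deriv T c p v ** U c p + T c p ** endo_deriv U c p v"
proof -
  have D: "((\<lambda>x. T c (chart_inv c x) ** U c (chart_inv c x)) has_derivative
      (\<lambda>v. T c p ** endo_deriv U c p v + endo_deriv T c p v ** U c p)) (at (coord c p))"
    using bounded_bilinear.FDERIV[OF bounded_bilinear_matrix_mult endo_has_derivative[OF T c] endo_has_derivative[OF U c]]
    by (simp add: chart_inv_coord[OF chart[OF c(1)] c(2)])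
  have "((\<lambda>x. V c (chart_inv c x)) has_derivative
      (\<lambda>v. T c p ** endo_deriv U c p v + endo_deriv T c p v ** U c p)) (at (coord c p))"
    by (rule has_derivative_transform_within_open[OF D, of "coord c ` cdom c"])
      (use c chart[OF c(1)] eq in \<open>auto simp: is_chart_def coord_chart_inv chart_inv_coord\<close>)
  then have "endo_deriv V c p = (\<lambda>v. T c p ** endo_deriv U c p v + endo_deriv T c p v ** U c p)"
    using has_derivative_unique[OF endo_has_derivative[OF V c]] by blast
  then show ?thesis by (simp add: add.commute)
qed

lemma nijenhuis_endo:
  assumes T: "tensor_field_1_1 A T" and c: "c \<in> A" "p \<in> cdom c"
    and TT: "\<And>q. q \<in> cdom c \<Longrightarrow> TT c q = map_matrix complex_of_real (T c q)"
    and X: "\<And>q. q \<in> cdom c \<Longrightarrow> X c q = cvec (x (coord c q))"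
    and Y: "\<And>q. q \<in> cdom c \<Longrightarrow> Y c q = cvec (y (coord c q))"
    and x: "(x has_derivative x') (at (coord c p))" and y: "(y has_derivative y') (at (coord c p))"
  shows "nijenhuis TT X Y c p = cvec (nijenhuis_at (T c p) (endo_deriv T c p) (x (coord c p)) (y (coord c p)))"
proof -
  have "nijenhuis TT X Y c p = cvec (nijenhuis_at (T c (chart_inv c (coord c p))) (endo_deriv T c p) (x (coord c p)) (y (coord c p)))"
    by (rule nijenhuis_cvec[where t = "\<lambda>x. T c (chart_inv c x)" and T = TT and X = X and Y = Y and x = x and y = y, OF chart[OF c(1)] c(2) X Y _ x y endo_has_derivative[OF T c]])
      (simp_all add: TT chart_inv_coord[OF chart[OF c(1)]])
  then show ?thesis by (simp add: chart_inv_coord[OF chart[OF c(1)] c(2)])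
qed

text \<open>Tensoriality in both directions. \<open>TT\<close> is kept separate from
  \<open>T\<close> because \<open>l_op\<close> and its real counterpart are known to agree only at
  points of chart domains.\<close>

lemma nijenhuis_vanishes_iff:
  assumes T: "tensor_field_1_1 A T"
    and TT: "\<And>c q. c \<in> A \<Longrightarrow> q \<in> cdom c \<Longrightarrow> TT c q = map_matrix complex_of_real (T c q)"
  shows "nijenhuis_vanishes A TT \<longleftrightarrow>
    (\<forall>c\<in>A. \<forall>p\<in>cdom c. \<forall>a b. nijenhuis_at (T c p) (endo_deriv T c p) a b = 0)"
proof
  assume N: "nijenhuis_vanishes A TT"
  show "\<forall>c\<in>A. \<forall>p\<in>cdom c. \<forall>a b. nijenhuis_at (T c p) (endo_deriv T c p) a b = 0"
  proof (intro ballI allI)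
    fix c p a b assume c: "c \<in> A" "p \<in> cdom c"
    obtain X where X: "vector_field A X" "X c p = a" using vector_field_through[OF c] .
    obtain Y where Y: "vector_field A Y" "Y c p = b" using vector_field_through[OF c] .
    obtain x x' where x: "(x has_derivative x') (at (coord c p))" "x (coord c p) = X c p"
      "\<And>q. q \<in> cdom c \<Longrightarrow> cfield X c q = cvec (x (coord c q))"
      using vector_field_coord[OF X(1) c] by blast
    obtain y y' where y: "(y has_derivative y') (at (coord c p))" "y (coord c p) = Y c p"
      "\<And>q. q \<in> cdom c \<Longrightarrow> cfield Y c q = cvec (y (coord c q))"
      using vector_field_coord[OF Y(1) c] by blast
    have e: "nijenhuis TT (cfield X) (cfield Y) c p
        = cvec (nijenhuis_at (T c p) (endo_deriv T c p) (x (coord c p)) (y (coord c p)))"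
      by (rule nijenhuis_endo[where T = T and TT = TT and X = "cfield X" and Y = "cfield Y" and x = x and y = y,
            OF T c TT[OF c(1)] x(3) y(3) x(1) y(1)])
    have "nijenhuis TT (cfield X) (cfield Y) c p = 0"
      using N X(1) Y(1) c by (simp add: nijenhuis_vanishes_def)
    then show "nijenhuis_at (T c p) (endo_deriv T c p) a b = 0"
      unfolding e by (simp add: x(2) y(2) X(2) Y(2))
  qed
next
  assume N: "\<forall>c\<in>A. \<forall>p\<in>cdom c. \<forall>a b. nijenhuis_at (T c p) (endo_deriv T c p) a b = 0"
  show "nijenhuis_vanishes A TT"
    unfolding nijenhuis_vanishes_def
  proof (intro allI impI ballI)
    fix X Y c p assume X: "vector_field A X" and Y: "vector_field A Y" and c: "c \<in> A" "p \<in> cdom c"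
    obtain x x' where x: "(x has_derivative x') (at (coord c p))" "x (coord c p) = X c p"
      "\<And>q. q \<in> cdom c \<Longrightarrow> cfield X c q = cvec (x (coord c q))"
      using vector_field_coord[OF X(1) c] by blast
    obtain y y' where y: "(y has_derivative y') (at (coord c p))" "y (coord c p) = Y c p"
      "\<And>q. q \<in> cdom c \<Longrightarrow> cfield Y c q = cvec (y (coord c q))"
      using vector_field_coord[OF Y(1) c] by blast
    have e: "nijenhuis TT (cfield X) (cfield Y) c p
        = cvec (nijenhuis_at (T c p) (endo_deriv T c p) (x (coord c p)) (y (coord c p)))"
      by (rule nijenhuis_endo[where T = T and TT = TT and X = "cfield X" and Y = "cfield Y" and x = x and y = y,
            OF T c TT[OF c(1)] x(3) y(3) x(1) y(1)])
    show "nijenhuis TT (cfield X) (cfield Y) c p = 0"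
      unfolding e using N c by simp
  qed
qed

lemma tensor_field_mult:
  assumes "tensor_field_1_1 A T" "tensor_field_1_1 A U"
  shows "tensor_field_1_1 A (\<lambda>c p. T c p ** U c p)"
  unfolding tensor_field_1_1_def
proof (intro conjI ballI)
  fix c d p assume c: "c \<in> A" "d \<in> A" and p: "p \<in> cdom c \<inter> cdom d"
  have "T d p ** U d p = chart_jac c d p ** T c p ** (chart_jac d c p ** chart_jac c d p) ** U c p ** chart_jac d c p"
    using tensor_field_transform[OF assms(1) c, of p] tensor_field_transform[OF assms(2) c, of p] p
    by (simp add: matrix_mul_assoc)
  moreover have J: "chart_jac d c p ** chart_jac c d p = mat 1" using chart_jac_inverse[OF c] p by blast
  ultimately show "T d p ** U d p = chart_jac c d p ** (T c p ** U c p) ** chart_jac d c p"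
    by (simp only: J matrix_mul_rid) (simp only: matrix_mul_assoc)
next
  fix c assume "c \<in> A"
  moreover from this have "open (coord c ` cdom c)" using chart by (simp add: is_chart_def)
  ultimately show "smooth_on (coord c ` cdom c) (\<lambda>x. T c (chart_inv c x) ** U c (chart_inv c x))"
    by (intro smooth_on_matrix_mult tensor_field_smooth assms)
qed

lemma tensor_field_id: "tensor_field_1_1 A (\<lambda>c p. mat 1)"
  unfolding tensor_field_1_1_def by (auto simp: chart_jac_inverse smooth_on_const)

lemma tensor_field_linear_combination:
  assumes "tensor_field_1_1 A T" "tensor_field_1_1 A U"
  shows "tensor_field_1_1 A (\<lambda>c p. a *\<^sub>R T c p + b *\<^sub>R U c p)"
  unfolding tensor_field_1_1_def
proof (intro conjI ballI)
  fix c d p assume c: "c \<in> A" "d \<in> A" and p: "p \<in> cdom c \<inter> cdom d"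
  have "T d p = chart_jac c d p ** T c p ** chart_jac d c p" "U d p = chart_jac c d p ** U c p ** chart_jac d c p"
    using tensor_field_transform[OF assms(1) c, of p] tensor_field_transform[OF assms(2) c, of p] p by auto
  then show "a *\<^sub>R T d p + b *\<^sub>R U d p = chart_jac c d p ** (a *\<^sub>R T c p + b *\<^sub>R U c p) ** chart_jac d c p"
    by (simp add: matrix_mult_scaleR bounded_bilinear.add_left[OF bounded_bilinear_matrix_mult]
        bounded_bilinear.add_right[OF bounded_bilinear_matrix_mult])
next
  fix c assume "c \<in> A"
  moreover from this have "open (coord c ` cdom c)" using chart by (simp add: is_chart_def)
  ultimately show "smooth_on (coord c ` cdom c) (\<lambda>x. a *\<^sub>R T c (chart_inv c x) + b *\<^sub>R U c (chart_inv c x))"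
    by (intro smooth_on_add smooth_on_scaleR smooth_on_const tensor_field_smooth assms)
qed

lemma tensor_field_power:
  "tensor_field_1_1 A T \<Longrightarrow> tensor_field_1_1 A (\<lambda>c p. matrix_power (T c p) k)"
  by (induction k) (simp_all add: tensor_field_id tensor_field_mult)

lemma tensor_field_complement:
  "tensor_field_1_1 A T \<Longrightarrow> tensor_field_1_1 A (\<lambda>c p. mat 1 - T c p)"
  using tensor_field_linear_combination[OF tensor_field_id, of T 1 "-1"] by simp

lemma endo_deriv_complement:
  assumes T: "tensor_field_1_1 A T" and c: "c \<in> A" "p \<in> cdom c"
  shows "endo_deriv (\<lambda>c p. mat 1 - T c p) c p = (\<lambda>v. - endo_deriv T c p v)"
proof -
  have "((\<lambda>x. mat 1 - T c (chart_inv c x)) has_derivative (\<lambda>v. 0 - endo_deriv T c p v)) (at (coord c p))"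
    by (intro has_derivative_diff has_derivative_const endo_has_derivative[OF T c])
  then show ?thesis unfolding endo_deriv_def[of "\<lambda>c p. mat 1 - T c p"]
    using frechet_derivative_at by fastforce
qed

end

section \<open>The two real projections of an F-structure\<close>

locale F_structure = manifold_atlas A for A :: "('a::{t2_space, second_countable_topology}, 'n::finite) chart set" +
  fixes K :: nat and \<alpha> \<beta> :: complex and r :: nat and F :: "('a, 'n, real) endo_field"
  assumes F_structure: "F_structure_manifold A K \<alpha> \<beta> r F"
begin

lemma F_tensor: "tensor_field_1_1 A F"
  using F_structure by (simp add: F_structure_manifold_def)

definition L :: "('a, 'n, real) endo_field" where "L c p = real_l \<alpha> \<beta> K (F c p)"
text \<open>The real form of \<open>m\<close>. In the pointwise lemmas above, \<open>M\<close>
  stands for the matrix of \<open>F\<close> instead.\<close>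

definition M :: "('a, 'n, real) endo_field" where "M c p = mat 1 - L c p"

lemma L_tensor: "tensor_field_1_1 A L"
proof -
  have "L = (\<lambda>c p. (- Re \<alpha>) *\<^sub>R matrix_power (F c p) K + (- Re \<beta>) *\<^sub>R matrix_power (F c p) (K - 1))"
    by (simp add: L_def real_l_def fun_eq_iff)
  then show ?thesis
    using tensor_field_linear_combination[OF tensor_field_power[OF F_tensor] tensor_field_power[OF F_tensor], of "- Re \<alpha>" K "- Re \<beta>" "K - 1"]
    by simp
qed

lemma M_tensor: "tensor_field_1_1 A M"
  using tensor_field_complement[OF L_tensor] by (simp add: M_def[abs_def])

lemma F_L_props:
  assumes "c \<in> A" "p \<in> cdom c"
  shows "F c p ** L c p = F c p" "L c p ** F c p = F c p" "L c p ** L c p = L c p"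
    "\<exists>G. F c p ** G = L c p \<and> G ** F c p = L c p"
    "l_op \<alpha> \<beta> K F c p = map_matrix complex_of_real (L c p)"
    "m_op \<alpha> \<beta> K F c p = map_matrix complex_of_real (M c p)"
    "cendo F c p = map_matrix complex_of_real (F c p)"
proof -
  have K: "K \<ge> 3" and eq: "mat \<alpha> ** matrix_power (map_matrix complex_of_real (F c p)) (K + 1)
      + mat \<beta> ** matrix_power (map_matrix complex_of_real (F c p)) K + map_matrix complex_of_real (F c p) = 0"
    using F_structure assms unfolding F_structure_manifold_def cendo_def by blast+
  note * = F_structure_matrix[OF K eq]
  show "F c p ** L c p = F c p" "L c p ** F c p = F c p" "L c p ** L c p = L c p"
    "\<exists>G. F c p ** G = L c p \<and> G ** F c p = L c p"
    unfolding L_def using * by blast+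
  show l: "l_op \<alpha> \<beta> K F c p = map_matrix complex_of_real (L c p)"
    unfolding L_def l_op_def cendo_def by (rule *(5))
  have "m_op \<alpha> \<beta> K F c p = mat 1 - l_op \<alpha> \<beta> K F c p"
    by (simp add: m_op_def l_op_def)
  then show "m_op \<alpha> \<beta> K F c p = map_matrix complex_of_real (M c p)"
    by (simp add: l M_def vec_eq_iff mat_def)
qed (simp add: cendo_def)

lemma nijenhuis_l_iff_m:
  "nijenhuis_vanishes A (l_op \<alpha> \<beta> K F) \<longleftrightarrow> nijenhuis_vanishes A (m_op \<alpha> \<beta> K F)"
proof -
  have "nijenhuis_at (M c p) (endo_deriv M c p) a b = nijenhuis_at (L c p) (endo_deriv L c p) a b"
    if "c \<in> A" "p \<in> cdom c" for c p a b
    using endo_deriv_complement[OF L_tensor that] nijenhuis_at_complement[OF linear_endo_deriv[OF L_tensor that]]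
    by (simp add: M_def[abs_def])
  then show ?thesis
    using nijenhuis_vanishes_iff[OF L_tensor F_L_props(5)] nijenhuis_vanishes_iff[OF M_tensor F_L_props(6)]
    by simp
qed

lemma nijenhuis_l_iff_involutive:
  "nijenhuis_vanishes A (l_op \<alpha> \<beta> K F) \<longleftrightarrow>
    (\<forall>c\<in>A. \<forall>p\<in>cdom c. involutive_at (L c p) (endo_deriv L c p)) \<and>
    (\<forall>c\<in>A. \<forall>p\<in>cdom c. involutive_at (M c p) (endo_deriv M c p))"
proof -
  have "(\<forall>a b. nijenhuis_at (L c p) (endo_deriv L c p) a b = 0) \<longleftrightarrow>
      involutive_at (L c p) (endo_deriv L c p) \<and> involutive_at (M c p) (endo_deriv M c p)"
    if "c \<in> A" "p \<in> cdom c" for c p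
    using nijenhuis_at_projection[OF F_L_props(3)[OF that] linear_endo_deriv[OF L_tensor that]]
      endo_deriv_complement[OF L_tensor that]
    by (simp add: M_def[abs_def])
  then show ?thesis
    using nijenhuis_vanishes_iff[OF L_tensor F_L_props(5)] by blast
qed

lemma nijenhuis_F_at_iff:
  assumes "c \<in> A" "p \<in> cdom c"
  shows "(\<forall>a b. nijenhuis_at (F c p) (endo_deriv F c p) a b
        = L c p *v nijenhuis_at (F c p) (endo_deriv F c p) (L c p *v a) (L c p *v b)
          + nijenhuis_at (F c p) (endo_deriv F c p) (L c p *v a) (M c p *v b)
          + nijenhuis_at (F c p) (endo_deriv F c p) (M c p *v a) (L c p *v b))
    \<longleftrightarrow> (\<forall>a b. nijenhuis_at (L c p) (endo_deriv L c p) a b = 0)"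
proof -
  have M: "M c p *v x = x - L c p *v x" for x by (simp add: M_def mv_simps)
  obtain G where G: "F c p ** G = L c p" "G ** F c p = L c p" using F_L_props(4)[OF assms] by blast
  note FL = F_L_props(1-3)[OF assms]
  note dF = linear_endo_deriv[OF F_tensor assms] and dL = linear_endo_deriv[OF L_tensor assms]
  show ?thesis unfolding M
  proof (rule nijenhuis_at_F_iff[OF FL G dF dL])
    fix v
    show "endo_deriv F c p v = endo_deriv L c p v ** F c p + L c p ** endo_deriv F c p v"
      by (rule endo_deriv_mult[OF L_tensor F_tensor F_tensor assms]) (simp add: F_L_props assms)
    show "endo_deriv F c p v = endo_deriv F c p v ** L c p + F c p ** endo_deriv L c p v"
      by (rule endo_deriv_mult[OF F_tensor L_tensor F_tensor assms]) (simp add: F_L_props assms)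
    show "endo_deriv L c p v = endo_deriv L c p v ** L c p + L c p ** endo_deriv L c p v"
      by (rule endo_deriv_mult[OF L_tensor L_tensor L_tensor assms]) (simp add: F_L_props assms)
  qed
qed

text \<open>Each side of the identity depends only on the values of \<open>X\<close> and
  \<open>Y\<close> at the point. So the fields may be traded for arbitrary vectors, and the
  pointwise equivalence applies.\<close>

lemma nijenhuis_F_iff:
  assumes l: "l = l_op \<alpha> \<beta> K F" and m: "m = m_op \<alpha> \<beta> K F" and G: "G = cendo F"
  shows "nijenhuis_vanishes A l
    \<longleftrightarrow> (\<forall>X Y. vector_field A X \<longrightarrow> vector_field A Y \<longrightarrow>
          (\<forall>c\<in>A. \<forall>p\<in>cdom c.
             nijenhuis G (cfield X) (cfield Y) c p
             = app l (nijenhuis G (app l (cfield X)) (app l (cfield Y))) c p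
               + nijenhuis G (app l (cfield X)) (app m (cfield Y)) c p
               + nijenhuis G (app m (cfield X)) (app l (cfield Y)) c p))"
    (is "_ \<longleftrightarrow> (\<forall>X Y. _ \<longrightarrow> _ \<longrightarrow> (\<forall>c\<in>A. \<forall>p\<in>cdom c. ?iv X Y c p))")
proof -
  define N where "N c p = nijenhuis_at (F c p) (endo_deriv F c p)" for c p
  define ivr where "ivr c p a b \<longleftrightarrow> N c p a b = L c p *v N c p (L c p *v a) (L c p *v b)
      + N c p (L c p *v a) (M c p *v b) + N c p (M c p *v a) (L c p *v b)" for c p a b
  have iv: "?iv X Y c p \<longleftrightarrow> ivr c p (X c p) (Y c p)"
    if X: "vector_field A X" and Y: "vector_field A Y" and c: "c \<in> A" "p \<in> cdom c" for X Y c p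
  proof -
    obtain x x' where x: "(x has_derivative x') (at (coord c p))" "x (coord c p) = X c p"
      "\<And>q. q \<in> cdom c \<Longrightarrow> cfield X c q = cvec (x (coord c q))"
      using vector_field_coord[OF X(1) c] by blast
    obtain y y' where y: "(y has_derivative y') (at (coord c p))" "y (coord c p) = Y c p"
      "\<And>q. q \<in> cdom c \<Longrightarrow> cfield Y c q = cvec (y (coord c q))"
      using vector_field_coord[OF Y(1) c] by blast
    note mv = bounded_bilinear.FDERIV[OF bounded_bilinear_matrix_vector_mult]
    note ci = chart_inv_coord[OF chart[OF c(1)]]
    have a: "app l Z c q = cvec (L c (chart_inv c (coord c q)) *v z (coord c q))"
      "app m Z c q = cvec (M c (chart_inv c (coord c q)) *v z (coord c q))"
      if "\<And>q. q \<in> cdom c \<Longrightarrow> Z c q = cvec (z (coord c q))" "q \<in> cdom c" for Z z q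
      using that c(1) by (simp_all add: app_def l m F_L_props cvec_matrix_vector ci)
    have N: "nijenhuis G Z W c p = cvec (N c p (z (coord c p)) (w (coord c p)))"
      \<comment> \<open>Arbitrary real coordinate representatives are allowed, because
        \<open>app l (cfield X)\<close> and \<open>app m (cfield X)\<close> enter as arguments and
        are complex fields.\<close>
      if "\<And>q. q \<in> cdom c \<Longrightarrow> Z c q = cvec (z (coord c q))" "\<And>q. q \<in> cdom c \<Longrightarrow> W c q = cvec (w (coord c q))"
       "(z has_derivative z') (at (coord c p))" "(w has_derivative w') (at (coord c p))" for Z W z w z' w'
      unfolding N_def
      by (rule nijenhuis_endo[where T = F and X = Z and Y = W and x = z and y = w, OF F_tensor c _ that]) (simp_all add: G F_L_props c)
    note dL = endo_has_derivative[OF L_tensor c] and dM = endo_has_derivative[OF M_tensor c]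
    have 1: "nijenhuis G (cfield X) (cfield Y) c p = cvec (N c p (X c p) (Y c p))"
      using N[where Z = "cfield X" and W = "cfield Y" and z = "x" and w = "y", OF x(3) y(3) x(1) y(1)] by (simp add: x(2) y(2))
    have 2: "nijenhuis G (app l (cfield X)) (app l (cfield Y)) c p = cvec (N c p (L c p *v X c p) (L c p *v Y c p))"
      using N[where Z = "app l (cfield X)" and W = "app l (cfield Y)" and z = "\<lambda>w. L c (chart_inv c w) *v x w" and w = "\<lambda>w. L c (chart_inv c w) *v y w", OF a(1)[where Z = "cfield X" and z = x, OF x(3)] a(1)[where Z = "cfield Y" and z = y, OF y(3)] mv[OF dL x(1)] mv[OF dL y(1)]] by (simp add: x(2) y(2) ci c)
    have 3: "nijenhuis G (app l (cfield X)) (app m (cfield Y)) c p = cvec (N c p (L c p *v X c p) (M c p *v Y c p))"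
      using N[where Z = "app l (cfield X)" and W = "app m (cfield Y)" and z = "\<lambda>w. L c (chart_inv c w) *v x w" and w = "\<lambda>w. M c (chart_inv c w) *v y w", OF a(1)[where Z = "cfield X" and z = x, OF x(3)] a(2)[where Z = "cfield Y" and z = y, OF y(3)] mv[OF dL x(1)] mv[OF dM y(1)]] by (simp add: x(2) y(2) ci c)
    have 4: "nijenhuis G (app m (cfield X)) (app l (cfield Y)) c p = cvec (N c p (M c p *v X c p) (L c p *v Y c p))"
      using N[where Z = "app m (cfield X)" and W = "app l (cfield Y)" and z = "\<lambda>w. M c (chart_inv c w) *v x w" and w = "\<lambda>w. L c (chart_inv c w) *v y w", OF a(2)[where Z = "cfield X" and z = x, OF x(3)] a(1)[where Z = "cfield Y" and z = y, OF y(3)] mv[OF dM x(1)] mv[OF dL y(1)]] by (simp add: x(2) y(2) ci c)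
    show ?thesis
      unfolding app_def[of l "nijenhuis _ _ _"] 1 2 3 4 ivr_def
      by (simp add: l F_L_props c cvec_matrix_vector flip: cvec_simps(1))
  qed
  have "nijenhuis_vanishes A l \<longleftrightarrow> (\<forall>c\<in>A. \<forall>p\<in>cdom c. \<forall>a b. ivr c p a b)"
    using nijenhuis_vanishes_iff[OF L_tensor F_L_props(5)] nijenhuis_F_at_iff by (simp add: l ivr_def N_def)
  also have "\<dots> \<longleftrightarrow> (\<forall>X Y. vector_field A X \<longrightarrow> vector_field A Y \<longrightarrow> (\<forall>c\<in>A. \<forall>p\<in>cdom c. ivr c p (X c p) (Y c p)))"
  proof
    assume *: "\<forall>X Y. vector_field A X \<longrightarrow> vector_field A Y \<longrightarrow> (\<forall>c\<in>A. \<forall>p\<in>cdom c. ivr c p (X c p) (Y c p))"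
    show "\<forall>c\<in>A. \<forall>p\<in>cdom c. \<forall>a b. ivr c p a b"
    proof (intro ballI allI)
      fix c p a b assume c: "c \<in> A" "p \<in> cdom c"
      obtain X where X: "vector_field A X" "X c p = a" using vector_field_through[OF c] .
      obtain Y where Y: "vector_field A Y" "Y c p = b" using vector_field_through[OF c] .
      show "ivr c p a b" using * X Y c by blast
    qed
  qed blast
  also have "\<dots> \<longleftrightarrow> (\<forall>X Y. vector_field A X \<longrightarrow> vector_field A Y \<longrightarrow> (\<forall>c\<in>A. \<forall>p\<in>cdom c. ?iv X Y c p))"
    by (simp add: iv)
  finally show ?thesis .
qed

end

section \<open>Symmetry of second derivatives\<close>

text \<open>The mean value theorem, used first in the direction \<open>v\<close> and then in
  \<open>w\<close>, writes the second difference quotient as an iterated derivative at a nearby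
  point; continuity of that derivative does the rest.\<close>

lemma second_difference_limit:
  fixes g :: "'a::real_normed_vector \<Rightarrow> real"
  assumes S: "open S" "z \<in> S" and g: "smooth_on S g" and e: "e > 0"
  obtains d where "d > 0"
    "\<And>h. 0 < h \<Longrightarrow> h < d \<Longrightarrow>
      \<bar>(g (z + h *\<^sub>R v + h *\<^sub>R w) - g (z + h *\<^sub>R v) - g (z + h *\<^sub>R w) + g z) / h\<^sup>2
        - frechet_derivative (\<lambda>x. frechet_derivative g (at x) v) (at z) w\<bar> < e"
proof -
  let ?D = "\<lambda>x. frechet_derivative g (at x) v"
  let ?E = "\<lambda>x. frechet_derivative ?D (at x) w"
  have sD: "smooth_on S ?D" by (rule smooth_on_frechet_derivative[OF g])
  have "continuous_on S ?E" by (rule smooth_on_imp_continuous_on[OF smooth_on_frechet_derivative[OF sD]])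
  then have "isCont ?E z" using S continuous_on_eq_continuous_at by blast
  then obtain d1 where d1: "d1 > 0" "\<And>x. dist x z < d1 \<Longrightarrow> \<bar>?E x - ?E z\<bar> < e"
    using e unfolding continuous_at_eps_delta dist_real_def by blast
  obtain d2 where d2: "d2 > 0" "ball z d2 \<subseteq> S" using S open_contains_ball by blast
  \<comment> \<open>The parallelogram with sides \<open>h *\<^sub>R v\<close> and
    \<open>h *\<^sub>R w\<close> must stay in both balls; the added 1 keeps the denominator positive
    when both directions vanish.\<close>
  define d where "d = min d1 d2 / (norm v + norm w + 1)"
  have nz: "norm v + norm w + 1 > 0" by (simp add: add_nonneg_pos)
  have d: "d > 0" using d1(1) d2(1) nz by (simp add: d_def)
  have near: "dist (z + s *\<^sub>R v + t *\<^sub>R w) z < min d1 d2" if "0 \<le> s" "s \<le> h" "0 \<le> t" "t \<le> h" "0 < h" "h < d" for s t h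
  proof -
    have "dist (z + s *\<^sub>R v + t *\<^sub>R w) z = norm (s *\<^sub>R v + t *\<^sub>R w)" by (simp add: dist_norm)
    also have "\<dots> \<le> s * norm v + t * norm w"
      using that by (intro order_trans[OF norm_triangle_ineq]) simp
    also have "\<dots> \<le> h * norm v + h * norm w" using that by (intro add_mono mult_right_mono) auto
    also have "\<dots> < h * (norm v + norm w + 1)" using that by (simp add: algebra_simps)
    also have "\<dots> \<le> d * (norm v + norm w + 1)" using that nz by (intro mult_right_mono) auto
    also have "\<dots> = min d1 d2" using nz by (simp add: d_def)
    finally show ?thesis .
  qed
  have inS: "z + s *\<^sub>R v + t *\<^sub>R w \<in> S" if "0 \<le> s" "s \<le> h" "0 \<le> t" "t \<le> h" "0 < h" "h < d" for s t h
    using near[OF that] d2(2) by (auto simp: dist_commute)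
  have "\<bar>(g (z + h *\<^sub>R v + h *\<^sub>R w) - g (z + h *\<^sub>R v) - g (z + h *\<^sub>R w) + g z) / h\<^sup>2 - ?E z\<bar> < e"
    if h: "0 < h" "h < d" for h
  proof -
    have dg: "((\<lambda>s. g (z + s *\<^sub>R v + t *\<^sub>R w)) has_real_derivative ?D (z + s *\<^sub>R v + t *\<^sub>R w)) (at s)"
      if "0 \<le> s" "s \<le> h" "0 \<le> t" "t \<le> h" for s t
    proof -
      have 1: "(g has_derivative frechet_derivative g (at (z + s *\<^sub>R v + t *\<^sub>R w))) (at (z + s *\<^sub>R v + t *\<^sub>R w))"
        by (rule smooth_on_has_derivative[OF g inS]) (use that h in auto)
      have "((\<lambda>s. z + s *\<^sub>R v + t *\<^sub>R w) has_derivative (\<lambda>k. k *\<^sub>R v)) (at s)"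
        by (auto intro!: derivative_eq_intros)
      from diff_chain_at[OF this 1] show ?thesis
        unfolding has_field_derivative_def o_def
        by (rule has_derivative_eq_rhs) (simp add: fun_eq_iff linear_scale[OF has_derivative_linear[OF 1]] mult.commute)
    qed
    have dD: "((\<lambda>t. ?D (z + s *\<^sub>R v + t *\<^sub>R w)) has_real_derivative ?E (z + s *\<^sub>R v + t *\<^sub>R w)) (at t)"
      if "0 \<le> s" "s \<le> h" "0 \<le> t" "t \<le> h" for s t
    proof -
      have 1: "(?D has_derivative frechet_derivative ?D (at (z + s *\<^sub>R v + t *\<^sub>R w))) (at (z + s *\<^sub>R v + t *\<^sub>R w))"
        by (rule smooth_on_has_derivative[OF sD inS]) (use that h in auto)
      have "((\<lambda>t. z + s *\<^sub>R v + t *\<^sub>R w) has_derivative (\<lambda>k. k *\<^sub>R w)) (at t)"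
        by (auto intro!: derivative_eq_intros)
      from diff_chain_at[OF this 1] show ?thesis
        unfolding has_field_derivative_def o_def
        by (rule has_derivative_eq_rhs) (simp add: fun_eq_iff linear_scale[OF has_derivative_linear[OF 1]] mult.commute)
    qed
    let ?p = "\<lambda>s. g (z + s *\<^sub>R v + h *\<^sub>R w) - g (z + s *\<^sub>R v + 0 *\<^sub>R w)"
    have "\<exists>\<xi>. 0 < \<xi> \<and> \<xi> < h \<and> ?p h - ?p 0 = (h - 0) * (?D (z + \<xi> *\<^sub>R v + h *\<^sub>R w) - ?D (z + \<xi> *\<^sub>R v + 0 *\<^sub>R w))"
      by (rule MVT2[OF h(1), where f = ?p and f' = "\<lambda>s. ?D (z + s *\<^sub>R v + h *\<^sub>R w) - ?D (z + s *\<^sub>R v + 0 *\<^sub>R w)"])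
        (rule DERIV_diff[OF dg dg]; use h in simp)
    then obtain \<xi> where \<xi>: "0 < \<xi>" "\<xi> < h"
      "?p h - ?p 0 = h * (?D (z + \<xi> *\<^sub>R v + h *\<^sub>R w) - ?D (z + \<xi> *\<^sub>R v + 0 *\<^sub>R w))"
      by auto
    have "\<exists>\<eta>. 0 < \<eta> \<and> \<eta> < h \<and> ?D (z + \<xi> *\<^sub>R v + h *\<^sub>R w) - ?D (z + \<xi> *\<^sub>R v + 0 *\<^sub>R w)
        = (h - 0) * ?E (z + \<xi> *\<^sub>R v + \<eta> *\<^sub>R w)"
      by (rule MVT2[OF h(1), where f = "\<lambda>t. ?D (z + \<xi> *\<^sub>R v + t *\<^sub>R w)" and f' = "\<lambda>t. ?E (z + \<xi> *\<^sub>R v + t *\<^sub>R w)"])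
        (rule dD; use h \<xi> in simp)
    then obtain \<eta> where \<eta>: "0 < \<eta>" "\<eta> < h"
      "?D (z + \<xi> *\<^sub>R v + h *\<^sub>R w) - ?D (z + \<xi> *\<^sub>R v + 0 *\<^sub>R w) = h * ?E (z + \<xi> *\<^sub>R v + \<eta> *\<^sub>R w)"
      by auto
    have "g (z + h *\<^sub>R v + h *\<^sub>R w) - g (z + h *\<^sub>R v) - g (z + h *\<^sub>R w) + g z = ?p h - ?p 0" by simp
    also have "\<dots> = h\<^sup>2 * ?E (z + \<xi> *\<^sub>R v + \<eta> *\<^sub>R w)"
      unfolding \<xi>(3) \<eta>(3) by (simp add: power2_eq_square)
    finally have "(g (z + h *\<^sub>R v + h *\<^sub>R w) - g (z + h *\<^sub>R v) - g (z + h *\<^sub>R w) + g z) / h\<^sup>2 = ?E (z + \<xi> *\<^sub>R v + \<eta> *\<^sub>R w)"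
      using h by simp
    moreover have "dist (z + \<xi> *\<^sub>R v + \<eta> *\<^sub>R w) z < min d1 d2"
      by (rule near[where h = h]) (use \<xi> \<eta> h in auto)
    ultimately show ?thesis using d1(2)[of "z + \<xi> *\<^sub>R v + \<eta> *\<^sub>R w"] by simp
  qed
  with d show ?thesis by (rule that)
qed

text \<open>The second difference is symmetric in \<open>v\<close> and \<open>w\<close>, so one
  number approximates both iterated derivatives to within half of their supposed distance.\<close>

lemma second_derivative_symmetric_real:
  fixes g :: "'a::real_normed_vector \<Rightarrow> real"
  assumes S: "open S" "z \<in> S" and g: "smooth_on S g"
  shows "frechet_derivative (\<lambda>x. frechet_derivative g (at x) v) (at z) w
    = frechet_derivative (\<lambda>x. frechet_derivative g (at x) w) (at z) v" (is "?l = ?r")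
proof (rule ccontr)
  assume ne: "?l \<noteq> ?r"
  define e where "e = \<bar>?l - ?r\<bar> / 2"
  have e: "e > 0" using ne by (simp add: e_def)
  obtain d1 where d1: "d1 > 0"
    "\<And>h. 0 < h \<Longrightarrow> h < d1 \<Longrightarrow> \<bar>(g (z + h *\<^sub>R v + h *\<^sub>R w) - g (z + h *\<^sub>R v) - g (z + h *\<^sub>R w) + g z) / h\<^sup>2 - ?l\<bar> < e"
    using second_difference_limit[OF S g e, of v w] by blast
  obtain d2 where d2: "d2 > 0"
    "\<And>h. 0 < h \<Longrightarrow> h < d2 \<Longrightarrow> \<bar>(g (z + h *\<^sub>R w + h *\<^sub>R v) - g (z + h *\<^sub>R w) - g (z + h *\<^sub>R v) + g z) / h\<^sup>2 - ?r\<bar> < e"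
    using second_difference_limit[OF S g e, of w v] by blast
  define h where "h = min d1 d2 / 2"
  have h: "0 < h" "h < d1" "h < d2" using d1(1) d2(1) by (auto simp: h_def)
  have sw: "z + h *\<^sub>R w + h *\<^sub>R v = z + h *\<^sub>R v + h *\<^sub>R w" by simp
  define q where "q = (g (z + h *\<^sub>R v + h *\<^sub>R w) - g (z + h *\<^sub>R v) - g (z + h *\<^sub>R w) + g z) / h\<^sup>2"
  have a: "\<bar>q - ?l\<bar> < e" using d1(2)[OF h(1,2)] by (simp add: q_def)
  have b: "\<bar>q - ?r\<bar> < e" using d2(2)[OF h(1,3)] unfolding sw by (simp add: q_def algebra_simps)
  have c: "\<bar>?l - ?r\<bar> \<le> \<bar>q - ?r\<bar> + \<bar>q - ?l\<bar>"
    using abs_triangle_ineq4[of "q - ?r" "q - ?l"] by simp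
  have "\<bar>?l - ?r\<bar> < e + e" by (rule order_le_less_trans[OF c add_strict_mono[OF b a]])
  then show False by (simp add: e_def)
qed

lemma second_derivative_symmetric:
  fixes f :: "'a::real_normed_vector \<Rightarrow> 'b::euclidean_space"
  assumes S: "open S" "z \<in> S" and f: "smooth_on S f"
  shows "frechet_derivative (\<lambda>x. frechet_derivative f (at x) v) (at z) w
    = frechet_derivative (\<lambda>x. frechet_derivative f (at x) w) (at z) v"
proof (rule euclidean_eqI)
  fix b :: 'b assume "b \<in> Basis"
  have fb: "smooth_on S (\<lambda>x. f x \<bullet> b)"
    by (rule smooth_on_bounded_linear[OF bounded_linear_inner_left f S(1)])
  have 1: "frechet_derivative (\<lambda>x. f x \<bullet> b) (at x) u = frechet_derivative f (at x) u \<bullet> b" if "x \<in> S" for x u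
    using frechet_derivative_at[OF bounded_linear.has_derivative[OF bounded_linear_inner_left smooth_on_has_derivative[OF f that]], symmetric]
    by simp
  have 2: "frechet_derivative (\<lambda>x. frechet_derivative (\<lambda>x. f x \<bullet> b) (at x) u) (at z) k
      = frechet_derivative (\<lambda>x. frechet_derivative f (at x) u) (at z) k \<bullet> b" for u k
  proof -
    have "frechet_derivative (\<lambda>x. frechet_derivative (\<lambda>x. f x \<bullet> b) (at x) u) (at z)
        = (\<lambda>k. frechet_derivative (\<lambda>x. frechet_derivative f (at x) u) (at z) k \<bullet> b)"
      by (rule frechet_derivative_cong_open[OF S 1])
        (assumption, rule bounded_linear.has_derivative[OF bounded_linear_inner_left
            smooth_on_has_derivative[OF smooth_on_frechet_derivative[OF f] S(2)]])
    then show ?thesis by simp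
  qed
  show "frechet_derivative (\<lambda>x. frechet_derivative f (at x) v) (at z) w \<bullet> b
    = frechet_derivative (\<lambda>x. frechet_derivative f (at x) w) (at z) v \<bullet> b"
    using second_derivative_symmetric_real[OF S fb, of v w] by (simp add: 2)
qed

section \<open>Tangent spaces of submanifolds\<close>

lemma mem_complexify_cvec:
  assumes "0 \<in> V"
  shows "cvec u \<in> complexify V \<longleftrightarrow> u \<in> V"
proof
  assume "cvec u \<in> complexify V"
  then obtain a b where ab: "a \<in> V" "cvec u = cvec a + \<i> *s cvec b" by (auto simp: complexify_def)
  have "u $ i = a $ i" for i
    using arg_cong[OF ab(2), of "\<lambda>x. Re (x $ i)"] by (simp add: cvec_def)
  then have "u = a" by (simp add: vec_eq_iff)
  then show "u \<in> V" using ab by simp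
next
  assume "u \<in> V"
  moreover have "cvec u = cvec u + \<i> *s cvec 0" by (simp add: cvec_simps)
  ultimately show "cvec u \<in> complexify V" using assms unfolding complexify_def by blast
qed

text \<open>Lets an equality of complexified distributions be read as an equality of real
  subspaces.\<close>

lemma complexify_inject:
  "0 \<in> V \<Longrightarrow> 0 \<in> W \<Longrightarrow> complexify V = complexify W \<longleftrightarrow> V = W"
  using mem_complexify_cvec by blast

lemma range_map_matrix_of_real:
  fixes M :: "real^'n^'m"
  shows "range (\<lambda>v. map_matrix complex_of_real M *v v) = complexify (range ((*v) M))"
proof -
  have dec: "v = cvec (\<chi> i. Re (v $ i)) + \<i> *s cvec (\<chi> i. Im (v $ i))" for v :: "complex^'k"
    by (simp add: cvec_def vec_eq_iff complex_eq_iff)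
  have mul: "map_matrix complex_of_real M *v (cvec a + \<i> *s cvec b) = cvec (M *v a) + \<i> *s cvec (M *v b)" for a b
    by (simp add: matrix_vector_right_distrib vector_scalar_commute cvec_matrix_vector)
  show ?thesis
  proof (intro equalityI subsetI)
    fix x assume "x \<in> range (\<lambda>v. map_matrix complex_of_real M *v v)"
    then obtain v where "x = map_matrix complex_of_real M *v v" by auto
    then show "x \<in> complexify (range ((*v) M))"
      using dec[of v] mul unfolding complexify_def by (metis (mono_tags, lifting) mem_Collect_eq rangeI)
  next
    fix x assume "x \<in> complexify (range ((*v) M))"
    then obtain a b where "x = cvec (M *v a) + \<i> *s cvec (M *v b)" by (auto simp: complexify_def)
    then show "x \<in> range (\<lambda>v. map_matrix complex_of_real M *v v)" unfolding mul[symmetric] by blast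
  qed
qed

lemma tangent_spaceI:
  assumes "\<gamma> 0 = q" "\<epsilon> > 0" "\<gamma> ` {-\<epsilon><..<\<epsilon>} \<subseteq> N \<inter> cdom c"
    "smooth_on {-\<epsilon><..<\<epsilon>} (coord c \<circ> \<gamma>)" "((coord c \<circ> \<gamma>) has_vector_derivative v) (at 0)"
  shows "v \<in> tangent_space N c q"
  unfolding tangent_space_def mem_Collect_eq by (intro exI[of _ \<gamma>] exI[of _ \<epsilon>] conjI assms)

lemma inj_on_coord: "is_chart c \<Longrightarrow> inj_on (coord c) (cdom c)"
  by (rule inj_on_inverseI[of _ "chart_inv c"]) (rule chart_inv_coord)

lemma mem_slice_iff:
  assumes c: "is_chart c" and N: "coord c ` (cdom c \<inter> N) = coord c ` cdom c \<inter> V" and p: "p \<in> cdom c"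
  shows "p \<in> N \<longleftrightarrow> coord c p \<in> V"
proof -
  have "coord c p \<in> coord c ` (cdom c \<inter> N) \<longleftrightarrow> p \<in> cdom c \<inter> N"
    by (rule inj_on_image_mem_iff[OF inj_on_coord[OF c] p Int_lower1])
  then show ?thesis unfolding N using p by auto
qed

text \<open>Paired with a vector orthogonal to \<open>V\<close> the curve is identically zero, hence
  so is its velocity; and \<open>V\<close> is its own double orthogonal complement.\<close>

lemma vector_derivative_in_subspace:
  fixes y :: "real \<Rightarrow> 'a::euclidean_space"
  assumes V: "subspace V" and e: "e > 0" and y: "\<And>t. t \<in> {-e<..<e} \<Longrightarrow> y t \<in> V"
    and d: "(y has_vector_derivative v) (at 0)"
  shows "v \<in> V"
proof -
  have "w \<bullet> v = 0" if w: "w \<in> V\<^sup>\<bottom>" for w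
  proof -
    have "((\<lambda>t. w \<bullet> y t) has_vector_derivative w \<bullet> v) (at 0)"
      by (rule bounded_linear.has_vector_derivative[OF bounded_linear_inner_right d])
    moreover have "((\<lambda>t. w \<bullet> y t) has_vector_derivative 0) (at 0)"
    proof (rule has_vector_derivative_transform_within_open[OF has_vector_derivative_const])
      show "0 = w \<bullet> y t" if "t \<in> {-e<..<e}" for t
        using w y[OF that] by (auto simp: orthogonal_comp_def orthogonal_def inner_commute)
    qed (use e in auto)
    ultimately show ?thesis using vector_derivative_unique_at by blast
  qed
  then have "v \<in> (V\<^sup>\<bottom>)\<^sup>\<bottom>" by (auto simp: orthogonal_comp_def orthogonal_def inner_commute)
  then show ?thesis using orthogonal_comp_self[OF V] by simp
qed

context manifold_atlas
begin

text \<open>Curves in the slice have velocities in \<open>V\<close>; conversely, each vector of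
  \<open>V\<close> is the velocity of a straight segment pulled back by the chart.\<close>

lemma tangent_space_slice:
  assumes c: "c \<in> A" and V: "subspace V" and N: "coord c ` (cdom c \<inter> N) = coord c ` cdom c \<inter> V"
    and q: "q \<in> N" "q \<in> cdom c"
  shows "tangent_space N c q = V"
proof (intro equalityI subsetI)
  have ch: "is_chart c" using chart c by blast
  note NV = mem_slice_iff[OF ch N]
  fix v
  {
    assume "v \<in> tangent_space N c q"
    then obtain \<gamma> \<epsilon> where g: "\<epsilon> > 0" "\<gamma> ` {-\<epsilon><..<\<epsilon>} \<subseteq> N \<inter> cdom c"
      "((coord c \<circ> \<gamma>) has_vector_derivative v) (at 0)" unfolding tangent_space_def by blast
    have "(coord c \<circ> \<gamma>) t \<in> V" if "t \<in> {-\<epsilon><..<\<epsilon>}" for t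
      using NV[of "\<gamma> t"] subsetD[OF g(2) imageI[OF that]] by simp
    then show "v \<in> V" by (rule vector_derivative_in_subspace[OF V g(1) _ g(3)])
  }
  assume v: "v \<in> V"
  let ?l = "\<lambda>t::real. coord c q + t *\<^sub>R v"
  have cont: "continuous_on UNIV ?l" by (intro continuous_intros)
  have "open (coord c ` cdom c)" using ch by (simp add: is_chart_def)
  then have "open (?l -` (coord c ` cdom c))" by (rule open_vimage[OF _ cont])
  moreover have "0 \<in> ?l -` (coord c ` cdom c)" using q by simp
  ultimately obtain \<epsilon> where e: "\<epsilon> > 0" "ball 0 \<epsilon> \<subseteq> ?l -` (coord c ` cdom c)"
    by (rule openE)
  have b: "ball 0 \<epsilon> = {-\<epsilon><..<\<epsilon>}" by (auto simp: ball_eq_greaterThanLessThan)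
  let ?g = "\<lambda>t. chart_inv c (?l t)"
  have g: "coord c (?g t) = ?l t" "?g t \<in> cdom c" if "t \<in> {-\<epsilon><..<\<epsilon>}" for t
  proof -
    have "?l t \<in> coord c ` cdom c" using e(2) that unfolding b by blast
    then show "coord c (?g t) = ?l t" "?g t \<in> cdom c" by (rule coord_chart_inv[OF ch])+
  qed
  have lV: "?l t \<in> V" for t
    using NV[OF q(2)] q(1) by (intro subspace_add subspace_scale V v) simp
  show "v \<in> tangent_space N c q"
    unfolding tangent_space_def
  proof (intro CollectI exI[of _ ?g] exI[of _ \<epsilon>] conjI)
    show "?g 0 = q" using chart_inv_coord[OF ch q(2)] by simp
    show "?g ` {-\<epsilon><..<\<epsilon>} \<subseteq> N \<inter> cdom c"
    proof (intro image_subsetI IntI)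
      fix t assume t: "t \<in> {-\<epsilon><..<\<epsilon>}"
      show "?g t \<in> cdom c" by (rule g[OF t])
      then show "?g t \<in> N" using NV[of "?g t"] g(1)[OF t] lV by simp
    qed
    have "smooth_on {-\<epsilon><..<\<epsilon>} ?l"
      by (intro smooth_on_add smooth_on_const smooth_on_scaleR smooth_on_id) auto
    then show "smooth_on {-\<epsilon><..<\<epsilon>} (coord c \<circ> ?g)"
      by (rule smooth_on_cong) (simp_all add: g)
    have "(?l has_vector_derivative v) (at 0)"
      by (auto intro!: derivative_eq_intros simp: has_vector_derivative_def)
    then show "((coord c \<circ> ?g) has_vector_derivative v) (at 0)"
      by (rule has_vector_derivative_transform_within_open[of _ _ _ "{-\<epsilon><..<\<epsilon>}"]) (use e g in auto)
  qed (rule e)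
qed

lemma tangent_space_transform_subset:
  assumes c: "c \<in> A" "d \<in> A" and q: "q \<in> cdom c" "q \<in> cdom d" and v: "v \<in> tangent_space N c q"
  shows "chart_jac c d q *v v \<in> tangent_space N d q"
proof -
  have chc: "is_chart c" and chd: "is_chart d" using chart c by auto
  obtain \<gamma> \<epsilon> where g: "\<epsilon> > 0" "\<gamma> 0 = q" "\<gamma> ` {-\<epsilon><..<\<epsilon>} \<subseteq> N \<inter> cdom c"
    "smooth_on {-\<epsilon><..<\<epsilon>} (coord c \<circ> \<gamma>)"
    "((coord c \<circ> \<gamma>) has_vector_derivative v) (at 0)" using v unfolding tangent_space_def by blast
  let ?I = "{-\<epsilon><..<\<epsilon>}" and ?S = "coord c ` (cdom c \<inter> cdom d)"
  have "open (?I \<inter> (coord c \<circ> \<gamma>) -` ?S)"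
    by (rule continuous_open_preimage[OF smooth_on_imp_continuous_on[OF g(4)] _ open_overlap[OF c]]) simp
  moreover have "0 \<in> ?I \<inter> (coord c \<circ> \<gamma>) -` ?S" using g(1,2) q by simp
  \<comment> \<open>The curve is only known to lie in \<open>cdom c\<close>; the interval is
    shortened until it also stays in \<open>cdom d\<close>.\<close>
  ultimately obtain \<delta> where d: "\<delta> > 0" "ball 0 \<delta> \<subseteq> ?I \<inter> (coord c \<circ> \<gamma>) -` ?S"
    by (rule openE)
  let ?J = "{-\<delta><..<\<delta>}"
  have b: "ball 0 \<delta> = ?J" by (auto simp: ball_eq_greaterThanLessThan)
  have J: "t \<in> ?I" "coord c (\<gamma> t) \<in> ?S" if "t \<in> ?J" for t
    using subsetD[OF d(2)[unfolded b] that] by simp_all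
  have Jd: "\<gamma> t \<in> N" "\<gamma> t \<in> cdom c" "\<gamma> t \<in> cdom d" if t: "t \<in> ?J" for t
  proof -
    show N: "\<gamma> t \<in> N" "\<gamma> t \<in> cdom c" using subsetD[OF g(3) imageI[OF J(1)[OF t]]] by simp_all
    have "\<gamma> t \<in> cdom c \<inter> cdom d"
      using inj_on_image_mem_iff[OF inj_on_coord[OF chc] N(2) Int_lower1] J(2)[OF t] by simp
    then show "\<gamma> t \<in> cdom d" by simp
  qed
  let ?h = "\<lambda>t. (coord d \<circ> chart_inv c) ((coord c \<circ> \<gamma>) t)"
  have h: "?h t = (coord d \<circ> \<gamma>) t" if "t \<in> ?J" for t
    using Jd[OF that] by (simp add: chart_inv_coord[OF chc])
  have g': "smooth_on ?J (coord c \<circ> \<gamma>)" by (rule smooth_on_subset[OF g(4)]) (use J(1) in blast)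
  have "smooth_on ?J ?h"
    by (rule smooth_on_compose[OF smooth_transition[OF c] g']) (use J(2) in auto)
  then have s: "smooth_on ?J (coord d \<circ> \<gamma>)" by (rule smooth_on_cong) (simp_all add: h del: o_apply)
  have "((coord d \<circ> chart_inv c) has_derivative (*v) (chart_jac c d q)) (at ((coord c \<circ> \<gamma>) 0))"
    using transition_has_derivative[OF c q] g(2) by simp
  then have "(((coord d \<circ> chart_inv c) \<circ> (coord c \<circ> \<gamma>)) has_vector_derivative chart_jac c d q *v v) (at 0)"
    by (rule vector_derivative_diff_chain_within[OF g(5) has_derivative_at_withinI])
  then have der: "((coord d \<circ> \<gamma>) has_vector_derivative chart_jac c d q *v v) (at 0)"
  proof (rule has_vector_derivative_transform_within_open)
    show "open ?J" "0 \<in> ?J" using d(1) by simp_all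
    show "(coord d \<circ> chart_inv c \<circ> (coord c \<circ> \<gamma>)) t = (coord d \<circ> \<gamma>) t" if "t \<in> ?J" for t
      using h[OF that] by simp
  qed
  have "\<gamma> ` ?J \<subseteq> N \<inter> cdom d" using Jd by blast
  then show ?thesis by (rule tangent_spaceI[OF g(2) d(1) _ s der])
qed

lemma tangent_space_transform:
  assumes c: "c \<in> A" "d \<in> A" and q: "q \<in> cdom c" "q \<in> cdom d"
  shows "tangent_space N d q = (*v) (chart_jac c d q) ` tangent_space N c q"
proof (intro equalityI subsetI)
  fix v assume "v \<in> tangent_space N d q"
  then have "chart_jac d c q *v v \<in> tangent_space N c q"
    by (rule tangent_space_transform_subset[OF c(2,1) q(2,1)])
  moreover have "v = chart_jac c d q *v (chart_jac d c q *v v)"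
    using chart_jac_inverse[OF c(2,1) q(2,1)] by (simp add: matrix_vector_mul_assoc)
  ultimately show "v \<in> (*v) (chart_jac c d q) ` tangent_space N c q" by blast
next
  fix v assume "v \<in> (*v) (chart_jac c d q) ` tangent_space N c q"
  then show "v \<in> tangent_space N d q" using tangent_space_transform_subset[OF assms] by blast
qed

section \<open>Integrable distributions are involutive\<close>

text \<open>With \<open>c\<close> a slice chart of the integral manifold, the transition map
  \<open>?s\<close> restricted to \<open>V\<close> parametrises it, and its derivative maps
  \<open>V\<close> onto the image of \<open>T\<close>. Differentiating this tangency expresses the
  derivative of \<open>T\<close> on tangent vectors by second derivatives of \<open>?s\<close>,
  which are symmetric.\<close>

lemma integrable_imp_involutive:
  assumes T: "tensor_field_1_1 A T"
    and TT: "\<And>c q. c \<in> A \<Longrightarrow> q \<in> cdom c \<Longrightarrow> TT c q = map_matrix complex_of_real (T c q)"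
    and proj: "\<And>c q. c \<in> A \<Longrightarrow> q \<in> cdom c \<Longrightarrow> T c q ** T c q = T c q"
    and int: "integrable_distribution A (image_distribution TT)"
    and d: "d \<in> A" "p \<in> cdom d"
  shows "involutive_at (T d p) (endo_deriv T d p)"
proof -
  have chd: "is_chart d" using chart d by blast
  obtain N where p: "p \<in> N" and N: "integral_manifold A (image_distribution TT) N"
    using int unfolding integrable_distribution_def by blast
  then obtain k where k: "embedded_submanifold A k N" by (auto simp: integral_manifold_def)
  obtain c V where c: "c \<in> A" "p \<in> cdom c" and V: "subspace V"
    and sl: "coord c ` (cdom c \<inter> N) = coord c ` cdom c \<inter> V"
    using k p unfolding embedded_submanifold_def by blast
  have chc: "is_chart c" using chart c by blast
  let ?S = "coord c ` (cdom c \<inter> cdom d)"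
  let ?s = "coord d \<circ> chart_inv c"
  let ?D = "\<lambda>z. frechet_derivative ?s (at z)"
  have S: "open ?S" by (rule open_overlap[OF c(1) d(1)])
  have sm: "smooth_on ?S ?s" by (rule smooth_transition[OF c(1) d(1)])
  define t where "t x = T d (chart_inv d x)" for x
  have range_T: "range ((*v) (T d q)) = (*v) (chart_jac c d q) ` V" if q: "q \<in> N" "q \<in> cdom c" "q \<in> cdom d" for q
  proof -
    have "complexify (range ((*v) (T d q))) = complexify (tangent_space N d q)"
      using N q d unfolding integral_manifold_def image_distribution_def range_map_matrix_of_real[symmetric]
      by (simp add: TT)
    also have "tangent_space N d q = (*v) (chart_jac c d q) ` V"
      using tangent_space_transform[OF c(1) d(1) q(2,3)] tangent_space_slice[OF c(1) V sl q(1,2)] by simp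
    finally show ?thesis
      using subspace_0[OF V] matrix_vector_mult_0_right[of "T d q"] matrix_vector_mult_0_right[of "chart_jac c d q"]
      by (subst (asm) complexify_inject) (metis rangeI imageI)+
  qed
  have jac: "?D (coord c q) v = chart_jac c d q *v v" if "q \<in> cdom c" "q \<in> cdom d" for q v
    using frechet_derivative_at[OF transition_has_derivative[OF c(1) d(1) that]] by metis
  have fix_V: "t (?s z) *v ?D z v = ?D z v" if z: "z \<in> ?S" "z \<in> V" and v: "v \<in> V" for z v
  proof -
    obtain q where q: "q \<in> cdom c" "q \<in> cdom d" "z = coord c q" using z by auto
    have "q \<in> N" using mem_slice_iff[OF chc sl q(1)] z(2) q(3) by simp
    then obtain u where u: "?D z v = T d q *v u"
      using range_T[of q] q v jac[OF q(1,2)] by (metis imageI imageE)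
    have "t (?s z) = T d q" using q by (simp add: t_def chart_inv_coord[OF chc] chart_inv_coord[OF chd])
    then show ?thesis unfolding u using proj[OF d(1) q(2)] by (simp add: matrix_vector_mul_assoc)
  qed
  let ?z = "coord c p"
  have z: "?z \<in> ?S" "?z \<in> V" using c d p sl by auto
  have sz: "?s ?z = coord d p" by (simp add: chart_inv_coord[OF chc c(2)])
  have tp: "t (coord d p) = T d p" by (simp add: t_def chart_inv_coord[OF chd d(2)])
  have dt: "(t has_derivative endo_deriv T d p) (at (?s ?z))"
    unfolding sz using endo_has_derivative[OF T d] by (simp add: t_def[abs_def])
  define H where "H v w = frechet_derivative (\<lambda>z. ?D z v) (at ?z) w" for v w
  \<comment> \<open>\<open>fix_V\<close> holds only at points of \<open>V\<close>, so it is
    differentiated along a straight line in \<open>V\<close>, where the difference \<open>?g\<close>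
    is constantly zero.\<close>
  have key: "endo_deriv T d p (?D ?z w) *v ?D ?z v = H v w - T d p *v H v w" if v: "v \<in> V" and w: "w \<in> V" for v w
  proof -
    let ?g = "\<lambda>z. t (?s z) *v ?D z v - ?D z v"
    have ds: "(?s has_derivative ?D ?z) (at ?z)" by (rule smooth_on_has_derivative[OF sm z(1)])
    have dD: "((\<lambda>z. ?D z v) has_derivative H v) (at ?z)"
      unfolding H_def by (rule smooth_on_has_derivative[OF smooth_on_frechet_derivative[OF sm] z(1)])
    have dts: "((\<lambda>z. t (?s z)) has_derivative (\<lambda>w. endo_deriv T d p (?D ?z w))) (at ?z)"
      using diff_chain_at[OF ds dt] by (simp add: o_def)
    have dg: "(?g has_derivative (\<lambda>w. (t (?s ?z) *v H v w + endo_deriv T d p (?D ?z w) *v ?D ?z v) - H v w)) (at ?z)"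
      by (rule has_derivative_diff[OF bounded_bilinear.FDERIV[OF bounded_bilinear_matrix_vector_mult dts dD] dD])
    have dl: "((\<lambda>s. ?z + s *\<^sub>R w) has_vector_derivative w) (at (0::real))"
      by (auto intro!: derivative_eq_intros simp: has_vector_derivative_def)
    have "continuous_on UNIV (\<lambda>s::real. ?z + s *\<^sub>R w)" by (intro continuous_intros)
    then have "open ((\<lambda>s::real. ?z + s *\<^sub>R w) -` ?S)" by (rule open_vimage[OF S])
    moreover have "0 \<in> (\<lambda>s::real. ?z + s *\<^sub>R w) -` ?S" using z(1) by simp
    ultimately obtain e where e: "e > 0" "ball 0 e \<subseteq> (\<lambda>s::real. ?z + s *\<^sub>R w) -` ?S"
      by (rule openE)
    have "((?g \<circ> (\<lambda>s. ?z + s *\<^sub>R w)) has_vector_derivative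
        ((t (?s ?z) *v H v w + endo_deriv T d p (?D ?z w) *v ?D ?z v) - H v w)) (at 0)"
      by (rule vector_derivative_diff_chain_within[OF dl])
        (rule has_derivative_at_withinI, use dg in \<open>simp only: scaleR_zero_left add_0_right\<close>)
    moreover have "((?g \<circ> (\<lambda>s. ?z + s *\<^sub>R w)) has_vector_derivative 0) (at 0)"
    proof (rule has_vector_derivative_transform_within_open[OF has_vector_derivative_const open_ball])
      fix s :: real assume "s \<in> ball 0 e"
      then have "?z + s *\<^sub>R w \<in> ?S" using e(2) by blast
      moreover have "?z + s *\<^sub>R w \<in> V" using V z(2) w by (intro subspace_add subspace_scale)
      ultimately show "0 = (?g \<circ> (\<lambda>s. ?z + s *\<^sub>R w)) s" using fix_V v by (simp del: o_apply add: o_apply[of ?g])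
    qed (use e in simp)
    ultimately have "(t (?s ?z) *v H v w + endo_deriv T d p (?D ?z w) *v ?D ?z v) - H v w = 0"
      using vector_derivative_unique_at by blast
    then show ?thesis unfolding sz tp by (simp add: algebra_simps)
  qed
  have sym: "H v w = H w v" for v w
    unfolding H_def by (rule second_derivative_symmetric[OF S z(1) sm])
  have comm: "endo_deriv T d p a *v b = endo_deriv T d p b *v a"
    if ab: "a \<in> range ((*v) (T d p))" "b \<in> range ((*v) (T d p))" for a b
  proof -
    have "range ((*v) (T d p)) = ?D ?z ` V"
      using range_T[OF p c(2) d(2)] jac[OF c(2) d(2)] by (metis (mono_tags, lifting) image_cong)
    then obtain v w where vw: "v \<in> V" "w \<in> V" "a = ?D ?z w" "b = ?D ?z v" using ab by blast
    show ?thesis unfolding vw key[OF vw(1,2)] key[OF vw(2,1)] sym[of v w] ..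
  qed
  \<comment> \<open>The derivative of \<open>T = TT\<close>. By it, the component of the bracket
    outside the image of \<open>T\<close> is the antisymmetric part of the derivative on the image,
    which \<open>comm\<close> kills.\<close>
  have d3: "endo_deriv T d p v *v (T d p *v b) = endo_deriv T d p v *v b - T d p *v (endo_deriv T d p v *v b)" for v b
  proof -
    have "endo_deriv T d p v *v b = (endo_deriv T d p v ** T d p + T d p ** endo_deriv T d p v) *v b"
      using endo_deriv_mult[OF T T T d] proj[OF d(1)] by metis
    also have "\<dots> = endo_deriv T d p v *v (T d p *v b) + T d p *v (endo_deriv T d p v *v b)"
      by (simp add: matrix_vector_mult_add_rdistrib matrix_vector_mul_assoc)
    finally show ?thesis by (metis add_diff_cancel_right')
  qed
  show ?thesis
    unfolding involutive_at_def
  proof (intro allI)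
    fix a b
    have "endo_deriv T d p (T d p *v a) *v (T d p *v b) = endo_deriv T d p (T d p *v b) *v (T d p *v a)"
      by (rule comm) auto
    then show "T d p *v (endo_deriv T d p (T d p *v a) *v b - endo_deriv T d p (T d p *v b) *v a)
        = endo_deriv T d p (T d p *v a) *v b - endo_deriv T d p (T d p *v b) *v a"
      unfolding d3 matrix_vector_mult_diff_distrib by (simp add: algebra_simps)
  qed
qed

end

section \<open>Involutive distributions are integrable\<close>

context manifold_atlas
begin

text \<open>A diffeomorphic change of coordinates on an open part of a chart stays in the atlas, by
  maximality. This supplies the slice charts of the leaves.\<close>

lemma chart_composition:
  assumes d: "d \<in> A" and W: "open W" "W \<subseteq> coord d ` cdom d"
    and \<phi>: "smooth_on W \<phi>" and \<psi>: "smooth_on (\<phi> ` W) \<psi>" and op: "open (\<phi> ` W)"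
    and inv: "\<And>x. x \<in> W \<Longrightarrow> \<psi> (\<phi> x) = x"
  obtains c where "c \<in> A" "cdom c = {q \<in> cdom d. coord d q \<in> W}" "coord c = \<phi> \<circ> coord d"
    "coord c ` cdom c = \<phi> ` W"
    "\<And>z. z \<in> \<phi> ` W \<Longrightarrow> chart_inv c z = chart_inv d (\<psi> z)"
proof -
  have chd: "is_chart d" using chart d by blast
  define D where "D = {q \<in> cdom d. coord d q \<in> W}"
  define c where "c = Chart D (\<phi> \<circ> coord d)"
  have c: "cdom c = D" "coord c = \<phi> \<circ> coord d" by (simp_all add: c_def)
  have dW: "coord d (chart_inv d x) = x" "chart_inv d x \<in> D" if "x \<in> W" for x
  proof -
    have "x \<in> coord d ` cdom d" using W(2) that by blast
    then show "coord d (chart_inv d x) = x" "chart_inv d x \<in> D"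
      using coord_chart_inv[OF chd, of x] that by (simp_all add: D_def)
  qed
  have Dd: "q \<in> cdom d" "coord d q \<in> W" if "q \<in> D" for q using that by (simp_all add: D_def)
  have im: "coord c ` cdom c = \<phi> ` W"
  proof (intro equalityI subsetI)
    fix z assume "z \<in> coord c ` cdom c"
    then obtain q where "q \<in> D" "z = \<phi> (coord d q)" by (auto simp: c)
    then show "z \<in> \<phi> ` W" using Dd by blast
  next
    fix z assume "z \<in> \<phi> ` W"
    then obtain x where x: "x \<in> W" "z = \<phi> x" by blast
    then have "z = coord c (chart_inv d x)" by (simp add: c dW)
    then show "z \<in> coord c ` cdom c" using dW(2)[OF x(1)] c(1) by blast
  qed
  have inv': "chart_inv d (\<psi> (coord c q)) = q" if "q \<in> D" for q
    using Dd[OF that] by (simp add: c inv chart_inv_coord[OF chd])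
  have inj: "inj_on (coord c) D" by (rule inj_on_inverseI[of _ "\<lambda>z. chart_inv d (\<psi> z)"]) (rule inv')
  have ci: "chart_inv c z = chart_inv d (\<psi> z)" if "z \<in> \<phi> ` W" for z
  proof -
    have "z \<in> coord c ` D" using that im c(1) by simp
    then obtain q where q: "q \<in> D" "z = coord c q" by blast
    have "chart_inv c z = q" unfolding chart_inv_def c(1) q(2) by (rule inv_into_f_f[OF inj q(1)])
    then show ?thesis using inv'[OF q(1)] q(2) by simp
  qed
  have Dalt: "D = cdom d \<inter> coord d -` W" by (auto simp: D_def)
  have oD: "open D"
    unfolding Dalt using chd by (intro continuous_open_preimage continuous_on_coord W) (simp_all add: is_chart_def)
  have contc: "continuous_on D (coord c)"
    unfolding c(2) by (intro continuous_on_compose continuous_on_subset[OF continuous_on_coord[OF chd]]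
        continuous_on_subset[OF smooth_on_imp_continuous_on[OF \<phi>]]) (auto simp: D_def)
  have \<psi>W: "\<psi> ` \<phi> ` W \<subseteq> W" using inv by auto
  have "continuous_on (\<phi> ` W) (chart_inv d \<circ> \<psi>)"
    by (intro continuous_on_compose smooth_on_imp_continuous_on[OF \<psi>]
        continuous_on_subset[OF continuous_on_chart_inv[OF chd]] order_trans[OF \<psi>W W(2)])
  then have contci: "continuous_on (\<phi> ` W) (chart_inv c)"
    by (rule continuous_on_eq) (simp add: ci)
  have imD: "chart_inv c ` \<phi> ` W = D"
  proof (intro equalityI subsetI)
    fix q assume "q \<in> chart_inv c ` \<phi> ` W"
    then obtain x where "x \<in> W" "q = chart_inv c (\<phi> x)" by blast
    then show "q \<in> D" using dW(2) by (simp add: ci inv)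
  next
    fix q assume q: "q \<in> D"
    then have "coord c q \<in> \<phi> ` W" using im c(1) by blast
    then show "q \<in> chart_inv c ` \<phi> ` W" using ci inv'[OF q] by (metis imageI)
  qed
  have "homeomorphism D (\<phi> ` W) (coord c) (chart_inv c)"
  proof (rule homeomorphismI[OF contc contci])
    show "coord c ` D \<subseteq> \<phi> ` W" using im c(1) by simp
    show "chart_inv c ` \<phi> ` W \<subseteq> D" using imD by simp
    show "chart_inv c (coord c q) = q" if "q \<in> D" for q
    proof -
      have "coord c q \<in> \<phi> ` W" using im c(1) that by blast
      then show ?thesis by (simp add: ci inv'[OF that])
    qed
    show "coord c (chart_inv c z) = z" if z: "z \<in> \<phi> ` W" for z
    proof -
      obtain x where "x \<in> W" "z = \<phi> x" using z by blast
      then show ?thesis by (simp add: ci c dW inv)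
    qed
  qed
  then have chc: "is_chart c" using oD op im by (simp add: is_chart_def c(1))
  have "compatible c e" if e: "e \<in> A" for e
    unfolding compatible_def
  proof
    have che: "is_chart e" using chart e by blast
    let ?S = "coord c ` (cdom c \<inter> cdom e)"
    have S: "open ?S" using che by (intro open_coord_image[OF chc]) (simp add: is_chart_def)
    have SW: "?S \<subseteq> \<phi> ` W" using im by blast
    have sub: "\<psi> ` ?S \<subseteq> coord d ` (cdom d \<inter> cdom e)"
    proof (intro image_subsetI)
      fix z assume "z \<in> ?S"
      then obtain q where q: "q \<in> D" "q \<in> cdom e" "z = coord c q" using c(1) by blast
      have "\<psi> z = coord d q" using Dd[OF q(1)] q(3) by (simp add: c inv)
      then show "\<psi> z \<in> coord d ` (cdom d \<inter> cdom e)" using Dd[OF q(1)] q(2) by blast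
    qed
    have "smooth_on ?S (\<lambda>z. (coord e \<circ> chart_inv d) (\<psi> z))"
      by (rule smooth_on_compose[OF smooth_transition[OF d e] smooth_on_subset[OF \<psi> SW] S sub])
    then show "smooth_on ?S (coord e \<circ> chart_inv c)"
      by (rule smooth_on_cong[OF _ S]) (use ci SW in \<open>simp add: subset_iff\<close>)
    let ?U = "coord e ` (cdom c \<inter> cdom e)"
    have Ueq: "?U = coord e ` (cdom e \<inter> D)" by (simp add: c Int_commute)
    have U: "open ?U" unfolding Ueq by (rule open_coord_image[OF che oD])
    have sub1: "?U \<subseteq> coord e ` (cdom e \<inter> cdom d)" unfolding Ueq using Dd by blast
    have sub2: "(coord d \<circ> chart_inv e) ` ?U \<subseteq> W"
      unfolding Ueq using Dd by (auto simp: chart_inv_coord[OF che])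
    have "smooth_on ?U (\<lambda>x. \<phi> ((coord d \<circ> chart_inv e) x))"
      by (rule smooth_on_compose[OF \<phi> smooth_on_subset[OF smooth_transition[OF e d] sub1] U sub2])
    then show "smooth_on ?U (coord c \<circ> chart_inv e)" by (simp add: c o_def)
  qed
  then have cA: "c \<in> A" by (rule maximal[OF chc])
  show ?thesis by (rule that[OF cA c(1)[unfolded D_def] c(2) im ci])
qed

end

section \<open>Leaves of an involutive projection field in coordinates\<close>

lemma complementary_projection:
  fixes P Q :: "real^'n^'n"
  assumes "P ** P = P" "Q = mat 1 - P"
  shows "P ** Q = 0" "Q ** P = 0" "Q ** Q = Q"
  by (simp_all add: assms bounded_bilinear.diff_left[OF bounded_bilinear_matrix_mult]
      bounded_bilinear.diff_right[OF bounded_bilinear_matrix_mult])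

text \<open>In a neighbourhood of \<open>x0\<close> the image of the projection \<open>t x\<close> is a graph over the image of
  \<open>P = t x0\<close>; \<open>B x\<close> is the projection onto the image of \<open>t x\<close> with kernel \<open>ker P\<close>.\<close>

lemma graph_projection:
  fixes t :: "real^'n \<Rightarrow> real^'n^'n"
  assumes U: "open U" "x0 \<in> U" and t: "smooth_on U t" and tt: "\<And>x. x \<in> U \<Longrightarrow> t x ** t x = t x"
  obtains S B where "open S" "x0 \<in> S" "S \<subseteq> U" "smooth_on S B"
    "\<And>x. x \<in> S \<Longrightarrow> t x ** B x = B x" "\<And>x. x \<in> S \<Longrightarrow> t x0 ** B x = t x0"
    "\<And>x. x \<in> S \<Longrightarrow> B x ** t x0 = B x" "\<And>x \<xi>. x \<in> S \<Longrightarrow> t x *v \<xi> = \<xi> \<Longrightarrow> B x *v \<xi> = \<xi>"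
proof -
  define P where "P = t x0"
  define Q where "Q = mat 1 - P"
  \<comment> \<open>\<open>J x\<close> is the compression of \<open>t x\<close> to the image of
    \<open>P\<close>, completed by the identity on the kernel; so invertibility of the compression
    becomes a condition on a determinant.\<close>
  define J where "J x = P ** t x ** P + Q" for x
  define B where "B x = t x ** P ** matrix_inv (J x) ** P" for x
  have PP: "P ** P = P" using tt U by (simp add: P_def)
  note Q = complementary_projection[OF PP Q_def]
  obtain k where k: "k > 0" "\<And>(M::real^'n^'n) v. norm (M *v v) \<le> norm M * norm v * k"
    using bounded_bilinear.pos_bounded[OF bounded_bilinear_matrix_vector_mult] by blast
  have J: "smooth_on U J"
    unfolding J_def by (intro smooth_on_add smooth_on_matrix_mult smooth_on_const t U)
  have J0: "J x0 = mat 1" using PP by (simp add: J_def P_def[symmetric] Q_def)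
  \<comment> \<open>Positivity of the first entry makes \<open>J x\<close> invertible and
    \<open>B\<close> smooth; positivity of the second makes the image of \<open>t x\<close> meet the
    kernel of \<open>P\<close> only in 0.\<close>
  let ?g = "\<lambda>x. min \<bar>det (J x)\<bar> (1 / k - norm (t x - P))"
  have cg: "continuous_on U ?g"
    by (intro continuous_intros smooth_on_imp_continuous_on[OF smooth_on_det[OF J U(1)]]
        smooth_on_imp_continuous_on[OF t])
  define S where "S = U \<inter> ?g -` {0<..}"
  have oS: "open S" unfolding S_def by (rule continuous_open_preimage[OF cg U(1)]) simp
  have x0S: "x0 \<in> S" using U k by (simp add: S_def J0 P_def)
  have SU: "S \<subseteq> U" by (simp add: S_def)
  have inv: "invertible (J x)" if "x \<in> S" for x using that by (simp add: S_def invertible_det_nz)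
  have sB: "smooth_on S B"
    unfolding B_def
    by (intro smooth_on_matrix_mult oS smooth_on_const smooth_on_subset[OF t SU]
        smooth_on_matrix_inv[OF smooth_on_subset[OF J SU] oS inv])
  have tB: "t x ** B x = B x" if "x \<in> S" for x
    using tt[OF subsetD[OF SU that]] by (simp add: B_def matrix_mul_assoc)
  have PB: "P ** B x = P" if x: "x \<in> S" for x
  proof -
    have "Q ** J x = Q" by (simp add: J_def bounded_bilinear.add_right[OF bounded_bilinear_matrix_mult] matrix_mul_assoc Q
          bounded_bilinear.zero_left[OF bounded_bilinear_matrix_mult])
    then have QI: "Q ** matrix_inv (J x) = Q"
      using matrix_inv_works(1)[OF inv[OF x]] by (metis matrix_mul_assoc matrix_mul_rid)
    have "P ** t x ** P = J x - Q" by (simp add: J_def)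
    then have "P ** B x = (J x - Q) ** matrix_inv (J x) ** P"
      by (simp add: B_def matrix_mul_assoc)
    also have "\<dots> = P - Q ** P"
      by (simp add: bounded_bilinear.diff_left[OF bounded_bilinear_matrix_mult] matrix_inv_works(1)[OF inv[OF x]] QI)
    finally show ?thesis by (simp add: Q)
  qed
  have BP: "B x ** P = B x" for x
    by (simp add: B_def matrix_mul_assoc[symmetric] PP)
  have Bfix: "B x *v \<xi> = \<xi>" if x: "x \<in> S" and \<xi>: "t x *v \<xi> = \<xi>" for x \<xi>
  proof -
    \<comment> \<open>\<open>\<eta>\<close> lies in the image of \<open>t x\<close> and in the
      kernel of \<open>P\<close>, so it is fixed by \<open>t x - P\<close>, which strictly shrinks
      nonzero vectors.\<close>
    define \<eta> where "\<eta> = \<xi> - B x *v \<xi>"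
    have t\<eta>: "t x *v \<eta> = \<eta>"
      using \<xi> tB[OF x] by (simp add: \<eta>_def matrix_vector_mult_diff_distrib matrix_vector_mul_assoc)
    have P\<eta>: "P *v \<eta> = 0"
      using PB[OF x] by (simp add: \<eta>_def matrix_vector_mult_diff_distrib matrix_vector_mul_assoc)
    have "\<eta> = (t x - P) *v \<eta>" by (simp add: matrix_vector_mult_diff_rdistrib t\<eta> P\<eta>)
    then have le: "norm \<eta> \<le> (norm (t x - P) * k) * norm \<eta>"
      using k(2)[of "t x - P" \<eta>] by (simp add: mult_ac)
    have "norm (t x - P) < 1 / k" using x by (simp add: S_def)
    then have lt: "norm (t x - P) * k < 1" using k(1) by (simp add: field_simps)
    have "\<eta> = 0"
    proof (rule ccontr)
      assume "\<eta> \<noteq> 0"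
      then have "(norm (t x - P) * k) * norm \<eta> < 1 * norm \<eta>" using lt by (intro mult_strict_right_mono) auto
      then show False using le by simp
    qed
    then show ?thesis by (simp add: \<eta>_def)
  qed
  show ?thesis
    by (rule that[OF oS x0S SU sB tB PB[unfolded P_def] BP[unfolded P_def] Bfix])
qed

text \<open>The slopes \<open>B x\<close> solve the compatibility condition: the defect
  \<open>\<zeta>\<close> lies in the kernel of \<open>t x0\<close>, because
  \<open>t x0 ** B x\<close> is constant, and in the image of \<open>t x\<close> by involutivity,
  and these two meet only in 0. Since \<open>B x ** t x0 = B x\<close>, the solution has zero
  derivative along the kernel of \<open>t x0\<close>; its restriction to the image of
  \<open>t x0\<close> parametrises the leaf.\<close>

proposition involutive_leaf:
  fixes t :: "real^'n \<Rightarrow> real^'n^'n"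
  assumes U: "open U" "x0 \<in> U" and t: "smooth_on U t" and tt: "\<And>x. x \<in> U \<Longrightarrow> t x ** t x = t x"
    and inv: "\<And>x. x \<in> U \<Longrightarrow> involutive_at (t x) (frechet_derivative t (at x))"
  obtains r f B where "r > 0" "f 0 = x0" "smooth_on (ball 0 r) f"
    "\<And>u. u \<in> ball 0 r \<Longrightarrow> f u \<in> U"
    "\<And>u. u \<in> ball 0 r \<Longrightarrow> (f has_derivative (*v) (B u)) (at u)"
    "\<And>u. u \<in> ball 0 r \<Longrightarrow> t x0 ** B u = t x0"
    "\<And>u. u \<in> ball 0 r \<Longrightarrow> (*v) (B u) ` range ((*v) (t x0)) = range ((*v) (t (f u)))"
proof -
  obtain S B where S: "open S" "x0 \<in> S" "S \<subseteq> U" and B: "smooth_on S B"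
    and tB: "\<And>x. x \<in> S \<Longrightarrow> t x ** B x = B x" and PB: "\<And>x. x \<in> S \<Longrightarrow> t x0 ** B x = t x0"
    and BP: "\<And>x. x \<in> S \<Longrightarrow> B x ** t x0 = B x" and Bfix: "\<And>x \<xi>. x \<in> S \<Longrightarrow> t x *v \<xi> = \<xi> \<Longrightarrow> B x *v \<xi> = \<xi>"
    using graph_projection[OF U t tt] by blast
  have sym: "frechet_derivative B (at x) (B x *v u) *v v = frechet_derivative B (at x) (B x *v v) *v u"
    if x: "x \<in> S" for x u v
  proof -
    let ?DB = "frechet_derivative B (at x)" and ?Dt = "frechet_derivative t (at x)"
    have dB: "(B has_derivative ?DB) (at x)" by (rule smooth_on_has_derivative[OF B x])
    have xU: "x \<in> U" using x S by blast
    have dt: "(t has_derivative ?Dt) (at x)" by (rule smooth_on_has_derivative[OF t xU])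
    note mm = bounded_bilinear.FDERIV[OF bounded_bilinear_matrix_mult]
    have PDB: "t x0 ** ?DB w = 0" for w
    proof -
      have "((\<lambda>y. t x0 ** B y) has_derivative (\<lambda>w. t x0 ** ?DB w)) (at x)"
        by (rule bounded_linear.has_derivative[OF bounded_bilinear.bounded_linear_right[OF bounded_bilinear_matrix_mult] dB])
      moreover have "((\<lambda>y. t x0 ** B y) has_derivative (\<lambda>w. 0)) (at x)"
        by (rule has_derivative_transform_within_open[OF has_derivative_const S(1) x]) (simp add: PB)
      ultimately have "(\<lambda>w. t x0 ** ?DB w) = (\<lambda>w. 0)" by (rule has_derivative_unique)
      then show ?thesis by meson
    qed
    have tDB: "?DB w = t x ** ?DB w + ?Dt w ** B x" for w
    proof -
      have "(B has_derivative (\<lambda>w. t x ** ?DB w + ?Dt w ** B x)) (at x)"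
        by (rule has_derivative_transform_within_open[OF mm[OF dt dB] S(1) x]) (simp add: tB)
      then have "?DB = (\<lambda>w. t x ** ?DB w + ?Dt w ** B x)" using has_derivative_unique[OF dB] by blast
      then show ?thesis by meson
    qed
    have tDt: "?Dt w = t x ** ?Dt w + ?Dt w ** t x" for w
    proof -
      have "(t has_derivative (\<lambda>w. t x ** ?Dt w + ?Dt w ** t x)) (at x)"
        by (rule has_derivative_transform_within_open[OF mm[OF dt dt] U(1) xU]) (simp add: tt)
      then have "?Dt = (\<lambda>w. t x ** ?Dt w + ?Dt w ** t x)" using has_derivative_unique[OF dt] by blast
      then show ?thesis by meson
    qed
    define a b where "a = B x *v u" and "b = B x *v v"
    have ta: "t x *v a = a" "t x *v b = b" using tB[OF x] by (simp_all add: a_def b_def matrix_vector_mul_assoc)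
    have e1: "t x *v (?Dt w *v y) = ?Dt w *v y - ?Dt w *v (t x *v y)" for w y
    proof -
      have "?Dt w *v y = t x *v (?Dt w *v y) + ?Dt w *v (t x *v y)"
        by (subst tDt) (simp add: matrix_vector_mult_add_rdistrib matrix_vector_mul_assoc)
      then show ?thesis by (metis add_diff_cancel_right')
    qed
    have "t x *v (?Dt a *v b - ?Dt b *v a) = ?Dt a *v b - ?Dt b *v a"
      using inv[OF xU] ta unfolding involutive_at_def by metis
    then have Dtab: "?Dt a *v b = ?Dt b *v a"
      by (simp add: matrix_vector_mult_diff_distrib e1 ta)
    define \<zeta> where "\<zeta> = ?DB a *v v - ?DB b *v u"
    have e2: "?DB w *v y = t x *v (?DB w *v y) + ?Dt w *v (B x *v y)" for w y
      by (subst tDB) (simp add: matrix_vector_mult_add_rdistrib matrix_vector_mul_assoc)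
    have "\<zeta> = t x *v \<zeta> + (?Dt a *v b - ?Dt b *v a)"
      unfolding \<zeta>_def matrix_vector_mult_diff_distrib a_def[symmetric] b_def[symmetric]
      using e2[of a v] e2[of b u] unfolding a_def[symmetric] b_def[symmetric] by (metis add_diff_add)
    then have "t x *v \<zeta> = \<zeta>" by (simp add: Dtab)
    then have "\<zeta> = B x *v \<zeta>" using Bfix[OF x] by simp
    also have "\<dots> = B x *v (t x0 *v \<zeta>)" using BP[OF x] by (simp add: matrix_vector_mul_assoc)
    also have "t x0 *v \<zeta> = 0"
      using PDB by (simp add: \<zeta>_def matrix_vector_mult_diff_distrib matrix_vector_mul_assoc)
    finally show ?thesis by (simp add: \<zeta>_def a_def b_def)
  qed
  obtain r f where f: "r > 0" "f 0 = x0" "smooth_on (ball 0 r) f"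
    "\<And>u. u \<in> ball 0 r \<Longrightarrow> f u \<in> S"
    "\<And>u. u \<in> ball 0 r \<Longrightarrow> (f has_derivative (*v) (B (f u))) (at u)"
    using total_differential_equation_smooth_solution[OF S(1,2) B sym] by blast
  have rng: "(*v) (B x) ` range ((*v) (t x0)) = range ((*v) (t x))" if x: "x \<in> S" for x
  proof (intro equalityI subsetI)
    fix \<xi> assume "\<xi> \<in> (*v) (B x) ` range ((*v) (t x0))"
    then obtain y where "\<xi> = B x *v y" by blast
    then have "\<xi> = t x *v \<xi>" using tB[OF x] by (simp add: matrix_vector_mul_assoc)
    then show "\<xi> \<in> range ((*v) (t x))" by blast
  next
    fix \<xi> assume "\<xi> \<in> range ((*v) (t x))"
    then have "t x *v \<xi> = \<xi>" using tt[of x] x S by (auto simp: matrix_vector_mul_assoc)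
    then have "\<xi> = B x *v (t x0 *v \<xi>)" using Bfix[OF x] BP[OF x] by (simp add: matrix_vector_mul_assoc)
    then show "\<xi> \<in> (*v) (B x) ` range ((*v) (t x0))" by blast
  qed
  show ?thesis
    by (rule that[OF f(1-3) _ f(5)]) (use f(4) S PB rng in blast)+
qed

section \<open>Straightening the leaves\<close>

context manifold_atlas
begin

text \<open>The leaf through \<open>p\<close> is made a slice by the new coordinates
  \<open>\<phi>\<close>; its tangent spaces are found in the chart \<open>d\<close> and carried to
  the other charts by the transformation law of \<open>T\<close>.\<close>

lemma involutive_imp_integrable:
  assumes T: "tensor_field_1_1 A T"
    and TT: "\<And>c q. c \<in> A \<Longrightarrow> q \<in> cdom c \<Longrightarrow> TT c q = map_matrix complex_of_real (T c q)"
    and proj: "\<And>c q. c \<in> A \<Longrightarrow> q \<in> cdom c \<Longrightarrow> T c q ** T c q = T c q"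
    and inv: "\<And>c q. c \<in> A \<Longrightarrow> q \<in> cdom c \<Longrightarrow> involutive_at (T c q) (endo_deriv T c q)"
  shows "integrable_distribution A (image_distribution TT)"
  unfolding integrable_distribution_def
proof
  fix p
  obtain d where d: "d \<in> A" "p \<in> cdom d" by (rule chart_at)
  have chd: "is_chart d" using chart d by blast
  let ?U = "coord d ` cdom d"
  have U: "open ?U" using chd by (simp add: is_chart_def)
  define x0 where "x0 = coord d p"
  have x0: "x0 \<in> ?U" using d by (simp add: x0_def)
  define t where "t x = T d (chart_inv d x)" for x
  have st: "smooth_on ?U t" unfolding t_def[abs_def] by (rule tensor_field_smooth[OF T d(1)])
  have tT: "t (coord d q) = T d q" if "q \<in> cdom d" for q by (simp add: t_def chart_inv_coord[OF chd that])
  have tt: "t x ** t x = t x" if "x \<in> ?U" for x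
    unfolding t_def by (rule proj[OF d(1) coord_chart_inv(2)[OF chd that]])
  have invt: "involutive_at (t x) (frechet_derivative t (at x))" if x: "x \<in> ?U" for x
    using inv[OF d(1) coord_chart_inv(2)[OF chd x]]
    by (simp add: endo_deriv_def coord_chart_inv(1)[OF chd x] t_def[abs_def])
  obtain r f B where r: "r > 0" and f0: "f 0 = x0" and sf: "smooth_on (ball 0 r) f"
    and fU: "\<And>u. u \<in> ball 0 r \<Longrightarrow> f u \<in> ?U"
    and df: "\<And>u. u \<in> ball 0 r \<Longrightarrow> (f has_derivative (*v) (B u)) (at u)"
    and PB: "\<And>u. u \<in> ball 0 r \<Longrightarrow> t x0 ** B u = t x0"
    and rng: "\<And>u. u \<in> ball 0 r \<Longrightarrow> (*v) (B u) ` range ((*v) (t x0)) = range ((*v) (t (f u)))"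
    using involutive_leaf[OF U x0 st tt invt] by blast
  define P where "P = t x0"
  have PP: "P *v (P *v y) = P *v y" for y by (simp add: P_def matrix_vector_mul_assoc tt[OF x0])
  have Pdiff: "P *v (y - z) = P *v y - P *v z" "P *v (y + z) = P *v y + P *v z" for y z
    by (simp_all add: matrix_vector_mult_diff_distrib matrix_vector_right_distrib)
  \<comment> \<open>The derivative of \<open>P *v f u - P *v u\<close> vanishes, so the leaf is a
    graph over the image of \<open>P\<close>. This is what makes \<open>\<phi>\<close> and
    \<open>\<psi>\<close> inverse to each other.\<close>
  have Pf: "P *v f u = P *v x0 + P *v u" if u: "u \<in> ball 0 r" for u
  proof -
    have "\<exists>k. \<forall>u\<in>ball 0 r. P *v f u - P *v u = k"
    proof (rule has_derivative_zero_constant[OF convex_ball])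
      fix u :: "real^'n" assume u: "u \<in> ball 0 r"
      have "((\<lambda>u. P *v f u - P *v u) has_derivative (\<lambda>v. P *v (B u *v v) - P *v v)) (at u)"
        by (intro has_derivative_diff bounded_linear.has_derivative[OF matrix_vector_mul_bounded_linear]
            df[OF u] has_derivative_ident)
      moreover have "P *v (B u *v v) - P *v v = 0" for v
        using PB[OF u] by (simp add: P_def matrix_vector_mul_assoc)
      ultimately show "((\<lambda>u. P *v f u - P *v u) has_derivative (\<lambda>v. 0)) (at u within ball 0 r)"
        by (simp add: has_derivative_at_withinI)
    qed
    then obtain k where k: "\<And>u. u \<in> ball 0 r \<Longrightarrow> P *v f u - P *v u = k" by blast
    have "k = P *v x0" using k[of 0] r f0 by simp
    then show ?thesis using k[OF u] by (simp add: algebra_simps)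
  qed
  \<comment> \<open>A shear along the kernel of \<open>P\<close>, up to translation: it subtracts
    the leaf point over \<open>P *v (x - x0)\<close> and adds the base point back. The leaf goes to
    the image of \<open>P\<close>, and on that image \<open>\<psi>\<close> is
    \<open>f\<close>.\<close>
  define \<phi> where "\<phi> x = x - f (P *v (x - x0)) + P *v (x - x0)" for x
  define \<psi> where "\<psi> z = z + f (P *v z) - P *v z" for z
  define W where "W = {x \<in> ?U. P *v (x - x0) \<in> ball 0 r}"
  have WU: "W \<subseteq> ?U" by (auto simp: W_def)
  have oV: "open ((\<lambda>x. P *v (x - y)) -` ball 0 r)" for y
    by (intro open_vimage open_ball bounded_linear.continuous_on[OF matrix_vector_mul_bounded_linear] continuous_intros)
  have "W = ?U \<inter> (\<lambda>x. P *v (x - x0)) -` ball 0 r" by (auto simp: W_def)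
  then have oW: "open W" using U oV by (simp add: open_Int)
  have P\<phi>: "P *v \<phi> x = P *v (x - x0)" if "x \<in> W" for x
    using that Pf[of "P *v (x - x0)"] by (simp add: W_def \<phi>_def Pdiff PP)
  have \<psi>\<phi>: "\<psi> (\<phi> x) = x" if "x \<in> W" for x
    using P\<phi>[OF that] by (simp add: \<psi>_def) (simp add: \<phi>_def)
  \<comment> \<open>The natural domain of \<open>\<psi>\<close>; \<open>z - 0\<close> makes its
    openness an instance of \<open>oV\<close>.\<close>
  define Z where "Z = {z. P *v (z - 0) \<in> ball 0 r}"
  have oZ: "open Z" using oV[of 0] by (simp add: Z_def vimage_def)
  have P\<psi>: "P *v (\<psi> z - x0) = P *v z" if "z \<in> Z" for z
    using that Pf[of "P *v z"] by (simp add: Z_def \<psi>_def Pdiff PP)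
  have \<phi>\<psi>: "\<phi> (\<psi> z) = z" if "z \<in> Z" for z
    using P\<psi>[OF that] by (simp add: \<phi>_def) (simp add: \<psi>_def)
  have s\<psi>: "smooth_on Z \<psi>"
    unfolding \<psi>_def[abs_def]
    by (intro smooth_on_diff smooth_on_add smooth_on_id oZ smooth_on_matrix_vector_mult smooth_on_const
        smooth_on_compose[OF sf]) (auto simp: Z_def)
  have s\<phi>: "smooth_on W \<phi>"
    unfolding \<phi>_def[abs_def]
    by (intro smooth_on_diff smooth_on_add smooth_on_id oW smooth_on_matrix_vector_mult smooth_on_const
        smooth_on_compose[OF sf]) (auto simp: W_def)
  have im: "\<phi> ` W = Z \<inter> \<psi> -` ?U"
  proof (intro equalityI subsetI)
    fix z assume "z \<in> \<phi> ` W"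
    then obtain x where x: "x \<in> W" "z = \<phi> x" by blast
    then show "z \<in> Z \<inter> \<psi> -` ?U" using P\<phi>[OF x(1)] \<psi>\<phi>[OF x(1)] by (simp add: Z_def W_def)
  next
    fix z assume z: "z \<in> Z \<inter> \<psi> -` ?U"
    then have "\<psi> z \<in> W" using P\<psi>[of z] by (simp add: W_def) (simp add: Z_def)
    then show "z \<in> \<phi> ` W" using \<phi>\<psi>[of z] z by (metis IntD1 imageI)
  qed
  have oim: "open (\<phi> ` W)"
    unfolding im by (rule continuous_open_preimage[OF smooth_on_imp_continuous_on[OF s\<psi>] oZ U])
  have s\<psi>': "smooth_on (\<phi> ` W) \<psi>" by (rule smooth_on_subset[OF s\<psi>]) (simp add: im)
  obtain c where c: "c \<in> A" and cd: "cdom c = {q \<in> cdom d. coord d q \<in> W}" and cc: "coord c = \<phi> \<circ> coord d"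
    and cim: "coord c ` cdom c = \<phi> ` W" and ci: "\<And>z. z \<in> \<phi> ` W \<Longrightarrow> chart_inv c z = chart_inv d (\<psi> z)"
    using chart_composition[OF d(1) oW WU s\<phi> s\<psi>' oim \<psi>\<phi>] by blast
  have chc: "is_chart c" using chart c by blast
  define V where "V = range ((*v) P)"
  have V: "subspace V" unfolding V_def by (intro linear_subspace_image matrix_vector_mul_linear subspace_UNIV)
  have PV: "P *v v = v" if "v \<in> V" for v using that PP by (auto simp: V_def)
  define N where "N = {q \<in> cdom c. coord c q \<in> V}"
  have sl: "coord c ` (cdom c \<inter> N) = coord c ` cdom c \<inter> V" by (auto simp: N_def)
  have emb: "embedded_submanifold A (dim V) N"
    unfolding embedded_submanifold_def using c V sl by (auto simp: N_def)
  have jac: "(*v) (chart_jac c d q) ` V = range ((*v) (T d q))" if q: "q \<in> N" for q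
  proof -
    have qc: "q \<in> cdom c" "coord c q \<in> V" using q by (auto simp: N_def)
    then have qd: "q \<in> cdom d" "coord d q \<in> W" by (auto simp: cd)
    let ?z = "coord c q"
    have z: "?z \<in> \<phi> ` W" using cim qc by blast
    then have zZ: "?z \<in> Z" using im by blast
    have Pz: "P *v ?z = ?z" using PV qc by blast
    then have zb: "?z \<in> ball 0 r" using zZ by (simp add: Z_def)
    have fz: "f ?z = coord d q"
      using \<psi>\<phi>[OF qd(2)] Pz by (simp add: cc \<psi>_def)
    \<comment> \<open>On \<open>V\<close>, where \<open>P\<close> is the identity, the outer terms
      cancel and only \<open>B ?z\<close> remains, which maps \<open>V\<close> onto the image of
      \<open>t\<close> at the leaf point.\<close>
    have "(\<psi> has_derivative (\<lambda>v. v + B (P *v ?z) *v (P *v v) - P *v v)) (at ?z)"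
    proof -
      have l: "((*v) P has_derivative (*v) P) (at ?z)"
        by (rule bounded_linear_imp_has_derivative[OF matrix_vector_mul_bounded_linear])
      have "(f has_derivative (*v) (B (P *v ?z))) (at (P *v ?z))" using df zb Pz by simp
      from diff_chain_at[OF l this] have "((\<lambda>z. f (P *v z)) has_derivative (\<lambda>v. B (P *v ?z) *v (P *v v))) (at ?z)"
        by (simp add: o_def)
      then show ?thesis unfolding \<psi>_def[abs_def]
        by (intro has_derivative_diff has_derivative_add has_derivative_ident l)
    qed
    then have "(\<psi> has_derivative (\<lambda>v. v + B ?z *v (P *v v) - P *v v)) (at ?z)" by (simp only: Pz)
    moreover have "(\<psi> has_derivative (*v) (chart_jac c d q)) (at ?z)"
    proof (rule has_derivative_transform_within_open[OF transition_has_derivative[OF c d(1) qc(1) qd(1)] oim z])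
      fix y assume y: "y \<in> \<phi> ` W"
      then have "\<psi> y \<in> ?U" using im by blast
      then show "(coord d \<circ> chart_inv c) y = \<psi> y" using ci[OF y] coord_chart_inv(1)[OF chd] by simp
    qed
    ultimately have e: "(*v) (chart_jac c d q) = (\<lambda>v. v + B ?z *v (P *v v) - P *v v)"
      using has_derivative_unique by blast
    have "chart_jac c d q *v v = B ?z *v v" if "v \<in> V" for v
      using fun_cong[OF e, of v] PV[OF that] by simp
    then have "(*v) (chart_jac c d q) ` V = (*v) (B ?z) ` V" by (intro image_cong) auto
    also have "\<dots> = range ((*v) (T d q))"
      using rng[OF zb] by (simp add: V_def P_def fz tT[OF qd(1)])
    finally show ?thesis .
  qed
  have tan: "image_distribution TT e q = complexify (tangent_space N e q)"
    if e: "e \<in> A" and q: "q \<in> N" "q \<in> cdom e" for e q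
  proof -
    have qc: "q \<in> cdom c" "q \<in> cdom d" using q by (auto simp: N_def cd)
    have "tangent_space N e q = (*v) (chart_jac c e q) ` V"
      using tangent_space_transform[OF c e qc(1) q(2)] tangent_space_slice[OF c V sl q(1) qc(1)] by simp
    also have "chart_jac c e q = chart_jac d e q ** chart_jac c d q"
      using chart_jac_cocycle[OF c d(1) e qc q(2)] by simp
    also have "(*v) (chart_jac d e q ** chart_jac c d q) ` V = (*v) (chart_jac d e q) ` range ((*v) (T d q))"
      unfolding jac[OF q(1), symmetric] image_image by (simp add: matrix_vector_mul_assoc)
    also have "\<dots> = range ((*v) (T e q))"
    proof (intro equalityI subsetI)
      fix y assume "y \<in> (*v) (chart_jac d e q) ` range ((*v) (T d q))"
      then obtain v where v: "y = (chart_jac d e q ** T d q) *v v" by (auto simp: matrix_vector_mul_assoc)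
      have "chart_jac d e q ** T d q = T e q ** chart_jac d e q"
        unfolding tensor_field_transform[OF T d(1) e qc(2) q(2)] matrix_mul_assoc[symmetric]
          chart_jac_inverse[OF d(1) e qc(2) q(2)] by simp
      then show "y \<in> range ((*v) (T e q))" unfolding v by (simp add: matrix_vector_mul_assoc[symmetric])
    next
      fix y assume "y \<in> range ((*v) (T e q))"
      then obtain v where "y = T e q *v v" by blast
      also have "\<dots> = chart_jac d e q *v (T d q *v (chart_jac e d q *v v))"
        unfolding tensor_field_transform[OF T d(1) e qc(2) q(2)] by (simp add: matrix_vector_mul_assoc matrix_mul_assoc)
      finally show "y \<in> (*v) (chart_jac d e q) ` range ((*v) (T d q))" by blast
    qed
    finally show ?thesis
      unfolding image_distribution_def TT[OF e q(2)] range_map_matrix_of_real by simp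
  qed
  have "\<phi> x0 = 0" using f0 by (simp add: \<phi>_def)
  moreover have "x0 \<in> W" using x0 r by (simp add: W_def)
  ultimately have "p \<in> N" using subspace_0[OF V] d by (simp add: N_def cd cc x0_def)
  moreover have "integral_manifold A (image_distribution TT) N"
    unfolding integral_manifold_def using emb tan by blast
  ultimately show "\<exists>N. p \<in> N \<and> integral_manifold A (image_distribution TT) N" by blast
qed

end

section \<open>The equivalences\<close>

context F_structure
begin

lemma integrable_distributions_iff:
  "integrable_distribution A (image_distribution (l_op \<alpha> \<beta> K F)) \<and>
    integrable_distribution A (image_distribution (m_op \<alpha> \<beta> K F))
    \<longleftrightarrow> nijenhuis_vanishes A (l_op \<alpha> \<beta> K F)"
proof -
  have MM: "M c p ** M c p = M c p" if "c \<in> A" "p \<in> cdom c" for c p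
    using complementary_projection(3)[OF F_L_props(3)[OF that] M_def] .
  have "integrable_distribution A (image_distribution (l_op \<alpha> \<beta> K F)) \<longleftrightarrow>
      (\<forall>c\<in>A. \<forall>p\<in>cdom c. involutive_at (L c p) (endo_deriv L c p))"
    using involutive_imp_integrable[OF L_tensor F_L_props(5,3)]
      integrable_imp_involutive[OF L_tensor F_L_props(5,3)] by blast
  moreover have "integrable_distribution A (image_distribution (m_op \<alpha> \<beta> K F)) \<longleftrightarrow>
      (\<forall>c\<in>A. \<forall>p\<in>cdom c. involutive_at (M c p) (endo_deriv M c p))"
    using involutive_imp_integrable[OF M_tensor F_L_props(6) MM]
      integrable_imp_involutive[OF M_tensor F_L_props(6) MM] by blast
  ultimately show ?thesis using nijenhuis_l_iff_involutive by simp
qed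

end

theorem theorem5p11:
  fixes A :: "('a::{t2_space, second_countable_topology}, 'n::finite) chart set"
    and F :: "('a, 'n, real) endo_field"
    and K r :: nat and \<alpha> \<beta> :: complex
    and l m F\<^sub>C :: "('a, 'n, complex) endo_field"
  assumes "F_structure_manifold A K \<alpha> \<beta> r F"
    and l: "l = l_op \<alpha> \<beta> K F"
    and m: "m = m_op \<alpha> \<beta> K F"
    and F\<^sub>C: "F\<^sub>C = cendo F"
  shows "((integrable_operator A l \<and> integrable_operator A m)
          \<longleftrightarrow> (integrable_distribution A (image_distribution l) \<and>
               integrable_distribution A (image_distribution m)))
       \<and> ((integrable_distribution A (image_distribution l) \<and>
               integrable_distribution A (image_distribution m))
          \<longleftrightarrow> nijenhuis_vanishes A l)
       \<and> (nijenhuis_vanishes A l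
          \<longleftrightarrow> (\<forall>X Y. vector_field A X \<longrightarrow> vector_field A Y \<longrightarrow>
                (\<forall>c\<in>A. \<forall>p\<in>cdom c.
                   nijenhuis F\<^sub>C (cfield X) (cfield Y) c p
                   = app l (nijenhuis F\<^sub>C (app l (cfield X)) (app l (cfield Y))) c p
                     + nijenhuis F\<^sub>C (app l (cfield X)) (app m (cfield Y)) c p
                     + nijenhuis F\<^sub>C (app m (cfield X)) (app l (cfield Y)) c p)))"
proof -
  interpret F_structure A K \<alpha> \<beta> r F
    using assms(1) by unfold_locales (simp_all add: F_structure_manifold_def)
  have "integrable_operator A l \<and> integrable_operator A m \<longleftrightarrow> nijenhuis_vanishes A l"
    using nijenhuis_l_iff_m by (simp add: integrable_operator_def l m)
  moreover have "integrable_distribution A (image_distribution l) \<and>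
      integrable_distribution A (image_distribution m) \<longleftrightarrow> nijenhuis_vanishes A l"
    unfolding l m by (rule integrable_distributions_iff)
  ultimately show ?thesis
    using nijenhuis_F_iff[OF l m F\<^sub>C] by (intro conjI) simp_all
qed

end
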